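(* Let $M$ be a closed surface and let $f \in \mathrm{Diff}^{1+\alpha}(M)$ with $\alpha > 0$. If $f$ permutes a dense collection of domains with bounded geometry, then $f$ has zero topological entropy, i.e. $h_{\mathrm{top}}(f) = 0$.
   Context: A closed surface $M$ is a smooth, closed (compact, connected, without boundary), oriented Riemannian two-manifold, equipped with the canonical metric $g$ induced from the standard conformal metric of its universal cover $\mathbb{P}^1$, $\mathbb{C}$ or $\mathbb{D}^2$ (round, Euclidean, or hyperbolic, respectively); $d$ is the distance function of $g$, and $B(p,r)$ is the $d$-ball centered at $p$ of radius $r$. $\mathrm{Homeo}(M)$ is the group of homeomorphisms of $M$. $\mathrm{Diff}^r(M)$ is the group of diffeomorphisms of $M$ of class $C^r$: continuously differentiable up to order $[r]$, with $[r]$-th derivative $(r)$-Hölder, where $[r]$ and $(r)$ are the integral and fractional parts of $r$. Permuting a dense collection of domains: let $S \subset M$ be compact and let $\mathcal{D} = \{D_k\}_{k\in\mathbb{Z}}$ be the collection of connected components of $M \setminus S$, with the property that $\mathrm{Int}(\mathrm{Cl}(D_k)) = D_k$ for all $k$ (Int and Cl are interior and closure in $M$; distinct indices correspond to distinct components). A homeomorphism $f \in \mathrm{Homeo}(M)$ permutes a dense collection of domains (namely $\mathcal{D}$) if (1) $f(S) = S$ and $\mathrm{Cl}(D_k) \cap \mathrm{Cl}(D_{k'}) = \emptyset$ whenever $k \neq k'$; (2) for every $k \in \mathbb{Z}$, $f^n(D_k) \cap D_k = \emptyset$ for all $n \neq 0$; (3) $\bigcup_{k\in\mathbb{Z}}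 D_k$ is dense in $M$. Bounded geometry: a collection of domains $\{D_k\}_{k\in\mathbb{Z}}$ on $M$ has bounded geometry if each $\mathrm{Cl}(D_k)$ is contractible in $M$, meaning it is contained in an embedded topological disk in $M$, and there is a constant $\beta \ge 1$ such that for every $k$ there exist $p_k \in D_k$ and $0 < r_k \le R_k$ with $B(p_k,r_k) \subseteq D_k \subseteq B(p_k,R_k)$ and $R_k/r_k \le \beta$. Topological entropy: for $n \ge 1$ let $d_n(x,y) = \max_{1\le i\le n} d(f^i(x), f^i(y))$. A subset $U \subset M$ is $(n,\epsilon)$ separated if $d_n(x,y) \ge \epsilon$ for all $x \neq y$ in $U$; $N(n,\epsilon)$ is the maximum cardinality of an $(n,\epsilon)$ separated set; and $h_{\mathrm{top}}(f) = \lim_{\epsilon\to 0} \limsup_{n\to\infty} \frac1n \log N(n,\epsilon)$. *)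

theory Defs
  imports "HOL-Analysis.Analysis"
begin

section \<open>Functions of class C^r on open sets\<close>

text \<open>For \<open>s = 0\<close> the condition is local boundedness, hence no restriction on a continuous map
  (recall that \<open>0 powr 0 = 0\<close>).\<close>

definition locally_hoelder_on ::
    "real \<Rightarrow> 'a::metric_space set \<Rightarrow> ('a \<Rightarrow> 'b::metric_space) \<Rightarrow> bool" where
  "locally_hoelder_on s W F \<longleftrightarrow>
     (\<forall>x\<in>W. \<exists>e>0. \<exists>C. \<forall>y\<in>W \<inter> ball x e. \<forall>z\<in>W \<inter> ball x e. dist (F y) (F z) \<le> C * dist y z powr s)"

text \<open>\<open>k\<close> times continuously differentiable with locally \<open>s\<close>-Hoelder derivatives of order \<open>k\<close>;
  meant for open \<open>W\<close> in a finite-dimensional space, where it suffices to speak about iterated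
  directional derivatives.\<close>

primrec hoelder_diff_on :: "nat \<Rightarrow> real \<Rightarrow> 'a::real_normed_vector set \<Rightarrow>
    ('a \<Rightarrow> 'b::real_normed_vector) \<Rightarrow> bool" where
  "hoelder_diff_on 0 s W F \<longleftrightarrow> continuous_on W F \<and> locally_hoelder_on s W F"
| "hoelder_diff_on (Suc k) s W F \<longleftrightarrow>
     F differentiable_on W \<and> (\<forall>v. hoelder_diff_on k s W (\<lambda>x. frechet_derivative F (at x) v))"

definition class_C_on :: "real \<Rightarrow> 'a::real_normed_vector set \<Rightarrow>
    ('a \<Rightarrow> 'b::real_normed_vector) \<Rightarrow> bool" where
  "class_C_on r W F \<longleftrightarrow> hoelder_diff_on (nat \<lfloor>r\<rfloor>) (frac r) W F"

definition smooth_on :: "'a::real_normed_vector set \<Rightarrow> ('a \<Rightarrow> 'b::real_normed_vector) \<Rightarrow> bool" where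
  "smooth_on W F \<longleftrightarrow> (\<forall>k::nat. class_C_on (real k) W F)"


section \<open>Oriented Riemannian surfaces\<close>

text \<open>A chart is a pair of a domain and a coordinate map into the plane, identified with the
  complex numbers; tangent vectors are given by their coordinates in a chart. The values of the
  coordinate map outside the domain are irrelevant.\<close>

type_synonym 'a chart = "'a set \<times> ('a \<Rightarrow> complex)"

type_synonym 'a metric_tensor = "'a chart \<Rightarrow> 'a \<Rightarrow> complex \<Rightarrow> complex \<Rightarrow> real"

definition chart_rep :: "'a chart \<Rightarrow> 'b chart \<Rightarrow> ('a \<Rightarrow> 'b) \<Rightarrow> complex \<Rightarrow> complex" where
  "chart_rep c c' F = snd c' \<circ> F \<circ> inv_into (fst c) (snd c)"

definition chart_rep_dom :: "'a chart \<Rightarrow> 'b chart \<Rightarrow> ('a \<Rightarrow> 'b) \<Rightarrow> complex set" where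
  "chart_rep_dom c c' F = snd c ` (fst c \<inter> F -` fst c')"

definition chart_deriv :: "'a chart \<Rightarrow> 'b chart \<Rightarrow> ('a \<Rightarrow> 'b) \<Rightarrow> 'a \<Rightarrow> complex \<Rightarrow> complex" where
  "chart_deriv c c' F p = frechet_derivative (chart_rep c c' F) (at (snd c p))"

definition surface_map_class_C :: "real \<Rightarrow> 'a chart set \<Rightarrow> 'b chart set \<Rightarrow> ('a \<Rightarrow> 'b) \<Rightarrow> bool" where
  "surface_map_class_C r A B F \<longleftrightarrow>
     (\<forall>c\<in>A. \<forall>c'\<in>B. class_C_on r (chart_rep_dom c c' F) (chart_rep c c' F))"

definition surface_map_smooth :: "'a chart set \<Rightarrow> 'b chart set \<Rightarrow> ('a \<Rightarrow> 'b) \<Rightarrow> bool" where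
  "surface_map_smooth A B F \<longleftrightarrow>
     (\<forall>c\<in>A. \<forall>c'\<in>B. smooth_on (chart_rep_dom c c' F) (chart_rep c c' F))"

text \<open>The inequality says that the real \<open>2 \<times> 2\<close> determinant of \<open>L\<close> is positive.\<close>

definition surface_map_orientation_preserving ::
    "'a chart set \<Rightarrow> 'b chart set \<Rightarrow> ('a \<Rightarrow> 'b) \<Rightarrow> bool" where
  "surface_map_orientation_preserving A B F \<longleftrightarrow>
     (\<forall>c\<in>A. \<forall>c'\<in>B. \<forall>p\<in>fst c \<inter> F -` fst c'.
        let L = chart_deriv c c' F p in Re (L 1) * Im (L \<i>) - Im (L 1) * Re (L \<i>) > 0)"

definition surface_map_isometric :: "'a chart set \<Rightarrow> 'a metric_tensor \<Rightarrow>
    'b chart set \<Rightarrow> 'b metric_tensor \<Rightarrow> ('a \<Rightarrow> 'b) \<Rightarrow> bool" where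
  "surface_map_isometric A g B h F \<longleftrightarrow>
     (\<forall>c\<in>A. \<forall>c'\<in>B. \<forall>p\<in>fst c \<inter> F -` fst c'. \<forall>v w.
        h c' (F p) (chart_deriv c c' F p v) (chart_deriv c c' F p w) = g c p v w)"

text \<open>Surfaces carry the subspace topology of an ambient Hausdorff type. Second countability is
  not required, since it is automatic in the compact case.\<close>

locale oriented_surface =
  fixes M :: "'a::t2_space set" and A :: "'a chart set"
  assumes charts_cover: "(\<Union>c\<in>A. fst c) = M"
    and chart_domain_open: "c \<in> A \<Longrightarrow> openin (top_of_set M) (fst c)"
    and chart_range_open: "c \<in> A \<Longrightarrow> open (snd c ` fst c)"
    and chart_homeomorphism:
      "c \<in> A \<Longrightarrow> homeomorphism (fst c) (snd c ` fst c) (snd c) (inv_into (fst c) (snd c))"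
    and transitions_smooth: "surface_map_smooth A A id"
    and transitions_oriented: "surface_map_orientation_preserving A A id"

locale riemannian_surface = oriented_surface M A
  for M :: "'a::t2_space set" and A :: "'a chart set" +
  fixes g :: "'a metric_tensor"
  assumes metric_bilinear: "c \<in> A \<Longrightarrow> p \<in> fst c \<Longrightarrow> bilinear (g c p)"
    and metric_symmetric: "c \<in> A \<Longrightarrow> p \<in> fst c \<Longrightarrow> g c p v w = g c p w v"
    and metric_positive: "c \<in> A \<Longrightarrow> p \<in> fst c \<Longrightarrow> v \<noteq> 0 \<Longrightarrow> g c p v v > 0"
    and metric_smooth:
      "c \<in> A \<Longrightarrow> smooth_on (snd c ` fst c) (\<lambda>z. g c (inv_into (fst c) (snd c) z) v w)"
    and metric_compatible: "surface_map_isometric A g A g id"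

text \<open>\<open>path_length A g p q l\<close>: some piecewise continuously differentiable path from \<open>p\<close> to \<open>q\<close>
  has length \<open>l\<close>; each step appends one \<open>C\<^sup>1\<close> arc \<open>\<gamma>\<close> inside a chart domain.\<close>

inductive path_length :: "'a chart set \<Rightarrow> 'a metric_tensor \<Rightarrow> 'a \<Rightarrow> 'a \<Rightarrow> real \<Rightarrow> bool"
  for A :: "'a chart set" and g :: "'a metric_tensor" where
  path_length_const: "path_length A g p p 0"
| path_length_append:
    "path_length A g p (\<gamma> a) l \<Longrightarrow> c \<in> A \<Longrightarrow> a < b \<Longrightarrow> \<gamma> ` {a..b} \<subseteq> fst c \<Longrightarrow>
     (\<forall>t\<in>{a..b}. (snd c \<circ> \<gamma> has_vector_derivative v t) (at t within {a..b})) \<Longrightarrow>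
     continuous_on {a..b} v \<Longrightarrow>
     path_length A g p (\<gamma> b) (l + integral {a..b} (\<lambda>t. sqrt (g c (\<gamma> t) (v t) (v t))))"

definition riemannian_dist :: "'a chart set \<Rightarrow> 'a metric_tensor \<Rightarrow> 'a \<Rightarrow> 'a \<Rightarrow> real" where
  "riemannian_dist A g p q = Inf {l. path_length A g p q l}"


section \<open>The round sphere, the Euclidean plane and the hyperbolic disk\<close>

text \<open>The complex projective line is the unit sphere, with the stereographic coordinate \<open>z\<close> from
  the pole \<open>(0, 1)\<close> and the coordinate \<open>1/z\<close>, which is the conjugate of the stereographic
  coordinate from the other pole. All three metrics have the form \<open>\<lambda>(z)\<^sup>2 |dz|\<^sup>2\<close>, with
  curvature \<open>1\<close>, \<open>0\<close> and \<open>-1\<close>.\<close>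

definition sphere_carrier :: "(complex \<times> real) set" where
  "sphere_carrier = sphere 0 1"

definition sphere_atlas :: "(complex \<times> real) chart set" where
  "sphere_atlas =
     {(sphere_carrier - {(0, 1)}, \<lambda>(w, t). w / of_real (1 - t)),
      (sphere_carrier - {(0, -1)}, \<lambda>(w, t). cnj w / of_real (1 + t))}"

definition sphere_metric :: "(complex \<times> real) metric_tensor" where
  "sphere_metric c p v w = (2 / (1 + (cmod (snd c p))\<^sup>2))\<^sup>2 * (v \<bullet> w)"

definition plane_carrier :: "complex set" where
  "plane_carrier = UNIV"

definition plane_atlas :: "complex chart set" where
  "plane_atlas = {(plane_carrier, id)}"

definition plane_metric :: "complex metric_tensor" where
  "plane_metric c p v w = v \<bullet> w"

definition disk_carrier :: "complex set" where
  "disk_carrier = ball 0 1"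

definition disk_atlas :: "complex chart set" where
  "disk_atlas = {(disk_carrier, id)}"

definition disk_metric :: "complex metric_tensor" where
  "disk_metric c p v w = (2 / (1 - (cmod (snd c p))\<^sup>2))\<^sup>2 * (v \<bullet> w)"


section \<open>Closed surfaces with their canonical metric\<close>

definition riemannian_covering ::
    "'b::t2_space set \<Rightarrow> 'b chart set \<Rightarrow> 'b metric_tensor \<Rightarrow> ('b \<Rightarrow> 'a::t2_space) \<Rightarrow>
     'a set \<Rightarrow> 'a chart set \<Rightarrow> 'a metric_tensor \<Rightarrow> bool" where
  "riemannian_covering N B h \<pi> M A g \<longleftrightarrow>
     covering_space N \<pi> M \<and> surface_map_smooth B A \<pi> \<and>
     surface_map_orientation_preserving B A \<pi> \<and> surface_map_isometric B h A g \<pi>"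

text \<open>The three model surfaces are simply connected, so that \<open>\<pi>\<close> below is a universal covering.\<close>

definition canonical_metric ::
    "'a::t2_space set \<Rightarrow> 'a chart set \<Rightarrow> 'a metric_tensor \<Rightarrow> bool" where
  "canonical_metric M A g \<longleftrightarrow>
     (\<exists>\<pi>. riemannian_covering sphere_carrier sphere_atlas sphere_metric \<pi> M A g) \<or>
     (\<exists>\<pi>. riemannian_covering plane_carrier plane_atlas plane_metric \<pi> M A g) \<or>
     (\<exists>\<pi>. riemannian_covering disk_carrier disk_atlas disk_metric \<pi> M A g)"

locale closed_surface = riemannian_surface M A g
  for M :: "'a::t2_space set" and A :: "'a chart set" and g :: "'a metric_tensor" +
  assumes compact: "compact M"
    and connected: "connected M"
    and canonical: "canonical_metric M A g"

definition Homeo :: "'a::topological_space set \<Rightarrow> ('a \<Rightarrow> 'a) set" where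
  "Homeo M = {f. \<exists>f'. homeomorphism M M f f'}"

definition Diff :: "real \<Rightarrow> 'a::topological_space set \<Rightarrow> 'a chart set \<Rightarrow> ('a \<Rightarrow> 'a) set" where
  "Diff r M A = {f. \<exists>f'. homeomorphism M M f f' \<and>
     surface_map_class_C r A A f \<and> surface_map_class_C r A A f'}"


section \<open>Permuting a dense collection of domains\<close>

definition int_iterate :: "'a set \<Rightarrow> ('a \<Rightarrow> 'a) \<Rightarrow> int \<Rightarrow> 'a \<Rightarrow> 'a" where
  "int_iterate M f n = (if n \<ge> 0 then f ^^ nat n else inv_into M f ^^ nat (- n))"

abbreviation closure_in :: "'a::topological_space set \<Rightarrow> 'a set \<Rightarrow> 'a set" where
  "closure_in M X \<equiv> top_of_set M closure_of X"

abbreviation interior_in :: "'a::topological_space set \<Rightarrow> 'a set \<Rightarrow> 'a set" where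
  "interior_in M X \<equiv> top_of_set M interior_of X"

definition complementary_domains ::
    "'a::topological_space set \<Rightarrow> 'a set \<Rightarrow> (int \<Rightarrow> 'a set) \<Rightarrow> bool" where
  "complementary_domains M S D \<longleftrightarrow>
     S \<subseteq> M \<and> compact S \<and> inj D \<and> range D = components (M - S) \<and>
     (\<forall>k. interior_in M (closure_in M (D k)) = D k)"

definition permutes_dense_domains ::
    "'a::topological_space set \<Rightarrow> ('a \<Rightarrow> 'a) \<Rightarrow> 'a set \<Rightarrow> (int \<Rightarrow> 'a set) \<Rightarrow> bool" where
  "permutes_dense_domains M f S D \<longleftrightarrow>
     f \<in> Homeo M \<and> complementary_domains M S D \<and>
     f ` S = S \<and> (\<forall>k k'. k \<noteq> k' \<longrightarrow> closure_in M (D k) \<inter> closure_in M (D k') = {}) \<and>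
     (\<forall>k n. n \<noteq> 0 \<longrightarrow> int_iterate M f n ` D k \<inter> D k = {}) \<and>
     closure_in M (\<Union>k. D k) = M"

definition contractible_in :: "'a::topological_space set \<Rightarrow> 'a set \<Rightarrow> bool" where
  "contractible_in M X \<longleftrightarrow> (\<exists>E. X \<subseteq> E \<and> E \<subseteq> M \<and> E homeomorphic cball (0::complex) 1)"

definition dist_ball :: "'a set \<Rightarrow> ('a \<Rightarrow> 'a \<Rightarrow> real) \<Rightarrow> 'a \<Rightarrow> real \<Rightarrow> 'a set" where
  "dist_ball M d p r = {q \<in> M. d p q < r}"

definition bounded_geometry ::
    "'a::topological_space set \<Rightarrow> ('a \<Rightarrow> 'a \<Rightarrow> real) \<Rightarrow> (int \<Rightarrow> 'a set) \<Rightarrow> bool" where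
  "bounded_geometry M d D \<longleftrightarrow>
     (\<forall>k. contractible_in M (closure_in M (D k))) \<and>
     (\<exists>\<beta>\<ge>1. \<forall>k. \<exists>p\<in>D k. \<exists>r R. 0 < r \<and> r \<le> R \<and>
        dist_ball M d p r \<subseteq> D k \<and> D k \<subseteq> dist_ball M d p R \<and> R / r \<le> \<beta>)"


section \<open>Topological entropy\<close>

definition dyn_dist :: "('a \<Rightarrow> 'a \<Rightarrow> real) \<Rightarrow> ('a \<Rightarrow> 'a) \<Rightarrow> nat \<Rightarrow> 'a \<Rightarrow> 'a \<Rightarrow> real" where
  "dyn_dist d f n x y = (MAX i\<in>{1..n}. d ((f ^^ i) x) ((f ^^ i) y))"

definition separated_set ::
    "'a set \<Rightarrow> ('a \<Rightarrow> 'a \<Rightarrow> real) \<Rightarrow> ('a \<Rightarrow> 'a) \<Rightarrow> nat \<Rightarrow> real \<Rightarrow> 'a set \<Rightarrow> bool" where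
  "separated_set M d f n \<epsilon> U \<longleftrightarrow>
     U \<subseteq> M \<and> (\<forall>x\<in>U. \<forall>y\<in>U. x \<noteq> y \<longrightarrow> dyn_dist d f n x y \<ge> \<epsilon>)"

text \<open>On a compact space, with \<open>f\<close> continuous, \<open>n \<ge> 1\<close> and \<open>\<epsilon> > 0\<close>, the cardinalities of separated
  sets are bounded, so that the maximum exists.\<close>

definition max_separated ::
    "'a set \<Rightarrow> ('a \<Rightarrow> 'a \<Rightarrow> real) \<Rightarrow> ('a \<Rightarrow> 'a) \<Rightarrow> nat \<Rightarrow> real \<Rightarrow> nat" where
  "max_separated M d f n \<epsilon> = Max {card U |U. finite U \<and> separated_set M d f n \<epsilon> U}"

text \<open>The inner upper limit is monotone in \<open>\<epsilon>\<close>, so that the outer limit exists in the extended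
  reals.\<close>

definition topological_entropy :: "'a set \<Rightarrow> ('a \<Rightarrow> 'a \<Rightarrow> real) \<Rightarrow> ('a \<Rightarrow> 'a) \<Rightarrow> ereal" where
  "topological_entropy M d f =
     Lim (at_right 0)
       (\<lambda>\<epsilon>. limsup (\<lambda>n. ereal (1 / real n * ln (real (max_separated M d f n \<epsilon>)))))"

end

theory Submission
  imports Defs "HOL-Real_Asymp.Real_Asymp"
begin

text \<open>Fix an iterate \<open>F = f ^^ N\<close> and a point \<open>p\<close> of \<open>S\<close>. Arbitrarily small domains accumulate at \<open>p\<close>, and \<open>F\<close>
  maps them to domains. Domains and images are round up to the factor \<open>\<beta>\<close>, and near \<open>p\<close> the map is almost
  linear; hence the derivative of \<open>F\<close> at \<open>p\<close> is quasiconformal, with a constant \<open>K\<close> that depends neither on \<open>N\<close>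
  nor on \<open>p\<close> (\<open>uniformly_quasiconformal_iterates\<close>). Thus on \<open>S\<close> there is, up to \<open>K\<close>, a single
  expansion factor, and no direction can expand while another contracts.

  Conformal behaviour excludes entropy by an elementary count. Along the orbit of a point of \<open>S\<close>, let the
  product of the expansion factors from the start be largest at time \<open>j\<close>. Seen from time \<open>j\<close>, the map
  contracts towards the future, and its inverse contracts towards the past. Hence the orbit segment is
  determined by \<open>j\<close> and by the position at time \<open>j\<close> (\<open>orbit_segment_shadowed_from_peak\<close>). If
  the orbit is read in blocks of \<open>N\<close> steps, each block costs a factor \<open>K\<close> in precision; as a surface has
  box dimension 2, there are at most about \<open>n * K ^ (2 * n / N)\<close> distinguishable segments of length \<open>n\<close>.
  The number \<open>N\<close> is arbitrary, so that the growth is subexponential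
  (\<open>subexponentially_many_orbit_segments\<close>).

  Points outside \<open>S\<close> contribute nothing more. Such a point stays in a wandering domain and moves along
  with a boundary point of it, except while it visits one of the finitely many domains that are not
  small; each of these it visits at most once (\<open>few_separated_points\<close>).

  To apply this to the Riemannian distance, it suffices that the distance is comparable to the Euclidean
  distance in charts, with one constant for the compact surface (\<open>rdist_comparable_in_chart\<close>,
  \<open>uniform_coordinates\<close>).\<close>

section \<open>Paths on Riemannian surfaces\<close>

lemma smooth_on_imp_continuous_on: "smooth_on W F \<Longrightarrow> continuous_on W F"
proof -
  assume "smooth_on W F"
  then have "class_C_on (real 0) W F" unfolding smooth_on_def by blast
  then show ?thesis by (simp add: class_C_on_def)
qed

lemma smooth_on_imp_differentiable_on: "smooth_on W F \<Longrightarrow> F differentiable_on W"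
proof -
  assume "smooth_on W F"
  then have "class_C_on (real (Suc 0)) W F" unfolding smooth_on_def by blast
  then show ?thesis by (simp add: class_C_on_def)
qed

context oriented_surface
begin

lemma chart_subset: "c \<in> A \<Longrightarrow> fst c \<subseteq> M"
  using charts_cover by blast

lemma obtain_chart:
  assumes "p \<in> M"
  obtains c where "c \<in> A" "p \<in> fst c"
  using assms charts_cover by blast

lemma chart_inv: "c \<in> A \<Longrightarrow> p \<in> fst c \<Longrightarrow> inv_into (fst c) (snd c) (snd c p) = p"
  using chart_homeomorphism[of c] by (auto simp: homeomorphism_def)

lemma inv_chart: "z \<in> snd c ` fst c \<Longrightarrow> snd c (inv_into (fst c) (snd c) z) = z"
  by (rule f_inv_into_f)

lemma inv_chart_in: "z \<in> snd c ` fst c \<Longrightarrow> inv_into (fst c) (snd c) z \<in> fst c"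
  by (rule inv_into_into)

lemma continuous_on_chart: "c \<in> A \<Longrightarrow> continuous_on (fst c) (snd c)"
  using chart_homeomorphism[of c] by (auto simp: homeomorphism_def)

lemma continuous_on_inv_chart:
  "c \<in> A \<Longrightarrow> continuous_on (snd c ` fst c) (inv_into (fst c) (snd c))"
  using chart_homeomorphism[of c] by (auto simp: homeomorphism_def)

lemma open_chart_image:
  assumes "c \<in> A" "openin (top_of_set M) U" "U \<subseteq> fst c"
  shows "open (snd c ` U)"
proof -
  have "openin (top_of_set (fst c)) U"
    by (rule openin_subset_trans[OF assms(2,3) chart_subset[OF assms(1)]])
  then have "openin (top_of_set (snd c ` fst c)) (snd c ` U)"
    by (rule homeomorphism_imp_open_map[OF chart_homeomorphism[OF assms(1)]])
  then show ?thesis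
    using chart_range_open[OF assms(1)] by (rule openin_open_trans)
qed

lemma open_chart_preimage:
  assumes "c \<in> A" "open V"
  shows "openin (top_of_set M) {q \<in> fst c. snd c q \<in> V}"
proof -
  have "openin (top_of_set (fst c)) (fst c \<inter> snd c -` V)"
    by (rule continuous_openin_preimage_gen[OF continuous_on_chart[OF assms(1)] assms(2)])
  then have "openin (top_of_set M) (fst c \<inter> snd c -` V)"
    using chart_domain_open[OF assms(1)] by (rule openin_trans)
  moreover have "fst c \<inter> snd c -` V = {q \<in> fst c. snd c q \<in> V}" by auto
  ultimately show ?thesis by simp
qed

lemma open_chart_rep_dom:
  assumes "c \<in> A" "c' \<in> A" "continuous_on M F" "F ` M \<subseteq> M"
  shows "open (chart_rep_dom c c' F)"
proof -
  have "openin (top_of_set M) (M \<inter> F -` fst c')"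
    by (rule continuous_openin_preimage[OF assms(3) _ chart_domain_open[OF assms(2)]]) (use assms in auto)
  then have "openin (top_of_set M) (fst c \<inter> (M \<inter> F -` fst c'))"
    by (rule openin_Int[OF chart_domain_open[OF assms(1)]])
  moreover have "fst c \<inter> (M \<inter> F -` fst c') = fst c \<inter> F -` fst c'"
    using chart_subset[OF assms(1)] by auto
  ultimately have "openin (top_of_set M) (fst c \<inter> F -` fst c')" by simp
  then show ?thesis
    unfolding chart_rep_dom_def by (rule open_chart_image[OF assms(1)]) blast
qed

lemma chart_rep_apply: "c \<in> A \<Longrightarrow> p \<in> fst c \<Longrightarrow> chart_rep c c' F (snd c p) = snd c' (F p)"
  by (simp add: chart_rep_def chart_inv)

lemma transition_has_derivative:
  assumes "c \<in> A" "c' \<in> A" "p \<in> fst c" "p \<in> fst c'"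
  shows "(chart_rep c c' id has_derivative chart_deriv c c' id p) (at (snd c p))"
proof -
  have "chart_rep c c' id differentiable_on chart_rep_dom c c' id"
    using transitions_smooth assms smooth_on_imp_differentiable_on
    unfolding surface_map_smooth_def by blast
  moreover have "snd c p \<in> chart_rep_dom c c' id"
    using assms by (auto simp: chart_rep_dom_def)
  moreover have "open (chart_rep_dom c c' id)"
    by (rule open_chart_rep_dom) (use assms in auto)
  ultimately have "chart_rep c c' id differentiable at (snd c p)"
    using differentiable_on_eq_differentiable_at by blast
  then show ?thesis
    by (simp add: chart_deriv_def frechet_derivative_works)
qed

end

context riemannian_surface
begin

text \<open>Smoothness of the metric is a statement about its coefficients for fixed vectors; this
  formula turns it into joint continuity in the base point and the vector.\<close>

lemma metric_expand:
  assumes "c \<in> A" "p \<in> fst c"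
  shows "g c p v v = (Re v)\<^sup>2 * g c p 1 1 + 2 * (Re v * Im v * g c p 1 \<i>) + (Im v)\<^sup>2 * g c p \<i> \<i>"
proof -
  have v: "v = Re v *\<^sub>R 1 + Im v *\<^sub>R \<i>"
    by (simp add: complex_eq_iff)
  note b = metric_bilinear[OF assms]
  have "g c p v v = g c p (Re v *\<^sub>R 1 + Im v *\<^sub>R \<i>) (Re v *\<^sub>R 1 + Im v *\<^sub>R \<i>)"
    using v by simp
  also have "\<dots> = (Re v)\<^sup>2 * g c p 1 1 + 2 * (Re v * Im v * g c p 1 \<i>) + (Im v)\<^sup>2 * g c p \<i> \<i>"
    using metric_symmetric[OF assms, of \<i> 1]
    by (simp add: bilinear_ladd[OF b] bilinear_radd[OF b] bilinear_lmul[OF b] bilinear_rmul[OF b]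
        power2_eq_square algebra_simps)
  finally show ?thesis .
qed

lemma metric_nonneg:
  assumes "c \<in> A" "p \<in> fst c"
  shows "g c p v v \<ge> 0"
proof (cases "v = 0")
  case True
  then show ?thesis
    using metric_expand[OF assms, of v] by simp
next
  case False
  then show ?thesis
    using metric_positive[OF assms] less_imp_le by blast
qed

lemma continuous_on_metric_coeff:
  assumes "c \<in> A"
  shows "continuous_on (fst c) (\<lambda>p. g c p v w)"
proof -
  have "continuous_on (snd c ` fst c) (\<lambda>z. g c (inv_into (fst c) (snd c) z) v w)"
    using metric_smooth[OF assms] smooth_on_imp_continuous_on by blast
  then have "continuous_on (fst c) (\<lambda>p. g c (inv_into (fst c) (snd c) (snd c p)) v w)"
    using continuous_on_compose2[OF _ continuous_on_chart[OF assms]] by auto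
  then show ?thesis
    by (rule continuous_on_eq) (simp add: chart_inv[OF assms])
qed

lemma continuous_on_metric:
  assumes "c \<in> A" "continuous_on T \<gamma>" "continuous_on T v" "\<gamma> ` T \<subseteq> fst c"
  shows "continuous_on T (\<lambda>t. g c (\<gamma> t) (v t) (v t))"
proof -
  have k: "continuous_on T (\<lambda>t. g c (\<gamma> t) x y)" for x y
    using continuous_on_compose2[OF continuous_on_metric_coeff[OF assms(1)] assms(2) assms(4)] .
  have "continuous_on T (\<lambda>t. (Re (v t))\<^sup>2 * g c (\<gamma> t) 1 1
      + 2 * (Re (v t) * Im (v t) * g c (\<gamma> t) 1 \<i>) + (Im (v t))\<^sup>2 * g c (\<gamma> t) \<i> \<i>)"
    by (intro continuous_intros k assms)
  then show ?thesis
    by (rule continuous_on_eq) (rule metric_expand[symmetric], use assms in auto)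
qed

text \<open>The norm of the metric is positive and continuous on the compact product of a disk with the
  unit circle, and homogeneous in the vector.\<close>

lemma chart_metric_bounds:
  assumes c: "c \<in> A" and p: "p \<in> fst c"
  obtains R a b where "R > 0" "cball (snd c p) R \<subseteq> snd c ` fst c" "a > 0" "b > 0"
    "\<And>q v. q \<in> fst c \<Longrightarrow> snd c q \<in> cball (snd c p) R \<Longrightarrow> a * norm v \<le> sqrt (g c q v v)"
    "\<And>q v. q \<in> fst c \<Longrightarrow> snd c q \<in> cball (snd c p) R \<Longrightarrow> sqrt (g c q v v) \<le> b * norm v"
proof -
  obtain R where R: "R > 0" "cball (snd c p) R \<subseteq> snd c ` fst c"
    using chart_range_open[OF c] p unfolding open_contains_cball by (meson imageI)
  define T where "T = cball (snd c p) R \<times> sphere (0::complex) 1"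
  define G where "G = (\<lambda>x. sqrt (g c (inv_into (fst c) (snd c) (fst x)) (snd x) (snd x)))"
  have cont: "continuous_on T G"
    unfolding G_def
  proof (intro continuous_intros continuous_on_metric[OF c])
    have "continuous_on (fst ` T) (inv_into (fst c) (snd c))"
      by (rule continuous_on_subset[OF continuous_on_inv_chart[OF c]]) (use R in \<open>auto simp: T_def\<close>)
    then show "continuous_on T (\<lambda>x. inv_into (fst c) (snd c) (fst x))"
      by (rule continuous_on_compose2[OF _ continuous_on_fst[OF continuous_on_id]]) simp
    show "(\<lambda>x. inv_into (fst c) (snd c) (fst x)) ` T \<subseteq> fst c"
    proof (rule image_subsetI)
      fix x assume "x \<in> T"
      then have "fst x \<in> cball (snd c p) R" unfolding T_def by (simp add: mem_Times_iff)
      then have "fst x \<in> snd c ` fst c" by (rule subsetD[OF R(2)])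
      then show "inv_into (fst c) (snd c) (fst x) \<in> fst c" by (rule inv_chart_in)
    qed
  qed
  have comp: "compact T" unfolding T_def by (intro compact_Times compact_cball compact_sphere)
  have ne: "T \<noteq> {}" using R unfolding T_def by auto
  obtain x where x: "x \<in> T" "\<And>y. y \<in> T \<Longrightarrow> G x \<le> G y"
    using continuous_attains_inf[OF comp ne cont] by blast
  obtain y where y: "y \<in> T" "\<And>x. x \<in> T \<Longrightarrow> G x \<le> G y"
    using continuous_attains_sup[OF comp ne cont] by blast
  have pos: "G x > 0"
  proof -
    have "snd x \<noteq> 0" using x(1) unfolding T_def by auto
    moreover have "fst x \<in> snd c ` fst c"
      by (rule subsetD[OF R(2)]) (use x(1) in \<open>simp add: T_def mem_Times_iff\<close>)
    ultimately show ?thesis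
      using metric_positive[OF c inv_chart_in] unfolding G_def by simp
  qed
  have homog: "sqrt (g c q v v) = norm v * G (snd c q, v /\<^sub>R norm v)"
    if q: "q \<in> fst c" and v: "v \<noteq> 0" for q v
  proof -
    note b = metric_bilinear[OF c q]
    have "g c q v v = (norm v)\<^sup>2 * g c q (v /\<^sub>R norm v) (v /\<^sub>R norm v)"
      unfolding bilinear_lmul[OF b] bilinear_rmul[OF b] using v by (simp add: power2_eq_square field_simps)
    then show ?thesis
      unfolding G_def by (simp add: real_sqrt_mult chart_inv[OF c q])
  qed
  have inT: "(snd c q, v /\<^sub>R norm v) \<in> T"
    if "q \<in> fst c" "snd c q \<in> cball (snd c p) R" "v \<noteq> 0" for q v
    using that unfolding T_def by simp
  have zero: "g c q 0 0 = 0" if "q \<in> fst c" for q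
    using metric_expand[OF c that, of 0] by simp
  show ?thesis
  proof (rule that[OF R pos, of "G y"])
    show "0 < G y" using pos x(2)[OF y(1)] by simp
  next
    fix q v assume q: "q \<in> fst c" "snd c q \<in> cball (snd c p) R"
    show "G x * norm v \<le> sqrt (g c q v v)"
    proof (cases "v = 0")
      case False
      then show ?thesis using homog[OF q(1) False] x(2)[OF inT[OF q False]]
        by (simp add: mult.commute)
    qed (use zero q in simp)
    show "sqrt (g c q v v) \<le> G y * norm v"
    proof (cases "v = 0")
      case False
      then show ?thesis using homog[OF q(1) False] y(2)[OF inT[OF q False]]
        by (simp add: mult.commute)
    qed (use zero q in simp)
  qed
qed

lemma arc_continuous:
  assumes "c \<in> A" "\<gamma> ` {a..b} \<subseteq> fst c"
    "\<forall>t\<in>{a..b}. (snd c \<circ> \<gamma> has_vector_derivative v t) (at t within {a..b})"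
  shows "continuous_on {a..b} \<gamma>"
proof -
  have "continuous_on {a..b} (snd c \<circ> \<gamma>)"
    using assms(3) has_vector_derivative_continuous continuous_on_eq_continuous_within by blast
  moreover have "(snd c \<circ> \<gamma>) ` {a..b} \<subseteq> snd c ` fst c" using assms(2) by auto
  ultimately have "continuous_on {a..b} (\<lambda>t. inv_into (fst c) (snd c) ((snd c \<circ> \<gamma>) t))"
    using continuous_on_compose2[OF continuous_on_inv_chart[OF assms(1)]] by blast
  then show ?thesis
    by (rule continuous_on_eq) (use assms(2) chart_inv[OF assms(1)] in \<open>simp add: image_subset_iff\<close>)
qed

lemma arc_speed_continuous:
  assumes "c \<in> A" "\<gamma> ` {a..b} \<subseteq> fst c"
    "\<forall>t\<in>{a..b}. (snd c \<circ> \<gamma> has_vector_derivative v t) (at t within {a..b})"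
    "continuous_on {a..b} v"
  shows "continuous_on {a..b} (\<lambda>t. sqrt (g c (\<gamma> t) (v t) (v t)))"
  by (intro continuous_intros continuous_on_metric[OF assms(1)] arc_continuous[OF assms(1-3)] assms)

lemma path_length_nonneg: "path_length A g p q l \<Longrightarrow> l \<ge> 0"
proof (induction rule: path_length.induct)
  case (path_length_append p \<gamma> a l c b v)
  have "0 \<le> g c (\<gamma> t) (v t) (v t)" if "t \<in> {a..b}" for t
    using metric_nonneg[of c] path_length_append.hyps that by (simp add: image_subset_iff)
  then have "0 \<le> integral {a..b} (\<lambda>t. sqrt (g c (\<gamma> t) (v t) (v t)))"
    by (intro Henstock_Kurzweil_Integration.integral_nonneg
        integrable_continuous_interval arc_speed_continuous)
      (use path_length_append.hyps in simp_all)
  then show ?case using path_length_append by simp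
qed simp

lemma path_length_trans:
  assumes "path_length A g q r l'" "path_length A g p q l"
  shows "path_length A g p r (l + l')"
  using assms
proof (induction rule: path_length.induct)
  case (path_length_append q \<gamma> a l' c b v)
  from path_length.path_length_append[OF path_length_append.IH[OF path_length_append.prems]
      path_length_append.hyps(2-6)]
  show ?case by (simp add: add.assoc)
qed simp

lemma path_length_reverse: "path_length A g p q l \<Longrightarrow> path_length A g q p l"
proof (induction rule: path_length.induct)
  case (path_length_const p)
  then show ?case by (rule path_length.path_length_const)
next
  case (path_length_append p \<gamma> a l c b v)
  note h = path_length_append.hyps
  have img: "uminus ` {-b..-a} = {a..b}" by auto
  have im: "(\<gamma> \<circ> uminus) ` {-b..-a} \<subseteq> fst c" using h by auto
  have der: "\<forall>t\<in>{-b..-a}. (snd c \<circ> (\<gamma> \<circ> uminus) has_vector_derivative - v (- t)) (at t within {-b..-a})"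
  proof
    fix t assume t: "t \<in> {-b..-a}"
    have "(uminus has_vector_derivative - 1) (at t within {-b..-a})"
      by (auto intro!: derivative_eq_intros)
    moreover have "(snd c \<circ> \<gamma> has_vector_derivative v (-t)) (at (-t) within uminus ` {-b..-a})"
      using h t unfolding img by auto
    ultimately have "((snd c \<circ> \<gamma>) \<circ> uminus has_vector_derivative (-1) *\<^sub>R v (- t)) (at t within {-b..-a})"
      by (rule vector_diff_chain_within)
    then show "(snd c \<circ> (\<gamma> \<circ> uminus) has_vector_derivative - v (- t)) (at t within {-b..-a})"
      by (simp add: o_assoc)
  qed
  have cont: "continuous_on {-b..-a} (\<lambda>t. - v (-t))"
    by (intro continuous_intros continuous_on_compose2[OF h(6)]) auto
  have "path_length A g ((\<gamma> \<circ> uminus) (-b)) ((\<gamma> \<circ> uminus) (-a))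
     (0 + integral {-b..-a} (\<lambda>t. sqrt (g c ((\<gamma> \<circ> uminus) t) (- v (-t)) (- v (-t)))))"
    by (rule path_length.path_length_append[OF path_length.path_length_const h(2) _ im der cont])
      (use h in simp)
  moreover have "integral {-b..-a} (\<lambda>t. sqrt (g c ((\<gamma> \<circ> uminus) t) (- v (-t)) (- v (-t))))
      = integral {-b..-a} (\<lambda>t. sqrt (g c (\<gamma> (-t)) (v (-t)) (v (-t))))"
  proof (rule integral_cong)
    fix t assume "t \<in> {-b..-a}"
    then have "\<gamma> (-t) \<in> fst c" using im by auto
    then show "sqrt (g c ((\<gamma> \<circ> uminus) t) (- v (-t)) (- v (-t))) = sqrt (g c (\<gamma> (-t)) (v (-t)) (v (-t)))"
      by (simp add: bilinear_lneg[OF metric_bilinear[OF h(2)]] bilinear_rneg[OF metric_bilinear[OF h(2)]])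
  qed
  moreover have "\<dots> = integral {a..b} (\<lambda>t. sqrt (g c (\<gamma> t) (v t) (v t)))"
    by (rule Henstock_Kurzweil_Integration.integral_reflect_real[of b a "\<lambda>t. sqrt (g c (\<gamma> t) (v t) (v t))"])
  ultimately have "path_length A g (\<gamma> b) (\<gamma> a) (integral {a..b} (\<lambda>t. sqrt (g c (\<gamma> t) (v t) (v t))))"
    by simp
  from path_length_trans[OF path_length_append.IH this] show ?case by (simp add: add.commute)
qed

lemma path_length_segment:
  assumes c: "c \<in> A" and x: "x \<in> fst c" "y \<in> fst c"
    and B: "cball z R \<subseteq> snd c ` fst c" "snd c x \<in> cball z R" "snd c y \<in> cball z R"
    and b: "\<And>q v. q \<in> fst c \<Longrightarrow> snd c q \<in> cball z R \<Longrightarrow> sqrt (g c q v v) \<le> b * norm v"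
  obtains l where "path_length A g x y l" "l \<le> b * norm (snd c y - snd c x)"
proof -
  define s where "s = (\<lambda>t::real. snd c x + t *\<^sub>R (snd c y - snd c x))"
  define \<gamma> where "\<gamma> = (\<lambda>t. inv_into (fst c) (snd c) (s t))"
  have s: "s t \<in> cball z R" if "t \<in> {0..1}" for t
  proof -
    have "s t = (1 - t) *\<^sub>R snd c x + t *\<^sub>R snd c y" by (simp add: s_def algebra_simps)
    then show ?thesis using convexD[OF convex_cball B(2,3), of "1 - t" t] that by simp
  qed
  have in_c: "\<gamma> t \<in> fst c" "snd c (\<gamma> t) = s t" if "t \<in> {0..1}" for t
    using inv_chart_in[of "s t" c] inv_chart[of "s t" c] s[OF that] subsetD[OF B(1)]
    unfolding \<gamma>_def by simp_all
  have der: "(snd c \<circ> \<gamma> has_vector_derivative snd c y - snd c x) (at t within {0..1})"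
    if "t \<in> {0..1}" for t
  proof (rule has_vector_derivative_transform[OF that])
    show "(s has_vector_derivative snd c y - snd c x) (at t within {0..1})"
      unfolding s_def by (auto intro!: derivative_eq_intros)
  qed (use in_c in simp)
  have ends: "\<gamma> 0 = x" "\<gamma> 1 = y" unfolding \<gamma>_def s_def using chart_inv c x by auto
  let ?I = "integral {0..1} (\<lambda>t. sqrt (g c (\<gamma> t) (snd c y - snd c x) (snd c y - snd c x)))"
  have P: "path_length A g (\<gamma> 0) (\<gamma> 1) (0 + ?I)"
    by (rule path_length_append[OF path_length_const c])
      (use in_c der in \<open>simp_all add: image_subset_iff\<close>)
  have "?I \<le> integral {0..1} (\<lambda>t::real. b * norm (snd c y - snd c x))"
  proof (rule integral_le)
    show "(\<lambda>t. sqrt (g c (\<gamma> t) (snd c y - snd c x) (snd c y - snd c x))) integrable_on {0..1}"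
      by (rule integrable_continuous_interval[OF arc_speed_continuous[OF c]])
        (use in_c der in \<open>simp_all add: image_subset_iff\<close>)
    show "sqrt (g c (\<gamma> t) (snd c y - snd c x) (snd c y - snd c x)) \<le> b * norm (snd c y - snd c x)"
      if "t \<in> {0..1}" for t
      by (rule b) (use in_c s that in simp_all)
  qed (rule integrable_const_ivl)
  then have I: "?I \<le> b * norm (snd c y - snd c x)" by simp
  show ?thesis by (rule that[OF _ I]) (use P in \<open>simp add: ends\<close>)
qed

end

section \<open>Cut-off functions in the plane\<close>

text \<open>Squaring the positive part makes the function continuously differentiable across the boundary
  circle, where \<open>bump z0 R\<close> starts to vanish.\<close>

definition bump :: "complex \<Rightarrow> real \<Rightarrow> complex \<Rightarrow> real" where
  "bump z0 R z = (max 0 (1 - (norm (z - z0))\<^sup>2 / R\<^sup>2))\<^sup>2"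

definition bump_deriv :: "complex \<Rightarrow> real \<Rightarrow> complex \<Rightarrow> complex \<Rightarrow> real" where
  "bump_deriv z0 R z h =
     2 * max 0 (1 - (norm (z - z0))\<^sup>2 / R\<^sup>2) * (- (2 * ((z - z0) \<bullet> h)) / R\<^sup>2)"

lemma has_real_derivative_max_0_power2:
  "((\<lambda>u. (max 0 u)\<^sup>2) has_real_derivative 2 * max 0 u) (at (u::real))"
proof -
  consider "u > 0" | "u < 0" | "u = 0" by linarith
  then show ?thesis
  proof cases
    case 1
    have "((\<lambda>u. u\<^sup>2) has_real_derivative 2 * max 0 u) (at u)"
      using 1 by (auto intro!: derivative_eq_intros)
    then show ?thesis
      by (rule has_field_derivative_transform_within_open[of _ _ _ "{0<..}"]) (use 1 in auto)
  next
    case 2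
    have "((\<lambda>u. 0) has_real_derivative 2 * max 0 u) (at u)"
      using 2 by simp
    then show ?thesis
      by (rule has_field_derivative_transform_within_open[of _ _ _ "{..<0}"]) (use 2 in auto)
  next
    case 3
    have "((\<lambda>h::real. max 0 h) \<longlongrightarrow> max 0 0) (at 0)"
      by (intro tendsto_intros)
    then have "((\<lambda>h::real. max 0 h) \<longlongrightarrow> 0) (at 0)" by simp
    then have "((\<lambda>h::real. (max 0 h)\<^sup>2 / h) \<longlongrightarrow> 0) (at 0)"
      by (rule Lim_transform_eventually) (auto simp: eventually_at_filter max_def power2_eq_square)
    then show ?thesis
      using 3 by (simp add: DERIV_def)
  qed
qed

lemma bump_has_derivative: "(bump z0 R has_derivative bump_deriv z0 R z) (at z)"
proof -
  have "((\<lambda>z. 1 - (norm (z - z0))\<^sup>2 / R\<^sup>2) has_derivative (\<lambda>h. - (2 * ((z - z0) \<bullet> h)) / R\<^sup>2)) (at z)"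
  proof -
    have "((\<lambda>z. (z - z0) \<bullet> (z - z0)) has_derivative (\<lambda>h. 2 * ((z - z0) \<bullet> h))) (at z)"
      by (auto intro!: derivative_eq_intros simp: inner_commute)
    from has_derivative_diff[OF has_derivative_const[of 1] has_derivative_mult_left[OF this, of "inverse (R\<^sup>2)"]]
    show ?thesis by (simp add: power2_norm_eq_inner divide_inverse)
  qed
  from has_derivative_compose[OF this
      has_real_derivative_max_0_power2[unfolded has_field_derivative_def]]
  show ?thesis
    unfolding bump_def bump_deriv_def by simp
qed

lemma bump_center [simp]: "bump z0 R z0 = 1"
  by (simp add: bump_def)

lemma bump_outside: "R > 0 \<Longrightarrow> z \<notin> ball z0 R \<Longrightarrow> bump z0 R z = 0"
proof -
  assume "R > 0" "z \<notin> ball z0 R"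
  then have "R\<^sup>2 \<le> (norm (z - z0))\<^sup>2"
    by (intro power_mono) (auto simp: dist_norm norm_minus_commute)
  then show ?thesis using \<open>R > 0\<close> by (simp add: bump_def)
qed

lemma bump_le_1: "bump z0 R z \<le> 1" and bump_nonneg: "bump z0 R z \<ge> 0"
  by (auto simp: bump_def power_le_one)

lemma norm_bump_deriv_le:
  assumes "R > 0"
  shows "\<bar>bump_deriv z0 R z h\<bar> \<le> 4 * norm (z - z0) / R\<^sup>2 * norm h"
proof -
  have "\<bar>max 0 (1 - (norm (z - z0))\<^sup>2 / R\<^sup>2)\<bar> \<le> 1" by simp
  moreover have "\<bar>(z - z0) \<bullet> h\<bar> \<le> norm (z - z0) * norm h"
    by (rule Cauchy_Schwarz_ineq2)
  ultimately have "\<bar>max 0 (1 - (norm (z - z0))\<^sup>2 / R\<^sup>2)\<bar> * \<bar>(z - z0) \<bullet> h\<bar> \<le> 1 * (norm (z - z0) * norm h)"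
    by (intro mult_mono) auto
  then show ?thesis
    using assms by (simp add: bump_deriv_def abs_mult divide_right_mono mult.assoc)
qed

text \<open>Agrees with \<open>z - z0\<close> to second order at \<open>z0\<close> and vanishes outside a disk. Read in a chart and
  extended by zero, it is a function on the whole surface, so that it can be followed along paths
  that leave the chart.\<close>

definition cutoff_coord :: "complex \<Rightarrow> real \<Rightarrow> complex \<Rightarrow> complex" where
  "cutoff_coord z0 R z = bump z0 R z *\<^sub>R (z - z0)"

lemma cutoff_coord_has_derivative:
  "(cutoff_coord z0 R has_derivative (\<lambda>h. bump z0 R z *\<^sub>R h + bump_deriv z0 R z h *\<^sub>R (z - z0))) (at z)"
proof -
  have "((\<lambda>z. z - z0) has_derivative (\<lambda>h. h)) (at z)"
    by (auto intro!: derivative_eq_intros)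
  from has_derivative_scaleR[OF bump_has_derivative[of z0 R z] this]
  show ?thesis by (simp add: cutoff_coord_def[abs_def])
qed

lemma norm_cutoff_coord_deriv_le:
  assumes "R > 0" "z \<in> cball z0 R"
  shows "norm (bump z0 R z *\<^sub>R h + bump_deriv z0 R z h *\<^sub>R (z - z0)) \<le> 5 * norm h"
proof -
  have z: "norm (z - z0) \<le> R" using assms by (simp add: dist_norm norm_minus_commute)
  have "norm (bump z0 R z *\<^sub>R h) \<le> norm h"
    using bump_le_1 bump_nonneg by (simp add: mult_left_le_one_le)
  moreover have "norm (bump_deriv z0 R z h *\<^sub>R (z - z0)) \<le> 4 * R / R\<^sup>2 * norm h * R"
    unfolding norm_scaleR real_norm_def using z assms
    by (intro mult_mono order_trans[OF norm_bump_deriv_le] divide_right_mono) auto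
  moreover have "4 * R / R\<^sup>2 * norm h * R = 4 * norm h"
    using assms by (simp add: power2_eq_square)
  ultimately show ?thesis
    by (smt (verit) norm_triangle_ineq)
qed

text \<open>The map differs from a translation by a map whose derivative is at most
  \<open>6 |z - z0|\<^sup>2 / R\<^sup>2 \<le> 3/8\<close> on this disk.\<close>

lemma cutoff_coord_expanding:
  assumes R: "R > 0" and "x \<in> ball z0 (R / 4)" "y \<in> ball z0 (R / 4)"
  shows "norm (x - y) \<le> 2 * norm (cutoff_coord z0 R x - cutoff_coord z0 R y)"
proof -
  have "norm ((cutoff_coord z0 R x - x) - (cutoff_coord z0 R y - y)) \<le> 1/2 * norm (x - y)"
  proof (rule differentiable_bound[OF convex_ball, of z0 "R/4"])
    fix z assume "z \<in> ball z0 (R / 4)"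
    then have z: "norm (z - z0) \<le> R / 4" by (simp add: dist_norm norm_minus_commute)
    have "((\<lambda>z. cutoff_coord z0 R z - z) has_derivative
       (\<lambda>h. (bump z0 R z *\<^sub>R h + bump_deriv z0 R z h *\<^sub>R (z - z0)) - h)) (at z)"
      by (intro has_derivative_diff cutoff_coord_has_derivative has_derivative_ident)
    then show "((\<lambda>z. cutoff_coord z0 R z - z) has_derivative
       (\<lambda>h. (bump z0 R z *\<^sub>R h + bump_deriv z0 R z h *\<^sub>R (z - z0)) - h)) (at z within ball z0 (R/4))"
      by (rule has_derivative_at_withinI)
    show "onorm (\<lambda>h. (bump z0 R z *\<^sub>R h + bump_deriv z0 R z h *\<^sub>R (z - z0)) - h) \<le> 1/2"
    proof (rule onorm_le)
      fix h :: complex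
      define s where "s = (norm (z - z0))\<^sup>2 / R\<^sup>2"
      have "(norm (z - z0))\<^sup>2 \<le> (R / 4)\<^sup>2" using z by (intro power_mono) auto
      then have s: "0 \<le> s" "s \<le> 1/16" using R by (auto simp: s_def field_simps power2_eq_square)
      have "\<bar>bump z0 R z - 1\<bar> \<le> 2 * s"
      proof -
        have "bump z0 R z = (1 - s)\<^sup>2" using s by (simp add: bump_def s_def[symmetric])
        moreover have "(1 - s)\<^sup>2 \<le> 1" using s by (simp add: power_le_one)
        moreover have "(1 - s)\<^sup>2 \<ge> 1 - 2 * s" by (simp add: power2_eq_square algebra_simps)
        ultimately show ?thesis by linarith
      qed
      then have 1: "norm ((bump z0 R z - 1) *\<^sub>R h) \<le> 2 * s * norm h"
        unfolding norm_scaleR real_norm_def by (intro mult_right_mono) auto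
      have "norm (bump_deriv z0 R z h *\<^sub>R (z - z0)) \<le> 4 * norm (z - z0) / R\<^sup>2 * norm h * norm (z - z0)"
        unfolding norm_scaleR real_norm_def by (intro mult_right_mono norm_bump_deriv_le R) auto
      also have "\<dots> = 4 * s * norm h" by (simp add: s_def power2_eq_square)
      finally have 2: "norm (bump_deriv z0 R z h *\<^sub>R (z - z0)) \<le> 4 * s * norm h" .
      have "(bump z0 R z *\<^sub>R h + bump_deriv z0 R z h *\<^sub>R (z - z0)) - h
          = (bump z0 R z - 1) *\<^sub>R h + bump_deriv z0 R z h *\<^sub>R (z - z0)"
        by (simp add: algebra_simps)
      then have "norm ((bump z0 R z *\<^sub>R h + bump_deriv z0 R z h *\<^sub>R (z - z0)) - h) \<le> 2 * s * norm h + 4 * s * norm h"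
        using 1 2 norm_triangle_ineq by (smt (verit))
      also have "\<dots> = 6 * s * norm h" by simp
      also have "\<dots> \<le> 1/2 * norm h" using s by (intro mult_right_mono) auto
      finally show "norm ((bump z0 R z *\<^sub>R h + bump_deriv z0 R z h *\<^sub>R (z - z0)) - h) \<le> 1/2 * norm h" .
    qed
  qed (use assms in auto)
  moreover have "(cutoff_coord z0 R x - x) - (cutoff_coord z0 R y - y)
      = (cutoff_coord z0 R x - cutoff_coord z0 R y) - (x - y)" by simp
  ultimately have "norm ((cutoff_coord z0 R x - cutoff_coord z0 R y) - (x - y)) \<le> 1/2 * norm (x - y)"
    by simp
  then have "norm (x - y) - norm (cutoff_coord z0 R x - cutoff_coord z0 R y) \<le> 1/2 * norm (x - y)"
    using norm_triangle_ineq2 by (smt (verit) norm_minus_commute)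
  then show ?thesis by simp
qed

section \<open>The Riemannian distance in charts\<close>

context riemannian_surface
begin

lemma eventually_within_openin:
  fixes \<gamma> :: "real \<Rightarrow> 'a"
  assumes "continuous_on S \<gamma>" "\<gamma> ` S \<subseteq> M" "openin (top_of_set M) U" "t \<in> S" "\<gamma> t \<in> U"
  shows "\<forall>\<^sub>F s in at t within S. \<gamma> s \<in> U"
proof -
  obtain V where V: "open V" "U = M \<inter> V" using assms(3) openin_open by metis
  have "(\<gamma> \<longlongrightarrow> \<gamma> t) (at t within S)" using assms(1,4) continuous_on_def by blast
  then have "\<forall>\<^sub>F s in at t within S. \<gamma> s \<in> V"
    using V assms(5) by (intro topological_tendstoD) auto
  moreover have "\<forall>\<^sub>F s in at t within S. s \<in> S" by (simp add: eventually_at_filter)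
  ultimately show ?thesis
    by eventually_elim (use assms(2) V(2) in auto)
qed

lemma chart_change_along_arc:
  assumes c: "c \<in> A" "\<gamma> ` {a..b} \<subseteq> fst c"
    "\<forall>t\<in>{a..b}. (snd c \<circ> \<gamma> has_vector_derivative v t) (at t within {a..b})"
    and c': "c' \<in> A" and t: "t \<in> {a..b}" "\<gamma> t \<in> fst c'"
  shows "(snd c' \<circ> \<gamma> has_vector_derivative chart_deriv c c' id (\<gamma> t) (v t)) (at t within {a..b})"
proof -
  have tc: "\<gamma> t \<in> fst c" using c(2) t(1) by blast
  have in_M: "\<gamma> ` {a..b} \<subseteq> M" using c(2) chart_subset[OF c(1)] by (rule order_trans)
  have "(snd c \<circ> \<gamma> has_vector_derivative v t) (at t within {a..b})" using c(3) t(1) by blast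
  moreover have "(chart_rep c c' id has_derivative chart_deriv c c' id (\<gamma> t))
     (at ((snd c \<circ> \<gamma>) t) within (snd c \<circ> \<gamma>) ` {a..b})"
    using transition_has_derivative[OF c(1) c' tc t(2)] by (simp add: has_derivative_at_withinI)
  ultimately have "(chart_rep c c' id \<circ> (snd c \<circ> \<gamma>) has_vector_derivative
      chart_deriv c c' id (\<gamma> t) (v t)) (at t within {a..b})"
    by (rule vector_derivative_diff_chain_within)
  then show ?thesis
    unfolding has_vector_derivative_def
  proof (rule has_derivative_transform_eventually[OF _ _ _ t(1)])
    show "\<forall>\<^sub>F s in at t within {a..b}. (chart_rep c c' id \<circ> (snd c \<circ> \<gamma>)) s = (snd c' \<circ> \<gamma>) s"
    proof -
      have "\<forall>\<^sub>F s in at t within {a..b}. s \<in> {a..b}" by (simp add: eventually_at_filter)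
      then show ?thesis
      proof eventually_elim
        case (elim s)
        then have "\<gamma> s \<in> fst c" using c(2) by blast
        then show ?case by (simp add: chart_rep_apply[OF c(1)])
      qed
    qed
    show "(chart_rep c c' id \<circ> (snd c \<circ> \<gamma>)) t = (snd c' \<circ> \<gamma>) t"
      by (simp add: chart_rep_apply[OF c(1) tc])
  qed
qed

text \<open>A function supported in a compact coordinate disk changes along a path by at most the integral
  of its speed, and the speed is controlled by the metric: inside the disk by \<open>low\<close>, outside because
  the function is locally zero. This holds for arcs in any chart, since the metric is compatible
  with the chart changes; paths may leave the disk and come back.\<close>

lemma cutoff_path_bound:
  fixes \<Theta> :: "complex \<Rightarrow> 'e::real_normed_vector"
  assumes c: "c \<in> A" and R: "cball z0 R \<subseteq> snd c ` fst c" and \<kappa>: "\<kappa> > 0"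
    and low: "\<And>q v. q \<in> fst c \<Longrightarrow> snd c q \<in> cball z0 R \<Longrightarrow> \<kappa> * norm v \<le> sqrt (g c q v v)"
    and der: "\<And>z. (\<Theta> has_derivative \<Theta>' z) (at z)"
    and bound: "\<And>z h. z \<in> cball z0 R \<Longrightarrow> norm (\<Theta>' z h) \<le> B * norm h"
    and out: "\<And>z. z \<notin> cball z0 R \<Longrightarrow> \<Theta> z = 0" and B: "B \<ge> 0"
    and path: "path_length A g p q l"
  shows "norm ((if q \<in> fst c then \<Theta> (snd c q) else 0) - (if p \<in> fst c then \<Theta> (snd c p) else 0)) \<le> B / \<kappa> * l"
  using path
proof (induction rule: path_length.induct)
  case (path_length_const p)
  then show ?case by simp
next
  case (path_length_append p \<gamma> a l c' b v)
  note h = path_length_append.hyps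
  define \<Psi> where "\<Psi> = (\<lambda>q. if q \<in> fst c then \<Theta> (snd c q) else 0)"
  define speed where "speed = (\<lambda>t. sqrt (g c' (\<gamma> t) (v t) (v t)))"
  define K where "K = inv_into (fst c) (snd c) ` cball z0 R"
  have "compact K"
    unfolding K_def by (rule compact_continuous_image[OF continuous_on_subset
          [OF continuous_on_inv_chart[OF c] R] compact_cball])
  then have "closed K" by (rule compact_imp_closed)
  have cont: "continuous_on {a..b} \<gamma>" by (rule arc_continuous[OF h(2,4,5)])
  have in_M: "\<gamma> ` {a..b} \<subseteq> M" using h(4) chart_subset[OF h(2)] by (rule order_trans)
  have cspeed: "continuous_on {a..b} speed"
    unfolding speed_def by (rule arc_speed_continuous[OF h(2,4,5,6)])
  have nonneg: "speed t \<ge> 0" if "t \<in> {a..b}" for t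
    unfolding speed_def using metric_nonneg[OF h(2)] h(4) that by (simp add: image_subset_iff)
  have \<Theta>'_out: "\<Theta>' z h = 0" if "z \<notin> cball z0 R" for z h
  proof -
    have "((\<lambda>_. 0) has_derivative (\<lambda>_. 0)) (at z)" by (rule has_derivative_const)
    then have "(\<Theta> has_derivative (\<lambda>_. 0)) (at z)"
      by (rule has_derivative_transform_within_open[of _ _ _ _ "- cball z0 R"]) (use that out in auto)
    then have "\<Theta>' z = (\<lambda>_. 0)" using der has_derivative_unique by blast
    then show ?thesis by simp
  qed
  have "\<exists>w. (\<Psi> \<circ> \<gamma> has_vector_derivative w) (at t within {a..b}) \<and> norm w \<le> B / \<kappa> * speed t"
    if t: "t \<in> {a..b}" for t
  proof (cases "\<gamma> t \<in> fst c")
    case True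
    have tc': "\<gamma> t \<in> fst c'" using h(4) t by blast
    define w where "w = chart_deriv c' c id (\<gamma> t) (v t)"
    have "(snd c \<circ> \<gamma> has_vector_derivative w) (at t within {a..b})"
      unfolding w_def by (rule chart_change_along_arc[OF h(2,4,5) c t True])
    from vector_derivative_diff_chain_within[OF this has_derivative_at_withinI[OF der]]
    have "(\<Theta> \<circ> (snd c \<circ> \<gamma>) has_vector_derivative \<Theta>' (snd c (\<gamma> t)) w) (at t within {a..b})"
      by simp
    then have "(\<Psi> \<circ> \<gamma> has_vector_derivative \<Theta>' (snd c (\<gamma> t)) w) (at t within {a..b})"
      unfolding has_vector_derivative_def
    proof (rule has_derivative_transform_eventually[OF _ _ _ t])
      have "\<forall>\<^sub>F s in at t within {a..b}. \<gamma> s \<in> fst c"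
        by (rule eventually_within_openin[OF cont in_M chart_domain_open[OF c] t True])
      then show "\<forall>\<^sub>F s in at t within {a..b}. (\<Theta> \<circ> (snd c \<circ> \<gamma>)) s = (\<Psi> \<circ> \<gamma>) s"
        by eventually_elim (simp add: \<Psi>_def)
    qed (use True in \<open>simp add: \<Psi>_def\<close>)
    moreover have "norm (\<Theta>' (snd c (\<gamma> t)) w) \<le> B / \<kappa> * speed t"
    proof (cases "snd c (\<gamma> t) \<in> cball z0 R")
      case in_ball: True
      have "\<gamma> t \<in> fst c' \<inter> id -` fst c" using tc' True by simp
      from metric_compatible[unfolded surface_map_isometric_def, rule_format, OF h(2) c this]
      have "g c (\<gamma> t) w w = g c' (\<gamma> t) (v t) (v t)" by (simp add: w_def)
      then have "\<kappa> * norm w \<le> speed t" using low[OF True in_ball, of w] by (simp add: speed_def)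
      then have "norm w \<le> speed t / \<kappa>" using \<kappa> by (simp add: field_simps)
      then have "B * norm w \<le> B * (speed t / \<kappa>)" using B by (rule mult_left_mono)
      then show ?thesis using bound[OF in_ball, of w] by simp
    qed (use \<Theta>'_out nonneg[OF t] B \<kappa> in simp)
    ultimately show ?thesis by blast
  next
    case False
    have "K \<subseteq> fst c" unfolding K_def using inv_chart_in[OF subsetD[OF R]] by (rule image_subsetI)
    with False have "\<gamma> t \<notin> K" by (rule contra_subsetD[rotated])
    have "((\<lambda>_. 0) has_vector_derivative 0) (at t within {a..b})" by simp
    then have "(\<Psi> \<circ> \<gamma> has_vector_derivative 0) (at t within {a..b})"
      unfolding has_vector_derivative_def
    proof (rule has_derivative_transform_eventually[OF _ _ _ t])
      have "openin (top_of_set M) (M \<inter> - K)" using \<open>closed K\<close> by (simp add: openin_open_Int open_Compl)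
      then have "\<forall>\<^sub>F s in at t within {a..b}. \<gamma> s \<in> M \<inter> - K"
        by (rule eventually_within_openin[OF cont in_M _ t]) (use t in_M \<open>\<gamma> t \<notin> K\<close> in blast)
      then show "\<forall>\<^sub>F s in at t within {a..b}. 0 = (\<Psi> \<circ> \<gamma>) s"
      proof eventually_elim
        case (elim s)
        have "\<Theta> (snd c (\<gamma> s)) = 0" if "\<gamma> s \<in> fst c"
        proof (rule out)
          show "snd c (\<gamma> s) \<notin> cball z0 R"
            using elim chart_inv[OF c that] unfolding K_def by force
        qed
        then show ?case by (simp add: \<Psi>_def)
      qed
    qed (use False in \<open>simp add: \<Psi>_def\<close>)
    then show ?thesis using nonneg[OF t] B \<kappa> by (intro exI[of _ 0]) simp
  qed
  then obtain w where w: "\<And>t. t \<in> {a..b} \<Longrightarrow> (\<Psi> \<circ> \<gamma> has_vector_derivative w t) (at t within {a..b})"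
    "\<And>t. t \<in> {a..b} \<Longrightarrow> norm (w t) \<le> B / \<kappa> * speed t" by metis
  define \<phi> where "\<phi> = (\<lambda>t. B / \<kappa> * integral {a..t} speed)"
  have \<phi>: "(\<phi> has_vector_derivative B / \<kappa> * speed t) (at t within {a..b})" if "t \<in> {a..b}" for t
    unfolding \<phi>_def
    by (rule has_vector_derivative_mult_right[OF integral_has_vector_derivative[OF cspeed that]])
  have "norm ((\<Psi> \<circ> \<gamma>) b - (\<Psi> \<circ> \<gamma>) a) \<le> \<phi> b - \<phi> a"
  proof (rule differentiable_bound_general[OF h(3)])
    show "continuous_on {a..b} (\<Psi> \<circ> \<gamma>)"
      using w(1) has_vector_derivative_continuous unfolding continuous_on_eq_continuous_within by blast
    show "continuous_on {a..b} \<phi>"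
      using \<phi> has_vector_derivative_continuous unfolding continuous_on_eq_continuous_within by blast
    fix t assume t: "a < t" "t < b"
    show "(\<Psi> \<circ> \<gamma> has_vector_derivative w t) (at t)" using w(1)[of t] t by (simp add: at_within_Icc_at)
    show "(\<phi> has_vector_derivative B / \<kappa> * speed t) (at t)" using \<phi>[of t] t by (simp add: at_within_Icc_at)
    show "norm (w t) \<le> B / \<kappa> * speed t" using w(2) t by simp
  qed
  then have 1: "norm (\<Psi> (\<gamma> b) - \<Psi> (\<gamma> a)) \<le> B / \<kappa> * integral {a..b} speed"
    by (simp add: \<phi>_def)
  have 2: "norm (\<Psi> (\<gamma> a) - \<Psi> p) \<le> B / \<kappa> * l"
    using path_length_append.IH unfolding \<Psi>_def .
  have "norm (\<Psi> (\<gamma> b) - \<Psi> p) \<le> norm (\<Psi> (\<gamma> b) - \<Psi> (\<gamma> a)) + norm (\<Psi> (\<gamma> a) - \<Psi> p)"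
    using norm_triangle_ineq[of "\<Psi> (\<gamma> b) - \<Psi> (\<gamma> a)" "\<Psi> (\<gamma> a) - \<Psi> p"] by simp
  also have "\<dots> \<le> B / \<kappa> * (l + integral {a..b} speed)"
    using 1 2 by (simp add: distrib_left)
  finally show ?case unfolding \<Psi>_def speed_def .
qed

end

context closed_surface
begin

abbreviation "rdist \<equiv> riemannian_dist A g"

lemma local_segments:
  assumes "p \<in> M"
  obtains c R \<kappa> b where "c \<in> A" "p \<in> fst c" "R > 0" "cball (snd c p) R \<subseteq> snd c ` fst c"
    "\<kappa> > 0" "b > 0"
    "\<And>q v. q \<in> fst c \<Longrightarrow> snd c q \<in> cball (snd c p) R \<Longrightarrow> \<kappa> * norm v \<le> sqrt (g c q v v)"
    "\<And>x y. x \<in> fst c \<Longrightarrow> y \<in> fst c \<Longrightarrow> snd c x \<in> cball (snd c p) R \<Longrightarrow> snd c y \<in> cball (snd c p) R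
       \<Longrightarrow> \<exists>l. path_length A g x y l \<and> l \<le> b * norm (snd c y - snd c x)"
proof -
  obtain c where c: "c \<in> A" "p \<in> fst c" using assms obtain_chart by blast
  obtain R \<kappa> b where R: "R > 0" "cball (snd c p) R \<subseteq> snd c ` fst c" "\<kappa> > 0" "b > 0"
    "\<And>q v. q \<in> fst c \<Longrightarrow> snd c q \<in> cball (snd c p) R \<Longrightarrow> \<kappa> * norm v \<le> sqrt (g c q v v)"
    "\<And>q v. q \<in> fst c \<Longrightarrow> snd c q \<in> cball (snd c p) R \<Longrightarrow> sqrt (g c q v v) \<le> b * norm v"
    by (rule chart_metric_bounds[OF c]) (rule that)
  show ?thesis
  proof (rule that[OF c R(1-5)])
    fix x y assume xy: "x \<in> fst c" "y \<in> fst c" "snd c x \<in> cball (snd c p) R" "snd c y \<in> cball (snd c p) R"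
    obtain l where "path_length A g x y l" "l \<le> b * norm (snd c y - snd c x)"
      by (rule path_length_segment[OF c(1) xy(1,2) R(2) xy(3,4) R(6)])
    then show "\<exists>l. path_length A g x y l \<and> l \<le> b * norm (snd c y - snd c x)" by blast
  qed
qed

lemma openin_iff_local:
  assumes "U \<subseteq> M" "\<And>p. p \<in> U \<Longrightarrow> \<exists>V. openin (top_of_set M) V \<and> p \<in> V \<and> V \<subseteq> U"
  shows "openin (top_of_set M) U"
  using assms by (subst openin_subopen) blast

text \<open>Points joined to \<open>p\<close> by a path form an open and closed set. This guards the distance against
  the infimum of the empty set.\<close>

lemma path_exists:
  assumes p: "p \<in> M" and q: "q \<in> M"
  shows "\<exists>l. path_length A g p q l"
proof -
  define E where "E = {q \<in> M. \<exists>l. path_length A g p q l}"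
  have nbhd: "\<exists>V. openin (top_of_set M) V \<and> q \<in> V \<and> V \<subseteq> M \<and> (\<forall>x\<in>V. \<forall>y\<in>V. \<exists>l. path_length A g x y l)"
    if qM: "q \<in> M" for q
  proof -
    obtain c R \<kappa> b where c: "c \<in> A" "q \<in> fst c" and R: "R > 0" "cball (snd c q) R \<subseteq> snd c ` fst c"
      and "\<kappa> > 0" "b > 0"
      and "\<And>x v. x \<in> fst c \<Longrightarrow> snd c x \<in> cball (snd c q) R \<Longrightarrow> \<kappa> * norm v \<le> sqrt (g c x v v)" and
      seg: "\<And>x y. x \<in> fst c \<Longrightarrow> y \<in> fst c \<Longrightarrow> snd c x \<in> cball (snd c q) R \<Longrightarrow> snd c y \<in> cball (snd c q) R
       \<Longrightarrow> \<exists>l. path_length A g x y l \<and> l \<le> b * norm (snd c y - snd c x)"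
      by (rule local_segments[OF qM]) (rule that)
    define V where "V = {x \<in> fst c. snd c x \<in> ball (snd c q) R}"
    have "\<exists>l. path_length A g x y l" if "x \<in> V" "y \<in> V" for x y
      using seg[of x y] that by (auto simp: V_def)
    moreover have "q \<in> V" "V \<subseteq> M" using c R(1) chart_subset[OF c(1)] by (auto simp: V_def)
    moreover have "openin (top_of_set M) V"
      unfolding V_def by (rule open_chart_preimage[OF c(1) open_ball])
    ultimately show ?thesis by blast
  qed
  have "openin (top_of_set M) E"
  proof (rule openin_iff_local)
    fix q assume q: "q \<in> E"
    then have "q \<in> M" by (simp add: E_def)
    then obtain V where V: "openin (top_of_set M) V" "q \<in> V" "V \<subseteq> M"
      "\<forall>x\<in>V. \<forall>y\<in>V. \<exists>l. path_length A g x y l" using nbhd by meson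
    then have "V \<subseteq> E" using q unfolding E_def by (blast intro: path_length_trans)
    then show "\<exists>V. openin (top_of_set M) V \<and> q \<in> V \<and> V \<subseteq> E" using V by blast
  qed (auto simp: E_def)
  moreover have "openin (top_of_set M) (M - E)"
  proof (rule openin_iff_local)
    fix q assume q: "q \<in> M - E"
    then have "q \<in> M" by simp
    then obtain V where V: "openin (top_of_set M) V" "q \<in> V" "V \<subseteq> M"
      "\<forall>x\<in>V. \<forall>y\<in>V. \<exists>l. path_length A g x y l" using nbhd by meson
    then have "V \<subseteq> M - E" using q unfolding E_def by (blast intro: path_length_trans)
    then show "\<exists>V. openin (top_of_set M) V \<and> q \<in> V \<and> V \<subseteq> M - E" using V by blast
  qed auto
  moreover have "p \<in> E" unfolding E_def using p path_length_const[of A g p] by auto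
  moreover have "E \<subseteq> M" by (auto simp: E_def)
  ultimately have "E = M"
    using connected unfolding connected_clopen closedin_def by auto
  then show ?thesis using q by (auto simp: E_def)
qed

lemma rdist_le: "path_length A g p q l \<Longrightarrow> rdist p q \<le> l"
  unfolding riemannian_dist_def
  by (rule cInf_lower) (auto intro!: bdd_belowI[of _ 0] path_length_nonneg)

lemma rdist_ge:
  assumes "p \<in> M" "q \<in> M" "\<And>l. path_length A g p q l \<Longrightarrow> x \<le> l"
  shows "x \<le> rdist p q"
  unfolding riemannian_dist_def
  by (rule cInf_greatest) (use path_exists[OF assms(1,2)] assms(3) in auto)

lemma rdist_nonneg: "p \<in> M \<Longrightarrow> q \<in> M \<Longrightarrow> rdist p q \<ge> 0"
  by (rule rdist_ge) (auto intro: path_length_nonneg)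

lemma rdist_self: "p \<in> M \<Longrightarrow> rdist p p = 0"
  using rdist_le[OF path_length_const] rdist_nonneg by (metis order_antisym)

lemma rdist_commute: "rdist p q = rdist q p"
proof -
  have "path_length A g p q = path_length A g q p"
    by (rule ext) (blast intro: path_length_reverse)
  then show ?thesis by (simp add: riemannian_dist_def)
qed

lemma rdist_triangle:
  assumes "p \<in> M" "q \<in> M" "r \<in> M"
  shows "rdist p r \<le> rdist p q + rdist q r"
proof -
  have "rdist p r - rdist q r \<le> rdist p q"
  proof (rule rdist_ge[OF assms(1,2)])
    fix l assume l: "path_length A g p q l"
    have "rdist p r - l \<le> rdist q r"
    proof (rule rdist_ge[OF assms(2,3)])
      fix l' assume "path_length A g q r l'"
      from rdist_le[OF path_length_trans[OF this l]] show "rdist p r - l \<le> l'" by simp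
    qed
    then show "rdist p r - rdist q r \<le> l" by simp
  qed
  then show ?thesis by simp
qed

text \<open>Coordinate segments give the upper bound for the distance. For the lower bound, the cut-off
  coordinate along an arbitrary path changes at most in proportion to the length of the path.\<close>

lemma rdist_comparable_in_chart:
  assumes "p \<in> M"
  obtains c U C where "c \<in> A" "openin (top_of_set M) U" "p \<in> U" "U \<subseteq> fst c" "C \<ge> 1"
    "\<And>x y. x \<in> U \<Longrightarrow> y \<in> U \<Longrightarrow> norm (snd c x - snd c y) \<le> C * rdist x y"
    "\<And>x y. x \<in> U \<Longrightarrow> y \<in> U \<Longrightarrow> rdist x y \<le> C * norm (snd c x - snd c y)"
proof -
  obtain c R \<kappa> b where c: "c \<in> A" "p \<in> fst c" and R: "R > 0" "cball (snd c p) R \<subseteq> snd c ` fst c"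
    and \<kappa>: "\<kappa> > 0" and b: "b > 0" and
    low: "\<And>q v. q \<in> fst c \<Longrightarrow> snd c q \<in> cball (snd c p) R \<Longrightarrow> \<kappa> * norm v \<le> sqrt (g c q v v)" and
    seg: "\<And>x y. x \<in> fst c \<Longrightarrow> y \<in> fst c \<Longrightarrow> snd c x \<in> cball (snd c p) R \<Longrightarrow> snd c y \<in> cball (snd c p) R
     \<Longrightarrow> \<exists>l. path_length A g x y l \<and> l \<le> b * norm (snd c y - snd c x)"
    by (rule local_segments[OF assms]) (rule that)
  define U where "U = {x \<in> fst c. snd c x \<in> ball (snd c p) (R / 4)}"
  define C where "C = max 1 (max b (10 / \<kappa>))"
  have C: "C \<ge> 1" "C \<ge> b" "C \<ge> 10 / \<kappa>" by (auto simp: C_def)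
  have U_fst: "U \<subseteq> fst c" by (auto simp: U_def)
  then have U_M: "U \<subseteq> M" using chart_subset[OF c(1)] by (rule order_trans)
  have U_R: "snd c x \<in> cball (snd c p) R" if "x \<in> U" for x using that R(1) by (auto simp: U_def)
  show ?thesis
  proof (rule that[OF c(1) _ _ U_fst C(1)])
    show "openin (top_of_set M) U" unfolding U_def by (rule open_chart_preimage[OF c(1) open_ball])
    show "p \<in> U" using c R by (simp add: U_def)
  next
    fix x y assume xy: "x \<in> U" "y \<in> U"
    have nonneg: "rdist x y \<ge> 0" using rdist_nonneg xy U_M by blast
    have "norm (snd c x - snd c y) * (\<kappa> / 10) \<le> rdist x y"
    proof (rule rdist_ge)
      fix l assume l: "path_length A g x y l"
      have "norm ((if y \<in> fst c then cutoff_coord (snd c p) R (snd c y) else 0)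
        - (if x \<in> fst c then cutoff_coord (snd c p) R (snd c x) else 0)) \<le> 5 / \<kappa> * l"
      proof (rule cutoff_path_bound[OF c(1) R(2) \<kappa> low cutoff_coord_has_derivative _ _ _ l])
        fix z h :: complex assume "z \<in> cball (snd c p) R"
        then show "norm (bump (snd c p) R z *\<^sub>R h + bump_deriv (snd c p) R z h *\<^sub>R (z - snd c p)) \<le> 5 * norm h"
          by (rule norm_cutoff_coord_deriv_le[OF R(1)])
      next
        fix z assume "z \<notin> cball (snd c p) R"
        then have "z \<notin> ball (snd c p) R" by simp
        then show "cutoff_coord (snd c p) R z = 0"
          by (simp add: cutoff_coord_def bump_outside[OF R(1)])
      qed auto
      moreover have "norm (snd c y - snd c x) \<le> 2 * norm (cutoff_coord (snd c p) R (snd c y) - cutoff_coord (snd c p) R (snd c x))"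
        by (rule cutoff_coord_expanding[OF R(1)]) (use xy in \<open>auto simp: U_def\<close>)
      ultimately have "norm (snd c y - snd c x) \<le> 10 / \<kappa> * l" using U_fst xy by (auto simp: subset_iff)
      then show "norm (snd c x - snd c y) * (\<kappa> / 10) \<le> l" using \<kappa> by (simp add: field_simps norm_minus_commute)
    qed (use xy U_M in auto)
    then have "norm (snd c x - snd c y) \<le> 10 / \<kappa> * rdist x y" using \<kappa> by (simp add: field_simps)
    also have "\<dots> \<le> C * rdist x y" using C nonneg by (intro mult_right_mono) auto
    finally show "norm (snd c x - snd c y) \<le> C * rdist x y" .
    obtain l where l: "path_length A g x y l" "l \<le> b * norm (snd c y - snd c x)"
      using seg[of x y] xy U_R U_fst by blast
    have "rdist x y \<le> b * norm (snd c y - snd c x)" using rdist_le[OF l(1)] l(2) by simp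
    also have "\<dots> \<le> C * norm (snd c x - snd c y)"
      unfolding norm_minus_commute[of "snd c y"] using C by (intro mult_right_mono) auto
    finally show "rdist x y \<le> C * norm (snd c x - snd c y)" .
  qed
qed

lemma dist_ball_open:
  assumes "p \<in> M"
  shows "openin (top_of_set M) (dist_ball M rdist p r)"
proof (rule openin_iff_local)
  fix q assume q: "q \<in> dist_ball M rdist p r"
  then have qM: "q \<in> M" and d: "rdist p q < r" by (auto simp: dist_ball_def)
  obtain c U C where c: "c \<in> A" and U: "openin (top_of_set M) U" "q \<in> U" "U \<subseteq> fst c" and C: "C \<ge> 1"
    and "\<And>x y. x \<in> U \<Longrightarrow> y \<in> U \<Longrightarrow> norm (snd c x - snd c y) \<le> C * rdist x y"
    and le: "\<And>x y. x \<in> U \<Longrightarrow> y \<in> U \<Longrightarrow> rdist x y \<le> C * norm (snd c x - snd c y)"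
    by (rule rdist_comparable_in_chart[OF qM]) (rule that)
  define V where "V = U \<inter> {x \<in> fst c. snd c x \<in> ball (snd c q) ((r - rdist p q) / C)}"
  have "openin (top_of_set M) V"
    unfolding V_def by (intro openin_Int U open_chart_preimage[OF c open_ball])
  moreover have "q \<in> V" using U C d by (auto simp: V_def)
  moreover have "V \<subseteq> dist_ball M rdist p r"
  proof
    fix x assume x: "x \<in> V"
    then have xU: "x \<in> U" and n: "norm (snd c q - snd c x) < (r - rdist p q) / C"
      by (auto simp: V_def dist_norm)
    have xM: "x \<in> M" using xU U(3) chart_subset[OF c] by blast
    have "rdist q x \<le> C * norm (snd c q - snd c x)" by (rule le[OF U(2) xU])
    also have "\<dots> < r - rdist p q" using n C by (simp add: field_simps)
    finally have "rdist p x < r" using rdist_triangle[OF assms qM xM] by simp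
    then show "x \<in> dist_ball M rdist p r" using xM by (simp add: dist_ball_def)
  qed
  ultimately show "\<exists>V. openin (top_of_set M) V \<and> q \<in> V \<and> V \<subseteq> dist_ball M rdist p r" by blast
qed (auto simp: dist_ball_def)

text \<open>Every path that leaves a small disk around \<open>p\<close> makes the bump function drop from 1 to 0, and
  therefore has a definite length.\<close>

lemma dist_ball_subset_openin:
  assumes U: "openin (top_of_set M) U" and p: "p \<in> U"
  shows "\<exists>r>0. dist_ball M rdist p r \<subseteq> U"
proof -
  have pM: "p \<in> M" using U p openin_imp_subset by blast
  obtain c R \<kappa> b where c: "c \<in> A" "p \<in> fst c" and R: "R > 0" "cball (snd c p) R \<subseteq> snd c ` fst c"
    and \<kappa>: "\<kappa> > 0" and "b > 0" and
    low: "\<And>q v. q \<in> fst c \<Longrightarrow> snd c q \<in> cball (snd c p) R \<Longrightarrow> \<kappa> * norm v \<le> sqrt (g c q v v)" and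
    "\<And>x y. x \<in> fst c \<Longrightarrow> y \<in> fst c \<Longrightarrow> snd c x \<in> cball (snd c p) R \<Longrightarrow> snd c y \<in> cball (snd c p) R
     \<Longrightarrow> \<exists>l. path_length A g x y l \<and> l \<le> b * norm (snd c y - snd c x)"
    by (rule local_segments[OF pM]) (rule that)
  have "openin (top_of_set M) (fst c \<inter> U)" by (rule openin_Int[OF chart_domain_open[OF c(1)] U])
  then have "open (snd c ` (fst c \<inter> U))" by (rule open_chart_image[OF c(1)]) simp
  moreover have "snd c p \<in> snd c ` (fst c \<inter> U)" using c p by simp
  ultimately obtain e where e: "e > 0" "cball (snd c p) e \<subseteq> snd c ` (fst c \<inter> U)"
    unfolding open_contains_cball by meson
  define s where "s = min R e"
  have s: "s > 0" "cball (snd c p) s \<subseteq> cball (snd c p) R" "cball (snd c p) s \<subseteq> snd c ` (fst c \<inter> U)"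
    using R e by (auto simp: s_def)
  have inU: "q \<in> U" if "q \<in> fst c" "snd c q \<in> cball (snd c p) s" for q
  proof -
    obtain q' where q': "q' \<in> fst c" "q' \<in> U" "snd c q = snd c q'" using s(3) \<open>snd c q \<in> _\<close> by blast
    then have "q = q'" using chart_inv[OF c(1)] that(1) by metis
    then show ?thesis using q' by simp
  qed
  have "dist_ball M rdist p (\<kappa> * s / 4) \<subseteq> U"
  proof
    fix q assume "q \<in> dist_ball M rdist p (\<kappa> * s / 4)"
    then have q: "q \<in> M" "rdist p q < \<kappa> * s / 4" by (auto simp: dist_ball_def)
    show "q \<in> U"
    proof (rule ccontr)
      assume "q \<notin> U"
      have "\<kappa> * s / 4 \<le> rdist p q"
      proof (rule rdist_ge[OF pM q(1)])
        fix l assume l: "path_length A g p q l"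
        have "norm ((if q \<in> fst c then bump (snd c p) s (snd c q) else 0)
          - (if p \<in> fst c then bump (snd c p) s (snd c p) else 0)) \<le> (4 / s) / \<kappa> * l"
        proof (rule cutoff_path_bound[OF c(1) _ \<kappa> _ bump_has_derivative _ _ _ l])
          show "cball (snd c p) s \<subseteq> snd c ` fst c" using s(3) by blast
          show "\<kappa> * norm v \<le> sqrt (g c q v v)" if "q \<in> fst c" "snd c q \<in> cball (snd c p) s" for q v
            using low that s(2) by blast
        next
          fix z h :: complex assume "z \<in> cball (snd c p) s"
          then have "norm (z - snd c p) \<le> s" by (simp add: dist_norm norm_minus_commute)
          then have "4 * norm (z - snd c p) / s\<^sup>2 \<le> 4 * s / s\<^sup>2" by (intro divide_right_mono) auto
          also have "\<dots> = 4 / s" using s(1) by (simp add: power2_eq_square)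
          finally have "4 * norm (z - snd c p) / s\<^sup>2 * norm h \<le> 4 / s * norm h"
            by (rule mult_right_mono) simp
          then show "norm (bump_deriv (snd c p) s z h) \<le> 4 / s * norm h"
            using norm_bump_deriv_le[OF s(1), of "snd c p" z h] by simp
        next
          fix z assume "z \<notin> cball (snd c p) s"
          then show "bump (snd c p) s z = 0" by (intro bump_outside s) auto
        qed (use s in simp)
        moreover have "(if q \<in> fst c then bump (snd c p) s (snd c q) else 0) = 0"
        proof (cases "q \<in> fst c")
          case True
          then have "snd c q \<notin> ball (snd c p) s" using inU \<open>q \<notin> U\<close> by auto
          then show ?thesis by (simp add: bump_outside[OF s(1)])
        qed simp
        ultimately have "1 \<le> (4 / s) / \<kappa> * l" using c by simp
        then show "\<kappa> * s / 4 \<le> l" using \<kappa> s(1) by (simp add: field_simps)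
      qed
      then show False using q by simp
    qed
  qed
  moreover have "\<kappa> * s / 4 > 0" using \<kappa> s by simp
  ultimately show ?thesis by blast
qed

end

section \<open>Distances on compact spaces\<close>

text \<open>The dynamical argument uses only that \<open>d\<close> is a metric on \<open>M\<close> that induces the topology. Away
  from \<open>M\<close> there is only symmetry: no path joins distinct points there, and the Riemannian distance
  is the infimum of the empty set.\<close>

locale compact_distance =
  fixes M :: "'a::t2_space set" and d :: "'a \<Rightarrow> 'a \<Rightarrow> real"
  assumes compact: "compact M"
    and nonneg: "x \<in> M \<Longrightarrow> y \<in> M \<Longrightarrow> 0 \<le> d x y"
    and self: "x \<in> M \<Longrightarrow> d x x = 0"
    and commute: "d x y = d y x"
    and triangle: "x \<in> M \<Longrightarrow> y \<in> M \<Longrightarrow> z \<in> M \<Longrightarrow> d x z \<le> d x y + d y z"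
    and ball_open: "p \<in> M \<Longrightarrow> openin (top_of_set M) (dist_ball M d p r)"
    and ball_subset_openin:
      "openin (top_of_set M) U \<Longrightarrow> p \<in> U \<Longrightarrow> \<exists>r>0. dist_ball M d p r \<subseteq> U"
begin

abbreviation "B \<equiv> dist_ball M d"

lemma in_ball: "q \<in> B p r \<longleftrightarrow> q \<in> M \<and> d p q < r"
  by (simp add: dist_ball_def)

lemma center_in_ball: "p \<in> M \<Longrightarrow> r > 0 \<Longrightarrow> p \<in> B p r"
  by (simp add: in_ball self)

lemma ball_mono: "r \<le> r' \<Longrightarrow> B p r \<subseteq> B p r'"
  by (auto simp: in_ball)

lemma ball_in_ball:
  assumes "p \<in> M" "x \<in> B p (r / 2)"
  shows "B x (r / 2) \<subseteq> B p r"
proof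
  fix y assume "y \<in> B x (r / 2)"
  then show "y \<in> B p r" using assms triangle[of p x y] by (simp add: in_ball)
qed

lemma finite_ball_cover:
  assumes "compact K" "K \<subseteq> M" "\<And>p. p \<in> K \<Longrightarrow> r p > 0"
  obtains F where "finite F" "F \<subseteq> K" "K \<subseteq> (\<Union>p\<in>F. B p (r p))"
proof -
  have "\<exists>T. open T \<and> B p (r p) = M \<inter> T" if "p \<in> K" for p
    using ball_open[OF subsetD[OF assms(2) that], of "r p"] unfolding openin_open .
  then obtain T where T: "\<And>p. p \<in> K \<Longrightarrow> open (T p)" "\<And>p. p \<in> K \<Longrightarrow> B p (r p) = M \<inter> T p"
    by metis
  have KT: "K \<subseteq> (\<Union>p\<in>K. T p)"
  proof
    fix p assume p: "p \<in> K"
    then have "p \<in> B p (r p)" by (intro center_in_ball subsetD[OF assms(2)] assms(3))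
    then show "p \<in> (\<Union>p\<in>K. T p)" using T(2)[OF p] p by blast
  qed
  obtain F where F: "F \<subseteq> K" "finite F" "K \<subseteq> (\<Union>p\<in>F. T p)"
    by (rule compactE_image[OF assms(1) T(1) KT])
  have "K \<subseteq> (\<Union>p\<in>F. B p (r p))"
  proof
    fix x assume x: "x \<in> K"
    then obtain p where "p \<in> F" "x \<in> T p" using F by blast
    moreover have "x \<in> M" "p \<in> K" using x assms(2) F(1) \<open>p \<in> F\<close> by blast+
    ultimately show "x \<in> (\<Union>p\<in>F. B p (r p))" using T(2)[of p] by blast
  qed
  then show ?thesis by (rule that[OF F(2,1)])
qed

text \<open>Turns statements that hold near each point, such as continuity or a distortion bound, into
  statements at one scale.\<close>

lemma lebesgue_number:
  assumes "compact K" "K \<subseteq> M" and loc: "\<And>p. p \<in> K \<Longrightarrow> \<exists>r>0. P (B p r)"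
    and anti: "\<And>U V. P V \<Longrightarrow> U \<subseteq> V \<Longrightarrow> P U"
  obtains \<rho> where "\<rho> > 0" "\<And>p. p \<in> K \<Longrightarrow> P (B p \<rho>)"
proof -
  obtain r where r: "\<And>p. p \<in> K \<Longrightarrow> r p > 0" "\<And>p. p \<in> K \<Longrightarrow> P (B p (r p))"
    using loc by metis
  obtain F where F: "finite F" "F \<subseteq> K" "K \<subseteq> (\<Union>p\<in>F. B p (r p / 2))"
    using finite_ball_cover[OF assms(1,2), of "\<lambda>p. r p / 2"] r(1) by auto
  define \<rho> where "\<rho> = Min (insert 1 ((\<lambda>p. r p / 2) ` F))"
  have \<rho>: "\<rho> > 0" using F r by (auto simp: \<rho>_def subset_iff)
  have le: "\<rho> \<le> r p / 2" if "p \<in> F" for p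
    unfolding \<rho>_def by (rule Min_le) (use F(1) that in auto)
  show ?thesis
  proof (rule that[OF \<rho>])
    fix x assume "x \<in> K"
    then obtain p where p: "p \<in> F" "x \<in> B p (r p / 2)" using F(3) by blast
    have "B x \<rho> \<subseteq> B x (r p / 2)" by (rule ball_mono[OF le[OF p(1)]])
    also have "\<dots> \<subseteq> B p (r p)" by (rule ball_in_ball) (use p F assms(2) in auto)
    finally show "P (B x \<rho>)" by (rule anti[OF r(2)[OF subsetD[OF F(2) p(1)]]])
  qed
qed

lemma uniformly_continuous:
  assumes "continuous_on M F" "F ` M \<subseteq> M" "e > 0"
  obtains \<delta> where "\<delta> > 0" "\<And>x y. x \<in> M \<Longrightarrow> y \<in> M \<Longrightarrow> d x y < \<delta> \<Longrightarrow> d (F x) (F y) < e"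
proof -
  obtain \<rho> where \<rho>: "\<rho> > 0" "\<And>p. p \<in> M \<Longrightarrow> (\<forall>x\<in>B p \<rho>. \<forall>y\<in>B p \<rho>. d (F x) (F y) < e)"
  proof (rule lebesgue_number[OF compact subset_refl, of "\<lambda>U. \<forall>x\<in>U. \<forall>y\<in>U. d (F x) (F y) < e"])
    fix p assume p: "p \<in> M"
    then have Fp: "F p \<in> M" using assms(2) by blast
    have "openin (top_of_set M) (M \<inter> F -` B (F p) (e / 2))"
      by (rule continuous_openin_preimage[OF assms(1) _ ball_open[OF Fp]]) (use assms(2) in auto)
    moreover have "p \<in> M \<inter> F -` B (F p) (e / 2)" using p center_in_ball[OF Fp] assms(3) by simp
    ultimately obtain r where r: "r > 0" "B p r \<subseteq> M \<inter> F -` B (F p) (e / 2)"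
      using ball_subset_openin by blast
    have "\<forall>x\<in>B p r. \<forall>y\<in>B p r. d (F x) (F y) < e"
    proof (intro ballI)
      fix x y assume "x \<in> B p r" "y \<in> B p r"
      then have xy: "F x \<in> B (F p) (e / 2)" "F y \<in> B (F p) (e / 2)" using r(2) by auto
      then show "d (F x) (F y) < e"
        using triangle[of "F x" "F p" "F y"] Fp commute[of "F p" "F x"] by (simp add: in_ball)
    qed
    then show "\<exists>r>0. \<forall>x\<in>B p r. \<forall>y\<in>B p r. d (F x) (F y) < e" using r(1) by blast
  qed (blast, rule that)
  show ?thesis
  proof (rule that[OF \<rho>(1)])
    fix x y assume "x \<in> M" "y \<in> M" "d x y < \<rho>"
    then show "d (F x) (F y) < e" using \<rho>(2)[of x] center_in_ball[OF _ \<rho>(1), of x] in_ball by blast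
  qed
qed

lemma finite_if_separated:
  assumes "e > 0" "X \<subseteq> M" "\<And>x y. x \<in> X \<Longrightarrow> y \<in> X \<Longrightarrow> x \<noteq> y \<Longrightarrow> e \<le> d x y"
  shows "finite X"
proof -
  obtain F where F: "finite F" "F \<subseteq> M" "M \<subseteq> (\<Union>p\<in>F. B p (e / 2))"
    using finite_ball_cover[OF compact subset_refl, of "\<lambda>_. e / 2"] assms(1) by auto
  have "\<forall>x\<in>X. \<exists>p. p \<in> F \<and> x \<in> B p (e / 2)" using F(3) assms(2) by blast
  then obtain c where c: "\<And>x. x \<in> X \<Longrightarrow> c x \<in> F" "\<And>x. x \<in> X \<Longrightarrow> x \<in> B (c x) (e / 2)" by metis
  have "inj_on c X"
  proof (rule inj_onI, rule ccontr)
    fix x y assume xy: "x \<in> X" "y \<in> X" "c x = c y" "x \<noteq> y"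
    then have "d x y < e"
      using c(2)[OF xy(1)] c(2)[OF xy(2)] F(2) c(1)[OF xy(1)] triangle[of x "c x" y] commute[of x "c x"]
      by (auto simp: in_ball)
    then show False using assms(3) xy by force
  qed
  moreover have "c ` X \<subseteq> F" using c(1) by blast
  ultimately show ?thesis using F(1) by (rule inj_on_finite)
qed

section \<open>Orbit segments of maps with conformal iterates\<close>

text \<open>Let \<open>H i\<close> be the product of the factors \<open>\<Lambda>\<close> along the first \<open>i\<close> points of the orbit of \<open>y\<close>, and let \<open>j\<close>
  be the time at which \<open>H\<close> is largest. Distances between the orbits of \<open>y\<close> and \<open>z\<close> are multiplied
  by about \<open>H i / H j \<le> 1\<close> on the way from time \<open>j\<close> to time \<open>i\<close>, forwards as well as backwards. Hence the
  position at the single time \<open>j\<close> determines the whole segment, up to the accumulated error \<open>K ^ m\<close>.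
  The backward half is where the lower distortion bound is needed.\<close>

lemma orbit_segment_shadowed_from_peak:
  fixes F :: "'a \<Rightarrow> 'a" and \<Lambda> :: "'a \<Rightarrow> real"
  assumes F: "F ` M \<subseteq> M" "F ` S \<subseteq> S" "S \<subseteq> M" and K: "K \<ge> 1"
    and \<Lambda>: "\<And>y. y \<in> S \<Longrightarrow> \<Lambda> y > 0"
    and conf: "\<And>y q. y \<in> S \<Longrightarrow> q \<in> M \<Longrightarrow> d y q < \<rho> \<Longrightarrow>
       \<Lambda> y * d y q \<le> K * d (F y) (F q) \<and> d (F y) (F q) \<le> K * \<Lambda> y * d y q"
    and \<rho>': "\<rho>' \<le> \<rho>" "\<And>x q. x \<in> M \<Longrightarrow> q \<in> M \<Longrightarrow> d (F x) (F q) < \<rho>' \<Longrightarrow> d x q < \<rho>"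
    and y: "y \<in> S"
  shows "\<exists>j\<le>m. \<forall>z\<in>M. d ((F ^^ j) y) ((F ^^ j) z) < \<rho>' / K ^ m \<longrightarrow>
           (\<forall>i\<le>m. d ((F ^^ i) y) ((F ^^ i) z) < \<rho>')"
proof -
  define H where "H = (\<lambda>j. \<Prod>i<j. \<Lambda> ((F ^^ i) y))"
  have yS: "(F ^^ i) y \<in> S" for i by (induction i) (use y F in auto)
  have zM: "(F ^^ i) z \<in> M" if "z \<in> M" for i z by (induction i) (use that F in auto)
  have H_pos: "H j > 0" for j unfolding H_def by (rule prod_pos) (use \<Lambda> yS in auto)
  have H_Suc: "H (Suc j) = H j * \<Lambda> ((F ^^ j) y)" for j by (simp add: H_def)
  obtain j where j: "j \<le> m" "\<And>i. i \<le> m \<Longrightarrow> H i \<le> H j"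
  proof -
    have "Max (H ` {..m}) \<in> H ` {..m}" by (rule Max_in) auto
    then obtain j where j: "Max (H ` {..m}) = H j" "j \<in> {..m}" by (rule imageE)
    show ?thesis
    proof (rule that[of j])
      show "H i \<le> H j" if "i \<le> m" for i
        unfolding j(1)[symmetric] by (rule Max_ge) (use that in auto)
    qed (use j(2) in simp)
  qed
  have "d ((F ^^ i) y) ((F ^^ i) z) < \<rho>'"
    if z: "z \<in> M" and close: "d ((F ^^ j) y) ((F ^^ j) z) < \<rho>' / K ^ m" and i: "i \<le> m" for z i
  proof -
    define \<delta> where "\<delta> = (\<lambda>i. d ((F ^^ i) y) ((F ^^ i) z))"
    have close': "\<delta> j < \<rho>' / K ^ m" using close by (simp add: \<delta>_def)
    have yM: "(F ^^ i) y \<in> M" for i using yS F(3) by blast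
    have \<delta>_nonneg: "\<delta> i \<ge> 0" for i unfolding \<delta>_def by (rule nonneg[OF yM zM[OF z]])
    have Km: "K ^ k \<le> K ^ m" "K ^ k > 0" if "k \<le> m" for k
      using K that by (auto intro: power_increasing)
    \<comment> \<open>The estimate for one time keeps the orbits close enough to make the next step of the induction.\<close>
    have peak: "\<delta> i < \<rho>'" if "i \<le> m" "k \<le> m" "H j * \<delta> i \<le> K ^ k * H i * \<delta> j" for i k
    proof -
      have "K ^ k * H i * \<delta> j \<le> K ^ m * H j * \<delta> j"
        using Km[OF that(2)] j(2)[OF that(1)] H_pos[of i] \<delta>_nonneg[of j]
        by (intro mult_right_mono mult_mono) auto
      with that(3) have "H j * \<delta> i \<le> K ^ m * H j * \<delta> j" by (rule order_trans)
      also have "\<dots> = H j * (K ^ m * \<delta> j)" by simp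
      finally have "\<delta> i \<le> K ^ m * \<delta> j" using H_pos[of j] by (simp only: mult_le_cancel_left_pos)
      also have "\<dots> < \<rho>'" using close' Km(2)[of m] by (simp add: field_simps)
      finally show ?thesis .
    qed
    have forward: "j + k \<le> m \<Longrightarrow> H j * \<delta> (j + k) \<le> K ^ k * H (j + k) * \<delta> j" for k
    proof (induction k)
      case (Suc k)
      then have IH: "H j * \<delta> (j + k) \<le> K ^ k * H (j + k) * \<delta> j" by simp
      have "\<delta> (j + k) < \<rho>'" by (rule peak[OF _ _ IH]) (use Suc in auto)
      then have "\<delta> (Suc (j + k)) \<le> K * \<Lambda> ((F ^^ (j + k)) y) * \<delta> (j + k)"
        using conf[OF yS zM[OF z], of "j + k"] \<rho>'(1) unfolding \<delta>_def by simp
      then have "H j * \<delta> (Suc (j + k)) \<le> H j * (K * \<Lambda> ((F ^^ (j + k)) y) * \<delta> (j + k))"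
        using H_pos[of j] by (intro mult_left_mono) auto
      also have "\<dots> = K * \<Lambda> ((F ^^ (j + k)) y) * (H j * \<delta> (j + k))" by simp
      also have "\<dots> \<le> K * \<Lambda> ((F ^^ (j + k)) y) * (K ^ k * H (j + k) * \<delta> j)"
        using IH K \<Lambda>[OF yS] by (intro mult_left_mono) (auto intro: less_imp_le)
      also have "\<dots> = K ^ Suc k * H (Suc (j + k)) * \<delta> j" by (simp add: H_Suc)
      finally show ?case by simp
    qed simp
    have backward: "k \<le> j \<Longrightarrow> H j * \<delta> (j - k) \<le> K ^ k * H (j - k) * \<delta> j" for k
    proof (induction k)
      case (Suc k)
      define i where "i = j - Suc k"
      have i: "j - k = Suc i" using Suc.prems by (simp add: i_def)
      have IH: "H j * \<delta> (Suc i) \<le> K ^ k * H (Suc i) * \<delta> j" using Suc i by simp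
      have "\<delta> (Suc i) < \<rho>'" by (rule peak[OF _ _ IH]) (use Suc.prems j(1) i in auto)
      then have "\<delta> i < \<rho>" using \<rho>'(2)[OF yM zM[OF z], of i] unfolding \<delta>_def by simp
      then have "\<Lambda> ((F ^^ i) y) * \<delta> i \<le> K * \<delta> (Suc i)"
        using conf[OF yS zM[OF z], of i] unfolding \<delta>_def by simp
      then have "H j * (\<Lambda> ((F ^^ i) y) * \<delta> i) \<le> H j * (K * \<delta> (Suc i))"
        using H_pos[of j] by (intro mult_left_mono) auto
      also have "\<dots> = K * (H j * \<delta> (Suc i))" by simp
      also have "\<dots> \<le> K * (K ^ k * H (Suc i) * \<delta> j)"
        using IH K by (intro mult_left_mono) auto
      also have "\<dots> = \<Lambda> ((F ^^ i) y) * (K ^ Suc k * H i * \<delta> j)" by (simp add: H_Suc)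
      finally have "\<Lambda> ((F ^^ i) y) * (H j * \<delta> i) \<le> \<Lambda> ((F ^^ i) y) * (K ^ Suc k * H i * \<delta> j)"
        by (simp add: mult.left_commute)
      then show ?case using \<Lambda>[OF yS[of i]] by (simp add: i_def)
    qed simp
    show ?thesis
    proof (cases "j \<le> i")
      case True
      have "\<delta> i < \<rho>'" by (rule peak[of _ "i - j"]) (use forward[of "i - j"] True i in auto)
      then show ?thesis by (simp add: \<delta>_def)
    next
      case False
      have "\<delta> i < \<rho>'" by (rule peak[of _ "j - i"]) (use backward[of "j - i"] False i j(1) in auto)
      then show ?thesis by (simp add: \<delta>_def)
    qed
  qed
  then show ?thesis using j(1) by blast
qed

end

context compact_distance
begin

lemma funpow_in_M: "F ` M \<subseteq> M \<Longrightarrow> x \<in> M \<Longrightarrow> (F ^^ i) x \<in> M"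
  by (induction i) auto

lemma continuous_on_funpow:
  assumes "continuous_on M F" "F ` M \<subseteq> M"
  shows "continuous_on M (F ^^ i)"
proof (induction i)
  case (Suc i)
  have "continuous_on M (F \<circ> F ^^ i)"
    by (rule continuous_on_compose[OF Suc continuous_on_subset[OF assms(1)]])
      (use funpow_in_M[OF assms(2)] in auto)
  then show ?case by simp
qed (simp add: id_def)

lemma uniformly_continuous_iterates:
  assumes "continuous_on M f" "f ` M \<subseteq> M" "e > 0"
  obtains \<delta> where "\<delta> > 0"
    "\<And>i x y. i \<le> N \<Longrightarrow> x \<in> M \<Longrightarrow> y \<in> M \<Longrightarrow> d x y < \<delta> \<Longrightarrow> d ((f ^^ i) x) ((f ^^ i) y) < e"
proof -
  have "\<exists>\<delta>>0. \<forall>i\<le>N. \<forall>x\<in>M. \<forall>y\<in>M. d x y < \<delta> \<longrightarrow> d ((f ^^ i) x) ((f ^^ i) y) < e"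
  proof (induction N)
    case 0
    then show ?case using assms(3) by (intro exI[of _ e]) simp
  next
    case (Suc N)
    then obtain \<delta> where \<delta>: "\<delta> > 0"
      "\<forall>i\<le>N. \<forall>x\<in>M. \<forall>y\<in>M. d x y < \<delta> \<longrightarrow> d ((f ^^ i) x) ((f ^^ i) y) < e" by blast
    have "(f ^^ Suc N) ` M \<subseteq> M" using funpow_in_M[OF assms(2)] by blast
    then obtain \<delta>' where \<delta>': "\<delta>' > 0"
      "\<And>x y. x \<in> M \<Longrightarrow> y \<in> M \<Longrightarrow> d x y < \<delta>' \<Longrightarrow> d ((f ^^ Suc N) x) ((f ^^ Suc N) y) < e"
      using uniformly_continuous[OF continuous_on_funpow[OF assms(1,2)] _ assms(3)] by blast
    have "\<forall>i\<le>Suc N. \<forall>x\<in>M. \<forall>y\<in>M. d x y < min \<delta> \<delta>' \<longrightarrow> d ((f ^^ i) x) ((f ^^ i) y) < e"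
    proof (intro allI ballI impI)
      fix i x y assume "i \<le> Suc N" "x \<in> M" "y \<in> M" "d x y < min \<delta> \<delta>'"
      then show "d ((f ^^ i) x) ((f ^^ i) y) < e"
        using \<delta>(2)[rule_format, of i x y] \<delta>'(2)[of x y] by (cases "i = Suc N") auto
    qed
    then show ?case using \<delta>(1) \<delta>'(1) by (intro exI[of _ "min \<delta> \<delta>'"]) auto
  qed
  then show ?thesis using that by blast
qed

end

lemma floor_eq_imp_diff_less:
  assumes "s > 0" "\<lfloor>x / s\<rfloor> = \<lfloor>y / s\<rfloor>"
  shows "\<bar>x - y\<bar> < (s::real)"
proof -
  have "\<bar>x / s - y / s\<bar> < 1" using assms(2) by linarith
  moreover have "x / s - y / s = (x - y) / s" by (simp add: diff_divide_distrib)
  ultimately show ?thesis using assms(1) by (simp add: field_simps abs_divide)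
qed

text \<open>Coordinates near each point in which \<open>d\<close> is comparable to the Euclidean distance. The constant \<open>C\<close>
  is the same for all points, because it enters the distortion bound for the iterates.\<close>

locale planar_distance = compact_distance M d
  for M :: "'a::t2_space set" and d :: "'a \<Rightarrow> 'a \<Rightarrow> real" +
  fixes \<phi> :: "'a \<Rightarrow> 'a \<Rightarrow> complex" and C :: real
  assumes C: "1 \<le> C"
    and coord_compare: "p \<in> M \<Longrightarrow> \<exists>r>0. \<forall>x\<in>dist_ball M d p r. \<forall>y\<in>dist_ball M d p r.
       norm (\<phi> p x - \<phi> p y) \<le> C * d x y \<and> d x y \<le> C * norm (\<phi> p x - \<phi> p y)"
    and coord_onto: "p \<in> M \<Longrightarrow> r > 0 \<Longrightarrow> \<exists>s>0. ball (\<phi> p p) s \<subseteq> \<phi> p ` dist_ball M d p r"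
begin

text \<open>The box dimension of \<open>M\<close> is at most 2: finitely many coordinate patches cover \<open>M\<close>, and a square
  grid divides each of them. The labels of \<open>\<kappa>\<close> name the patch and the square.\<close>

lemma few_small_cells:
  obtains a where "a > 0" "\<And>t. 0 < t \<Longrightarrow> t \<le> 1 \<Longrightarrow>
    \<exists>\<kappa> :: 'a \<Rightarrow> 'a \<times> int \<times> int. finite (\<kappa> ` M) \<and> card (\<kappa> ` M) \<le> a / t\<^sup>2 \<and>
      (\<forall>x\<in>M. \<forall>y\<in>M. \<kappa> x = \<kappa> y \<longrightarrow> d x y < t)"
proof -
  obtain r where r: "\<And>p. p \<in> M \<Longrightarrow> r p > 0" and
    cmp: "\<And>p. p \<in> M \<Longrightarrow> \<forall>x\<in>B p (r p). \<forall>y\<in>B p (r p).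
       norm (\<phi> p x - \<phi> p y) \<le> C * d x y \<and> d x y \<le> C * norm (\<phi> p x - \<phi> p y)"
    using coord_compare by metis
  obtain F where F: "finite F" "F \<subseteq> M" "M \<subseteq> (\<Union>p\<in>F. B p (r p))"
    using finite_ball_cover[OF compact subset_refl, of r] r by auto
  have "\<forall>x\<in>M. \<exists>p. p \<in> F \<and> x \<in> B p (r p)" using F(3) by blast
  then obtain c where c: "\<And>x. x \<in> M \<Longrightarrow> c x \<in> F" "\<And>x. x \<in> M \<Longrightarrow> x \<in> B (c x) (r (c x))"
    by metis
  define W where "W = C * (\<Sum>p\<in>F. r p)"
  have r_le: "C * r p \<le> W" if "p \<in> F" for p
    unfolding W_def using C r F(1,2) that by (intro mult_left_mono member_le_sum) (auto intro: less_imp_le)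
  have W0: "W \<ge> 0" unfolding W_def using C r F(2) by (intro mult_nonneg_nonneg sum_nonneg) (auto intro: less_imp_le)
  have disp: "norm (\<phi> (c x) x - \<phi> (c x) (c x)) \<le> W" if "x \<in> M" for x
  proof -
    have cM: "c x \<in> M" using c(1)[OF that] F(2) by blast
    have "norm (\<phi> (c x) x - \<phi> (c x) (c x)) \<le> C * d x (c x)"
      using cmp[OF cM] c(2)[OF that] center_in_ball[OF cM r[OF cM]] by blast
    also have "\<dots> \<le> C * r (c x)" using C c(2)[OF that] commute[of x "c x"]
      by (intro mult_left_mono) (auto simp: in_ball)
    finally show ?thesis using r_le[OF c(1)[OF that]] by simp
  qed
  define w where "w = 4 * W * C + 2"
  have w: "w > 0" using W0 C by (simp add: w_def add_nonneg_pos)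
  show ?thesis
  proof (rule that[of "(card F + 1) * w\<^sup>2"])
    show "0 < real (card F + 1) * w\<^sup>2" using w by simp
    fix t :: real assume t: "0 < t" "t \<le> 1"
    \<comment> \<open>Points of one square differ by less than \<open>2 * s\<close> in coordinates, so their distance is less than \<open>2 * s * C = t\<close>.\<close>
    define s where "s = t / (2 * C)"
    have s: "s > 0" using t C by (simp add: s_def)
    define \<kappa> where "\<kappa> = (\<lambda>x. (c x, \<lfloor>Re (\<phi> (c x) x - \<phi> (c x) (c x)) / s\<rfloor>,
        \<lfloor>Im (\<phi> (c x) x - \<phi> (c x) (c x)) / s\<rfloor>))"
    define J where "J = {\<lfloor>- W / s\<rfloor>..\<lfloor>W / s\<rfloor>}"
    have in_J: "\<lfloor>u / s\<rfloor> \<in> J" if "\<bar>u\<bar> \<le> W" for u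
    proof -
      have "- W / s \<le> u / s" "u / s \<le> W / s" using that s by (auto simp: abs_le_iff field_simps)
      then show ?thesis unfolding J_def by (simp add: floor_mono)
    qed
    have sub: "\<kappa> ` M \<subseteq> F \<times> (J \<times> J)"
    proof (rule image_subsetI)
      fix x assume x: "x \<in> M"
      have "\<bar>Re (\<phi> (c x) x - \<phi> (c x) (c x))\<bar> \<le> W" "\<bar>Im (\<phi> (c x) x - \<phi> (c x) (c x))\<bar> \<le> W"
        using disp[OF x] abs_Re_le_cmod abs_Im_le_cmod order_trans by blast+
      then show "\<kappa> x \<in> F \<times> (J \<times> J)" unfolding \<kappa>_def using c(1)[OF x] in_J by simp
    qed
    have fin: "finite (F \<times> (J \<times> J))" using F(1) by (simp add: J_def)
    have "real (card J) \<le> 2 * (W / s) + 2"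
    proof -
      have "\<lfloor>- W / s\<rfloor> \<le> \<lfloor>W / s\<rfloor>" using W0 s by (intro floor_mono divide_right_mono) auto
      then have "real (card J) = real_of_int \<lfloor>W / s\<rfloor> - real_of_int \<lfloor>- (W / s)\<rfloor> + 1"
        by (simp add: J_def)
      then show ?thesis by linarith
    qed
    also have "\<dots> = (4 * W * C) / t + 2" using t C by (simp add: s_def field_simps)
    also have "\<dots> \<le> (4 * W * C) / t + 2 / t" using t by (simp add: field_simps)
    also have "\<dots> = w / t" by (simp add: w_def add_divide_distrib)
    finally have J: "real (card J) \<le> w / t" .
    have "real (card (\<kappa> ` M)) \<le> real (card F) * (real (card J) * real (card J))"
      using card_mono[OF fin sub] unfolding card_cartesian_product of_nat_mult[symmetric] of_nat_le_iff .
    also have "\<dots> \<le> real (card F + 1) * ((w / t) * (w / t))"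
      using J t w by (intro mult_mono) auto
    also have "\<dots> = real (card F + 1) * w\<^sup>2 / t\<^sup>2" by (simp add: power2_eq_square)
    finally have card: "real (card (\<kappa> ` M)) \<le> real (card F + 1) * w\<^sup>2 / t\<^sup>2" .
    have "d x y < t" if xy: "x \<in> M" "y \<in> M" "\<kappa> x = \<kappa> y" for x y
    proof -
      have cxy: "c y = c x" using xy by (simp add: \<kappa>_def)
      have cM: "c x \<in> M" using c(1)[OF xy(1)] F(2) by blast
      define v where "v = \<phi> (c x) x - \<phi> (c x) y"
      have Re: "\<bar>Re (\<phi> (c x) x - \<phi> (c x) (c x)) - Re (\<phi> (c x) y - \<phi> (c x) (c x))\<bar> < s"
        by (rule floor_eq_imp_diff_less[OF s]) (use xy(3) cxy in \<open>simp add: \<kappa>_def\<close>)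
      have Im: "\<bar>Im (\<phi> (c x) x - \<phi> (c x) (c x)) - Im (\<phi> (c x) y - \<phi> (c x) (c x))\<bar> < s"
        by (rule floor_eq_imp_diff_less[OF s]) (use xy(3) cxy in \<open>simp add: \<kappa>_def\<close>)
      have "norm v \<le> \<bar>Re v\<bar> + \<bar>Im v\<bar>" by (rule cmod_le)
      also have "\<dots> < 2 * s" using Re Im by (simp add: v_def)
      finally have "C * norm v < C * (2 * s)" using C by simp
      also have "\<dots> = t" using C by (simp add: s_def)
      finally show "d x y < t"
        using cmp[OF cM] c(2)[OF xy(1)] c(2)[OF xy(2)] unfolding cxy v_def by fastforce
    qed
    then show "\<exists>\<kappa> :: 'a \<Rightarrow> 'a \<times> int \<times> int. finite (\<kappa> ` M) \<and> card (\<kappa> ` M) \<le> real (card F + 1) * w\<^sup>2 / t\<^sup>2 \<and>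
      (\<forall>x\<in>M. \<forall>y\<in>M. \<kappa> x = \<kappa> y \<longrightarrow> d x y < t)"
      using finite_subset[OF sub fin] card by (intro exI[of _ \<kappa>]) blast
  qed
qed

text \<open>Cut the time interval into blocks of \<open>N\<close> steps. By \<open>orbit_segment_shadowed_from_peak\<close>, a segment is
  determined by the block in which it peaks and by its position then, to precision \<open>\<rho>' / K ^ (n div N)\<close>.
  There are at most about \<open>n * K ^ (2 * n / N)\<close> such data. Since \<open>K\<close> does not depend on \<open>N\<close>, the growth
  rate is arbitrarily small for large \<open>N\<close>.\<close>

lemma subexponentially_many_orbit_segments:
  assumes f: "continuous_on M f" "f ` M \<subseteq> M" and f': "continuous_on M f'" "f' ` M \<subseteq> M" "\<And>x. x \<in> M \<Longrightarrow> f' (f x) = x"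
    and S: "compact S" "S \<subseteq> M" "f ` S \<subseteq> S" and K: "K \<ge> 1"
    and conf: "\<And>N p. p \<in> S \<Longrightarrow> \<exists>r>0. \<exists>\<Lambda>>0. \<forall>x\<in>B p r. \<forall>y\<in>B p r.
       \<Lambda> * d x y \<le> K * d ((f ^^ N) x) ((f ^^ N) y) \<and> d ((f ^^ N) x) ((f ^^ N) y) \<le> K * \<Lambda> * d x y"
    and \<epsilon>: "\<epsilon> > 0" and q: "q > 1"
  shows "\<exists>a>0. \<forall>n. \<exists>\<kappa> :: 'a \<Rightarrow> nat \<times> 'a \<times> int \<times> int. finite (\<kappa> ` S) \<and> card (\<kappa> ` S) \<le> a * real (n + 1) * q ^ n \<and>
     (\<forall>x\<in>S. \<forall>y\<in>S. \<kappa> x = \<kappa> y \<longrightarrow> (\<forall>i\<le>n. d ((f ^^ i) x) ((f ^^ i) y) < \<epsilon>))"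
proof -
  \<comment> \<open>This block length makes the number of cells, \<open>(K ^ m)\<^sup>2\<close> for \<open>m = n div N\<close>, at most \<open>q ^ n\<close>.\<close>
  obtain N0 where N0: "K\<^sup>2 < q ^ N0" using real_arch_pow[OF q] by blast
  define N where "N = Suc N0"
  have "q ^ N0 \<le> q ^ N" using q by (simp add: N_def)
  then have N: "K\<^sup>2 \<le> q ^ N" "N > 0" using N0 by (auto simp: N_def)
  define F where "F = f ^^ N"
  have FM: "F ` M \<subseteq> M" unfolding F_def using funpow_in_M[OF f(2)] by blast
  have FS: "F ` S \<subseteq> S"
  proof -
    have "(f ^^ i) x \<in> S" if "x \<in> S" for i x by (induction i) (use that S(3) in auto)
    then show ?thesis unfolding F_def by blast
  qed
  have F_pow: "F ^^ j = f ^^ (N * j)" for j unfolding F_def by (simp add: funpow_mult)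
  define P where "P = (\<lambda>U. \<exists>\<Lambda>>0. \<forall>x\<in>U. \<forall>y\<in>U. \<Lambda> * d x y \<le> K * d (F x) (F y) \<and> d (F x) (F y) \<le> K * \<Lambda> * d x y)"
  obtain \<rho> where \<rho>: "\<rho> > 0" "\<And>p. p \<in> S \<Longrightarrow> P (B p \<rho>)"
  proof (rule lebesgue_number[OF S(1,2), of P])
    show "\<exists>r>0. P (B p r)" if "p \<in> S" for p unfolding P_def F_def using conf[OF that] .
    show "P U" if "P V" "U \<subseteq> V" for U V using that unfolding P_def by (meson subsetD)
  qed (rule that)
  obtain \<Lambda> where \<Lambda>: "\<And>p. p \<in> S \<Longrightarrow> \<Lambda> p > 0" "\<And>p. p \<in> S \<Longrightarrow> \<forall>x\<in>B p \<rho>. \<forall>y\<in>B p \<rho>.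
      \<Lambda> p * d x y \<le> K * d (F x) (F y) \<and> d (F x) (F y) \<le> K * \<Lambda> p * d x y"
    using \<rho>(2) unfolding P_def by metis
  have conf': "\<Lambda> y * d y z \<le> K * d (F y) (F z) \<and> d (F y) (F z) \<le> K * \<Lambda> y * d y z"
    if "y \<in> S" "z \<in> M" "d y z < \<rho>" for y z
    using \<Lambda>(2)[OF that(1)] center_in_ball[OF subsetD[OF S(2) that(1)] \<rho>(1)] that in_ball by blast
  have inv: "(f' ^^ i) ((f ^^ i) x) = x" if "x \<in> M" for i x
  proof (induction i)
    case (Suc i)
    have "(f' ^^ Suc i) ((f ^^ Suc i) x) = (f' ^^ i) (f' (f ((f ^^ i) x)))"
      by (simp add: funpow_swap1)
    also have "\<dots> = x" using f'(3)[OF funpow_in_M[OF f(2) that]] Suc by simp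
    finally show ?case .
  qed simp
  obtain \<delta> where \<delta>: "\<delta> > 0" "\<And>i x y. i \<le> N \<Longrightarrow> x \<in> M \<Longrightarrow> y \<in> M \<Longrightarrow> d x y < \<delta> \<Longrightarrow> d ((f' ^^ i) x) ((f' ^^ i) y) < \<rho>"
    by (rule uniformly_continuous_iterates[OF f'(1,2) \<rho>(1), of N]) (rule that)
  obtain \<eta> where \<eta>: "\<eta> > 0" "\<And>i x y. i \<le> N \<Longrightarrow> x \<in> M \<Longrightarrow> y \<in> M \<Longrightarrow> d x y < \<eta> \<Longrightarrow> d ((f ^^ i) x) ((f ^^ i) y) < \<epsilon> / 2"
    by (rule uniformly_continuous_iterates[OF f, of "\<epsilon> / 2" N]) (use \<epsilon> that in auto)
  define \<rho>' where "\<rho>' = min (min 1 \<rho>) (min \<delta> \<eta>)"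
  have \<rho>': "\<rho>' > 0" "\<rho>' \<le> 1" "\<rho>' \<le> \<rho>" "\<rho>' \<le> \<delta>" "\<rho>' \<le> \<eta>" using \<rho> \<delta> \<eta> by (auto simp: \<rho>'_def)
  have preimages_close: "d x z < \<rho>" if xz: "x \<in> M" "z \<in> M" and "d (F x) (F z) < \<rho>'" for x z
  proof -
    have "F x \<in> M" "F z \<in> M" "d (F x) (F z) < \<delta>" using that FM \<rho>'(4) by auto
    from \<delta>(2)[OF order_refl this] show ?thesis
      using inv[OF xz(1), of N] inv[OF xz(2), of N] by (simp add: F_def)
  qed
  obtain a where a: "a > 0" and cells: "\<And>t. 0 < t \<Longrightarrow> t \<le> 1 \<Longrightarrow>
    \<exists>\<kappa> :: 'a \<Rightarrow> 'a \<times> int \<times> int. finite (\<kappa> ` M) \<and> card (\<kappa> ` M) \<le> a / t\<^sup>2 \<and>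
      (\<forall>x\<in>M. \<forall>y\<in>M. \<kappa> x = \<kappa> y \<longrightarrow> d x y < t)"
    by (rule few_small_cells) (rule that)
  show ?thesis
  proof (intro exI[of _ "a / \<rho>'\<^sup>2"] conjI allI)
    show "a / \<rho>'\<^sup>2 > 0" using a \<rho>'(1) by simp
    fix n
    define m where "m = n div N"
    have "\<forall>y. \<exists>j. y \<in> S \<longrightarrow> j \<le> m \<and> (\<forall>z\<in>M. d ((F ^^ j) y) ((F ^^ j) z) < \<rho>' / K ^ m \<longrightarrow>
           (\<forall>i\<le>m. d ((F ^^ i) y) ((F ^^ i) z) < \<rho>'))"
      using orbit_segment_shadowed_from_peak[OF FM FS S(2) K \<Lambda>(1) conf' \<rho>'(3) preimages_close] by blast
    then obtain j where j: "\<And>y. y \<in> S \<Longrightarrow> j y \<le> m" and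
      shadow: "\<And>y z i. y \<in> S \<Longrightarrow> z \<in> M \<Longrightarrow> d ((F ^^ j y) y) ((F ^^ j y) z) < \<rho>' / K ^ m \<Longrightarrow> i \<le> m \<Longrightarrow>
           d ((F ^^ i) y) ((F ^^ i) z) < \<rho>'"
      by metis
    define t where "t = \<rho>' / K ^ m"
    have Km: "K ^ m \<ge> 1" using K by simp
    have t: "t > 0" "t \<le> 1" using \<rho>' Km by (auto simp: t_def divide_le_eq_1)
    obtain \<kappa> :: "'a \<Rightarrow> 'a \<times> int \<times> int" where \<kappa>: "finite (\<kappa> ` M)" "card (\<kappa> ` M) \<le> a / t\<^sup>2"
      "\<forall>x\<in>M. \<forall>y\<in>M. \<kappa> x = \<kappa> y \<longrightarrow> d x y < t"
      using cells[OF t] by blast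
    define code where "code = (\<lambda>y. (j y, \<kappa> ((F ^^ j y) y)))"
    have sub: "code ` S \<subseteq> {..m} \<times> \<kappa> ` M"
      unfolding code_def using j S(2) funpow_in_M[OF FM] by auto
    have fin: "finite ({..m} \<times> \<kappa> ` M)" using \<kappa>(1) by simp
    have "real (card (code ` S)) \<le> real (m + 1) * real (card (\<kappa> ` M))"
      using card_mono[OF fin sub] unfolding card_cartesian_product of_nat_mult[symmetric] of_nat_le_iff by simp
    also have "\<dots> \<le> real (n + 1) * (a / t\<^sup>2)"
      using \<kappa>(2) by (intro mult_mono) (auto simp: m_def)
    also have "\<dots> = a / \<rho>'\<^sup>2 * real (n + 1) * (K\<^sup>2) ^ m"
      by (simp add: t_def power_divide power_mult[symmetric] mult.commute)
    also have "\<dots> \<le> a / \<rho>'\<^sup>2 * real (n + 1) * q ^ n"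
    proof (rule mult_left_mono)
      have "(K\<^sup>2) ^ m \<le> (q ^ N) ^ m" using N(1) by (intro power_mono) auto
      also have "\<dots> = q ^ (N * m)" by (simp add: power_mult)
      also have "\<dots> \<le> q ^ n" using q by (intro power_increasing) (auto simp: m_def)
      finally show "(K\<^sup>2) ^ m \<le> q ^ n" .
    qed (use a in simp)
    finally have card: "real (card (code ` S)) \<le> a / \<rho>'\<^sup>2 * real (n + 1) * q ^ n" .
    have "d ((f ^^ i) x) ((f ^^ i) y) < \<epsilon>" if xy: "x \<in> S" "y \<in> S" "code x = code y" and i: "i \<le> n" for x y i
    proof -
      have xyM: "x \<in> M" "y \<in> M" using xy S(2) by auto
      have jj: "j y = j x" using xy(3) by (simp add: code_def)
      have "\<kappa> ((F ^^ j x) x) = \<kappa> ((F ^^ j x) y)" using xy(3) jj by (simp add: code_def)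
      then have "d ((F ^^ j x) x) ((F ^^ j x) y) < t"
        using \<kappa>(3) funpow_in_M[OF FM] xyM by blast
      then have "d ((F ^^ (i div N)) x) ((F ^^ (i div N)) y) < \<rho>'"
        by (intro shadow[OF xy(1) xyM(2)]) (use i in \<open>simp_all add: t_def m_def div_le_mono\<close>)
      then have "d ((F ^^ (i div N)) x) ((F ^^ (i div N)) y) < \<eta>" using \<rho>'(5) by simp
      from \<eta>(2)[OF _ funpow_in_M[OF FM xyM(1)] funpow_in_M[OF FM xyM(2)] this, of "i mod N"]
      have "d ((f ^^ (i mod N)) ((F ^^ (i div N)) x)) ((f ^^ (i mod N)) ((F ^^ (i div N)) y)) < \<epsilon> / 2"
        using N(2) by (simp add: less_imp_le)
      moreover have "(f ^^ (i mod N)) ((F ^^ (i div N)) z) = (f ^^ i) z" for z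
      proof -
        have "(f ^^ (i mod N)) ((F ^^ (i div N)) z) = (f ^^ (i mod N + N * (i div N))) z"
          by (simp only: F_pow funpow_add o_apply)
        then show ?thesis by simp
      qed
      ultimately show ?thesis using \<epsilon> by simp
    qed
    then show "\<exists>\<kappa> :: 'a \<Rightarrow> nat \<times> 'a \<times> int \<times> int. finite (\<kappa> ` S) \<and> card (\<kappa> ` S) \<le> a / \<rho>'\<^sup>2 * real (n + 1) * q ^ n \<and>
       (\<forall>x\<in>S. \<forall>y\<in>S. \<kappa> x = \<kappa> y \<longrightarrow> (\<forall>i\<le>n. d ((f ^^ i) x) ((f ^^ i) y) < \<epsilon>))"
      using finite_subset[OF sub fin] card by (intro exI[of _ code]) blast
  qed
qed

end

section \<open>Separated sets and entropy\<close>

text \<open>Polynomial factors do not affect the exponential growth rate, and \<open>q > 1\<close> is arbitrary.\<close>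

lemma topological_entropy_eq_0:
  assumes few: "\<And>\<epsilon> q. \<epsilon> > 0 \<Longrightarrow> q > 1 \<Longrightarrow> \<exists>a>0. \<exists>c::nat. \<forall>n\<ge>1. \<forall>U. finite U \<longrightarrow> separated_set M d f n \<epsilon> U \<longrightarrow>
     real (card U) \<le> a * real (n + 1) ^ c * q ^ n"
  shows "topological_entropy M d f = 0"
proof -
  define N where "N = max_separated M d f"
  define h where "h = (\<lambda>\<epsilon>. limsup (\<lambda>n. ereal (1 / real n * ln (real (N n \<epsilon>)))))"
  have "h \<epsilon> = 0" if \<epsilon>: "\<epsilon> > 0" for \<epsilon>
  proof (rule antisym)
    have "ereal 0 \<le> ereal (1 / real n * ln (real (N n \<epsilon>)))" for n
      by (cases "N n \<epsilon> = 0") auto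
    then show "0 \<le> h \<epsilon>"
      unfolding h_def zero_ereal_def by (intro le_Limsup always_eventually allI) auto
    show "h \<epsilon> \<le> 0"
    proof (rule ereal_le_epsilon2)
      fix \<delta> :: real assume \<delta>: "0 < \<delta>"
      then have "exp \<delta> > 1" by simp
      from few[OF \<epsilon> this] obtain a c where a: "a > 0" and
        bound: "\<And>n U. n \<ge> 1 \<Longrightarrow> finite U \<Longrightarrow> separated_set M d f n \<epsilon> U \<Longrightarrow>
           real (card U) \<le> a * real (n + 1) ^ c * exp \<delta> ^ n"
        by blast
      have le: "1 / real n * ln (real (N n \<epsilon>)) \<le> (\<bar>ln a\<bar> + real c * ln (real n + 1)) / real n + \<delta>"
        if n: "n \<ge> 1" for n
      proof -
        define X where "X = {card U |U. finite U \<and> separated_set M d f n \<epsilon> U}"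
        define b where "b = a * real (n + 1) ^ c * exp \<delta> ^ n"
        have "x \<le> nat \<lfloor>b\<rfloor>" if "x \<in> X" for x
          using that bound[OF n] unfolding X_def b_def[symmetric] by (auto simp: le_nat_floor)
        then have "finite X" using finite_nat_set_iff_bounded_le by blast
        moreover have "card ({} :: 'a set) \<in> X"
          unfolding X_def separated_set_def by blast
        ultimately have "Max X \<in> X" using Max_in by blast
        then have Nb: "real (N n \<epsilon>) \<le> b"
          using bound[OF n] unfolding N_def max_separated_def X_def b_def by force
        have rhs: "0 \<le> \<bar>ln a\<bar> + real c * ln (real n + 1) + real n * \<delta>" using \<delta> by simp
        have "ln (real (N n \<epsilon>)) \<le> \<bar>ln a\<bar> + real c * ln (real n + 1) + real n * \<delta>"
        proof (cases "N n \<epsilon> = 0")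
          case True
          then show ?thesis using rhs by simp
        next
          case False
          have "ln (real (N n \<epsilon>)) \<le> ln b" using False Nb by simp
          also have "\<dots> = ln a + real c * ln (real n + 1) + real n * \<delta>"
            unfolding b_def using a by (simp add: ln_mult ln_realpow add.commute)
          finally show ?thesis by linarith
        qed
        then show ?thesis using n by (simp add: field_simps)
      qed
      have "h \<epsilon> \<le> limsup (\<lambda>n. ereal ((\<bar>ln a\<bar> + real c * ln (real n + 1)) / real n + \<delta>))"
        unfolding h_def
        by (rule Limsup_mono) (use le in \<open>auto simp: eventually_sequentially intro!: exI[of _ 1]\<close>)
      also have "\<dots> = ereal \<delta>"
      proof (rule lim_imp_Limsup)
        have "(\<lambda>n. (\<bar>ln a\<bar> + real c * ln (real n + 1)) / real n + \<delta>) \<longlonglongrightarrow> \<delta>"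
          by real_asymp
        then show "(\<lambda>n. ereal ((\<bar>ln a\<bar> + real c * ln (real n + 1)) / real n + \<delta>)) \<longlonglongrightarrow> ereal \<delta>"
          by simp
      qed simp
      finally show "h \<epsilon> \<le> 0 + ereal \<delta>" by simp
    qed
  qed
  then have "eventually (\<lambda>\<epsilon>. h \<epsilon> = 0) (at_right 0)"
    by (auto simp: eventually_at_right_field intro!: exI[of _ 1])
  then have "(h \<longlongrightarrow> 0) (at_right 0)" by (rule tendsto_eventually)
  then have "Lim (at_right 0) h = 0" by (intro tendsto_Lim) simp_all
  then show ?thesis unfolding topological_entropy_def h_def N_def .
qed

context compact_distance
begin

text \<open>A separated set injects into the codes.\<close>

lemma exists_code_imp_card_le:
  assumes n: "n \<ge> 1" and sep: "separated_set M d f n \<epsilon> U"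
    and fin: "finite (\<kappa> ` M)" and b: "real (card (\<kappa> ` M)) \<le> b"
    and \<kappa>: "\<And>x y. x \<in> M \<Longrightarrow> y \<in> M \<Longrightarrow> \<kappa> x = \<kappa> y \<Longrightarrow> \<forall>i\<le>n. d ((f ^^ i) x) ((f ^^ i) y) < \<epsilon>"
  shows "real (card U) \<le> b"
proof -
  have UM: "U \<subseteq> M" using sep by (simp add: separated_set_def)
  have "inj_on \<kappa> U"
  proof (rule inj_onI, rule ccontr)
    fix x y assume xy: "x \<in> U" "y \<in> U" "\<kappa> x = \<kappa> y" "x \<noteq> y"
    then have "\<epsilon> \<le> dyn_dist d f n x y" using sep by (simp add: separated_set_def)
    moreover have "\<forall>i\<le>n. d ((f ^^ i) x) ((f ^^ i) y) < \<epsilon>"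
      using xy UM by (intro \<kappa>) auto
    then have "dyn_dist d f n x y < \<epsilon>"
      unfolding dyn_dist_def using n by (subst Max_less_iff) auto
    ultimately show False by simp
  qed
  then have "card U \<le> card (\<kappa> ` M)" using card_inj_on_le[OF _ image_mono[OF UM] fin] by blast
  then show ?thesis using b by linarith
qed

end

context planar_distance
begin

text \<open>A point outside \<open>S\<close> lies in some domain and is followed by a point of \<open>S\<close> on the boundary of that
  domain, except during visits to the finitely many domains of diameter at least \<open>\<epsilon> / 4\<close>. Domains
  wander, so each of these is visited at most once, and recording time and place of the visits
  costs only a polynomial factor.\<close>

lemma few_separated_points:
  fixes D :: "int \<Rightarrow> 'a set"
  assumes f: "continuous_on M f" "f ` M \<subseteq> M" and f': "continuous_on M f'" "f' ` M \<subseteq> M" "\<And>x. x \<in> M \<Longrightarrow> f' (f x) = x"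
    and S: "compact S" "S \<subseteq> M" "f ` S \<subseteq> S" and K: "K \<ge> 1"
    and conf: "\<And>N p. p \<in> S \<Longrightarrow> \<exists>r>0. \<exists>\<Lambda>>0. \<forall>x\<in>B p r. \<forall>y\<in>B p r.
       \<Lambda> * d x y \<le> K * d ((f ^^ N) x) ((f ^^ N) y) \<and> d ((f ^^ N) x) ((f ^^ N) y) \<le> K * \<Lambda> * d x y"
    and D: "M = S \<union> (\<Union>k. D k)" "\<And>k. \<exists>k'. f ` D k \<subseteq> D k'"
    and wandering: "\<And>k n. n > 0 \<Longrightarrow> (f ^^ n) ` D k \<inter> D k = {}"
    and bdry: "\<And>k. closure_in M (D k) \<inter> S \<noteq> {}"
    and small: "\<And>e. e > 0 \<Longrightarrow> finite {k. \<exists>x\<in>closure_in M (D k). \<exists>y\<in>closure_in M (D k). e \<le> d x y}"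
    and \<epsilon>: "\<epsilon> > 0" and q: "q > 1"
  shows "\<exists>a>0. \<exists>c::nat. \<forall>n\<ge>1. \<forall>U. finite U \<longrightarrow> separated_set M d f n \<epsilon> U \<longrightarrow>
     real (card U) \<le> a * real (n + 1) ^ c * q ^ n"
proof -
  define cl where "cl = (\<lambda>k. closure_in M (D k))"
  have DM: "D k \<subseteq> M" for k using D(1) by blast
  have Dcl: "D k \<subseteq> cl k" for k unfolding cl_def by (rule closure_of_subset) (simp add: DM)
  have clM: "cl k \<subseteq> M" for k unfolding cl_def using closure_of_subset_topspace[of "top_of_set M" "D k"] by simp
  have cmap: "continuous_map (top_of_set M) (top_of_set M) f" using f by (auto simp: Pi_iff)
  have step: "\<exists>k'. f ` D k \<subseteq> D k' \<and> f ` cl k \<subseteq> cl k'" for k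
  proof -
    obtain k' where k': "f ` D k \<subseteq> D k'" using D(2) by blast
    have "f ` cl k \<subseteq> closure_in M (f ` D k)"
      unfolding cl_def by (rule continuous_map_image_closure_subset[OF cmap])
    also have "\<dots> \<subseteq> cl k'" unfolding cl_def by (rule closure_of_mono[OF k'])
    finally show ?thesis using k' by blast
  qed
  have orbit: "\<exists>k'. (f ^^ i) ` D k \<subseteq> D k' \<and> (f ^^ i) ` cl k \<subseteq> cl k'" for i k
  proof (induction i)
    case 0
    have "(f ^^ 0) ` D k \<subseteq> D k \<and> (f ^^ 0) ` cl k \<subseteq> cl k" by simp
    then show ?case by blast
  next
    case (Suc i)
    then obtain k' where k': "(f ^^ i) ` D k \<subseteq> D k'" "(f ^^ i) ` cl k \<subseteq> cl k'" by blast
    obtain k'' where k'': "f ` D k' \<subseteq> D k''" "f ` cl k' \<subseteq> cl k''" using step by blast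
    have "(f ^^ Suc i) ` X = f ` ((f ^^ i) ` X)" for X by (simp add: image_comp)
    then have "(f ^^ Suc i) ` D k \<subseteq> D k'' \<and> (f ^^ Suc i) ` cl k \<subseteq> cl k''"
      using k' k'' by (metis image_mono order_trans)
    then show ?case by blast
  qed
  have "\<forall>k. \<exists>b. b \<in> cl k \<and> b \<in> S" using bdry unfolding cl_def by blast
  then obtain b where b: "\<And>k. b k \<in> cl k" "\<And>k. b k \<in> S" by metis
  define big where "big = {k. \<exists>x\<in>cl k. \<exists>y\<in>cl k. \<epsilon> / 4 \<le> d x y}"
  have fin_big: "finite big" unfolding big_def cl_def using small[of "\<epsilon> / 4"] \<epsilon> by simp
  have "\<exists>s. s \<in> S \<and> (\<forall>i. (\<forall>k\<in>big. (f ^^ i) x \<notin> D k) \<longrightarrow> d ((f ^^ i) x) ((f ^^ i) s) < \<epsilon> / 4)"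
    if x: "x \<in> M" for x
  proof (cases "x \<in> S")
    case True
    then show ?thesis using self[OF funpow_in_M[OF f(2) x]] \<epsilon> by (intro exI[of _ x]) simp
  next
    case False
    then obtain k where k: "x \<in> D k" using x D(1) by blast
    have "d ((f ^^ i) x) ((f ^^ i) (b k)) < \<epsilon> / 4" if i: "\<forall>k\<in>big. (f ^^ i) x \<notin> D k" for i
    proof -
      obtain k' where k': "(f ^^ i) ` D k \<subseteq> D k'" "(f ^^ i) ` cl k \<subseteq> cl k'" using orbit by blast
      have xk': "(f ^^ i) x \<in> D k'" using k' k by blast
      then have "k' \<notin> big" using i by blast
      moreover have "(f ^^ i) x \<in> cl k'" using xk' Dcl by blast
      moreover have "(f ^^ i) (b k) \<in> cl k'" using k' b(1) by blast
      ultimately show ?thesis unfolding big_def by (auto simp: not_le)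
    qed
    then show ?thesis using b(2) by blast
  qed
  then obtain s where s: "\<And>x. x \<in> M \<Longrightarrow> s x \<in> S"
    "\<And>x i. x \<in> M \<Longrightarrow> \<forall>k\<in>big. (f ^^ i) x \<notin> D k \<Longrightarrow> d ((f ^^ i) x) ((f ^^ i) (s x)) < \<epsilon> / 4"
    by metis
  have once: "i = j" if "(f ^^ i) x \<in> D k" "(f ^^ j) x \<in> D k" for i j k x
  proof -
    have False if ij: "i < j" "(f ^^ i) x \<in> D k" "(f ^^ j) x \<in> D k" for i j
    proof -
      have "(f ^^ j) x = (f ^^ (j - i)) ((f ^^ i) x)"
        using ij(1) funpow_add[of "j - i" i f] by simp
      then have "(f ^^ j) x \<in> (f ^^ (j - i)) ` D k \<inter> D k" using ij by blast
      then show False using wandering[of "j - i" k] ij(1) by simp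
    qed
    then show ?thesis using that by (meson linorder_neqE_nat)
  qed
  obtain a where a: "a > 0" and codes: "\<And>n. \<exists>\<kappa> :: 'a \<Rightarrow> nat \<times> 'a \<times> int \<times> int. finite (\<kappa> ` S) \<and>
     card (\<kappa> ` S) \<le> a * real (n + 1) * q ^ n \<and>
     (\<forall>x\<in>S. \<forall>y\<in>S. \<kappa> x = \<kappa> y \<longrightarrow> (\<forall>i\<le>n. d ((f ^^ i) x) ((f ^^ i) y) < \<epsilon> / 2))"
    using subexponentially_many_orbit_segments[OF f f' S K conf _ q, of "\<epsilon> / 2"] \<epsilon> by auto
  obtain a' where cells: "\<And>t. 0 < t \<Longrightarrow> t \<le> 1 \<Longrightarrow>
    \<exists>\<kappa> :: 'a \<Rightarrow> 'a \<times> int \<times> int. finite (\<kappa> ` M) \<and> card (\<kappa> ` M) \<le> a' / t\<^sup>2 \<and>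
      (\<forall>x\<in>M. \<forall>y\<in>M. \<kappa> x = \<kappa> y \<longrightarrow> d x y < t)"
    by (rule few_small_cells) (rule that)
  obtain \<kappa>0 :: "'a \<Rightarrow> 'a \<times> int \<times> int" where \<kappa>0: "finite (\<kappa>0 ` M)"
    "\<forall>x\<in>M. \<forall>y\<in>M. \<kappa>0 x = \<kappa>0 y \<longrightarrow> d x y < min 1 \<epsilon>"
    using cells[of "min 1 \<epsilon>"] \<epsilon> by auto
  define c0 where "c0 = card (\<kappa>0 ` M)"
  define c where "c = card big"
  show ?thesis
  proof (intro exI[of _ "a * real (1 + c0) ^ c"] exI[of _ "1 + c"] conjI allI impI)
    show "a * real (1 + c0) ^ c > 0" using a by simp
    fix n :: nat and U assume n: "1 \<le> n" and sep: "separated_set M d f n \<epsilon> U"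
    obtain \<kappa>1 :: "'a \<Rightarrow> nat \<times> 'a \<times> int \<times> int" where \<kappa>1: "finite (\<kappa>1 ` S)"
      "card (\<kappa>1 ` S) \<le> a * real (n + 1) * q ^ n"
      "\<forall>x\<in>S. \<forall>y\<in>S. \<kappa>1 x = \<kappa>1 y \<longrightarrow> (\<forall>i\<le>n. d ((f ^^ i) x) ((f ^^ i) y) < \<epsilon> / 2)"
      using codes by blast
    define visit where "visit = (\<lambda>x k. if \<exists>i\<le>n. (f ^^ i) x \<in> D k
        then (let i = (SOME i. i \<le> n \<and> (f ^^ i) x \<in> D k) in Some (i, \<kappa>0 ((f ^^ i) x))) else None)"
    have visit: "visit x k = Some (i, \<kappa>0 ((f ^^ i) x))" if "i \<le> n" "(f ^^ i) x \<in> D k" for x k i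
    proof -
      have "(SOME i. i \<le> n \<and> (f ^^ i) x \<in> D k) = i"
        by (rule some_equality) (use that once in blast)+
      then show ?thesis using that unfolding visit_def by auto
    qed
    have visitD: "i \<le> n \<and> (f ^^ i) x \<in> D k \<and> z = \<kappa>0 ((f ^^ i) x)" if "visit x k = Some (i, z)" for x k i z
    proof -
      have "\<exists>i\<le>n. (f ^^ i) x \<in> D k"
      proof (rule ccontr)
        assume "\<not> (\<exists>i\<le>n. (f ^^ i) x \<in> D k)"
        then have "visit x k = None" unfolding visit_def by (rule if_not_P)
        then show False using that by simp
      qed
      then obtain i' where i': "i' \<le> n" "(f ^^ i') x \<in> D k" by blast
      then show ?thesis using visit[OF i'] that by auto
    qed
    define T where "T = insert None (Some ` ({..n} \<times> \<kappa>0 ` M))"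
    have finT: "finite T" using \<kappa>0(1) by (simp add: T_def)
    have "card T \<le> Suc (card (Some ` ({..n} \<times> \<kappa>0 ` M)))" unfolding T_def by (rule card_insert_le_m1) auto
    also have "\<dots> \<le> Suc (card ({..n} \<times> \<kappa>0 ` M))"
      by (rule iffD2[OF Suc_le_mono card_image_le]) (use \<kappa>0(1) in simp)
    also have "\<dots> \<le> (1 + c0) * (n + 1)" by (simp add: c0_def card_cartesian_product)
    finally have cardT: "card T \<le> (1 + c0) * (n + 1)" .
    define code where "code = (\<lambda>x. (\<kappa>1 (s x), restrict (visit x) big))"
    have visitT: "visit x k \<in> T" if x: "x \<in> M" for x k
    proof (cases "visit x k")
      case (Some v)
      then obtain i z where "visit x k = Some (i, z)" by (cases v) auto
      with visitD[OF this] show ?thesis using funpow_in_M[OF f(2) x] by (auto simp: T_def)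
    qed (simp add: T_def)
    have sub: "code ` M \<subseteq> \<kappa>1 ` S \<times> (big \<rightarrow>\<^sub>E T)"
      unfolding code_def using s(1) visitT by auto
    have fin: "finite (\<kappa>1 ` S \<times> (big \<rightarrow>\<^sub>E T))" using \<kappa>1(1) finT fin_big by (simp add: finite_PiE)
    have "card (code ` M) \<le> card (\<kappa>1 ` S) * card T ^ c"
      using card_mono[OF fin sub] fin_big by (simp add: card_cartesian_product card_PiE c_def)
    then have "real (card (code ` M)) \<le> real (card (\<kappa>1 ` S)) * real (card T) ^ c"
      by (metis of_nat_le_iff of_nat_mult of_nat_power)
    also have "\<dots> \<le> (a * real (n + 1) * q ^ n) * (real (1 + c0) * real (n + 1)) ^ c"
      using \<kappa>1(2) cardT a q by (intro mult_mono power_mono) (auto simp flip: of_nat_mult of_nat_Suc)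
    also have "\<dots> = a * real (1 + c0) ^ c * real (n + 1) ^ (1 + c) * q ^ n"
      by (simp add: power_mult_distrib)
    finally have card: "real (card (code ` M)) \<le> a * real (1 + c0) ^ c * real (n + 1) ^ (1 + c) * q ^ n" .
    have near: "d ((f ^^ i) x) ((f ^^ i) y) < \<epsilon>"
      if xy: "x \<in> M" "y \<in> M" "code x = code y" and i: "i \<le> n" and k: "k \<in> big" "(f ^^ i) x \<in> D k" for x y i k
    proof -
      have "visit x k = visit y k" using xy(3) k(1) by (auto simp: code_def restrict_def fun_eq_iff split: if_splits)
      then have "visit y k = Some (i, \<kappa>0 ((f ^^ i) x))" using visit[OF i k(2)] by simp
      then have "\<kappa>0 ((f ^^ i) x) = \<kappa>0 ((f ^^ i) y)" using visitD by blast
      then show ?thesis using \<kappa>0(2) funpow_in_M[OF f(2)] xy by fastforce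
    qed
    have sep': "\<forall>i\<le>n. d ((f ^^ i) x) ((f ^^ i) y) < \<epsilon>" if xy: "x \<in> M" "y \<in> M" "code x = code y" for x y
    proof (intro allI impI)
      fix i assume i: "i \<le> n"
      consider k where "k \<in> big" "(f ^^ i) x \<in> D k" | k where "k \<in> big" "(f ^^ i) y \<in> D k"
        | "\<forall>k\<in>big. (f ^^ i) x \<notin> D k" "\<forall>k\<in>big. (f ^^ i) y \<notin> D k" by blast
      then show "d ((f ^^ i) x) ((f ^^ i) y) < \<epsilon>"
      proof cases
        case (1 k)
        then show ?thesis using near xy i by blast
      next
        case (2 k)
        then show ?thesis using near[OF xy(2,1) xy(3)[symmetric] i] commute by metis
      next
        case 3
        have sx: "s x \<in> S" "s y \<in> S" using s(1) xy by auto
        then have sM: "s x \<in> M" "s y \<in> M" using S(2) by auto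
        have "\<kappa>1 (s x) = \<kappa>1 (s y)" using xy(3) by (simp add: code_def)
        then have "d ((f ^^ i) (s x)) ((f ^^ i) (s y)) < \<epsilon> / 2" using \<kappa>1(3) sx i by blast
        moreover have "d ((f ^^ i) x) ((f ^^ i) (s x)) < \<epsilon> / 4" using s(2)[OF xy(1) 3(1)] .
        moreover have "d ((f ^^ i) (s y)) ((f ^^ i) y) < \<epsilon> / 4" using s(2)[OF xy(2) 3(2)] commute by metis
        moreover note triangle[OF funpow_in_M[OF f(2) xy(1)] funpow_in_M[OF f(2) sM(1)] funpow_in_M[OF f(2) xy(2)], of i i i]
          triangle[OF funpow_in_M[OF f(2) sM(1)] funpow_in_M[OF f(2) sM(2)] funpow_in_M[OF f(2) xy(2)], of i i i]
        ultimately show ?thesis by linarith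
      qed
    qed
    show "real (card U) \<le> a * real (1 + c0) ^ c * real (n + 1) ^ (1 + c) * q ^ n"
      by (rule exists_code_imp_card_le[OF n sep finite_subset[OF sub fin] card sep'])
  qed
qed

end

section \<open>Conformal distortion of iterates\<close>

context planar_distance
begin

text \<open>The derivative at \<open>p\<close> in coordinates, in the strict sense: it controls the images of any two points
  near \<open>p\<close>. The nearby domains need not contain \<open>p\<close>.\<close>

definition strict_deriv :: "('a \<Rightarrow> 'a) \<Rightarrow> 'a \<Rightarrow> (complex \<Rightarrow> complex) \<Rightarrow> bool" where
  "strict_deriv F p T \<longleftrightarrow> bounded_linear T \<and> (\<forall>e>0. \<exists>r>0. \<forall>x\<in>B p r. \<forall>y\<in>B p r.
     norm (\<phi> (F p) (F x) - \<phi> (F p) (F y) - T (\<phi> p x - \<phi> p y)) \<le> e * norm (\<phi> p x - \<phi> p y))"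

lemma strict_deriv_bounded_linear: "strict_deriv F p T \<Longrightarrow> bounded_linear T"
  by (simp add: strict_deriv_def)

lemma strict_derivD:
  assumes "strict_deriv F p T" "e > 0"
  obtains r where "r > 0" "\<And>x y. x \<in> B p r \<Longrightarrow> y \<in> B p r \<Longrightarrow>
     norm (\<phi> (F p) (F x) - \<phi> (F p) (F y) - T (\<phi> p x - \<phi> p y)) \<le> e * norm (\<phi> p x - \<phi> p y)"
  using assms unfolding strict_deriv_def by blast

lemma continuous_at_ball:
  assumes "continuous_on M F" "F ` M \<subseteq> M" "p \<in> M" "e > 0"
  obtains r where "r > 0" "F ` B p r \<subseteq> B (F p) e"
proof -
  obtain \<delta> where \<delta>: "\<delta> > 0" "\<And>x y. x \<in> M \<Longrightarrow> y \<in> M \<Longrightarrow> d x y < \<delta> \<Longrightarrow> d (F x) (F y) < e"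
    using uniformly_continuous[OF assms(1,2,4)] by blast
  have "F ` B p \<delta> \<subseteq> B (F p) e"
  proof (rule image_subsetI)
    fix x assume "x \<in> B p \<delta>"
    then show "F x \<in> B (F p) e" using \<delta>(2)[OF assms(3), of x] assms(2) by (auto simp: in_ball)
  qed
  then show ?thesis using that \<delta>(1) by blast
qed

lemma strict_deriv_compose:
  assumes F: "strict_deriv F p T" "continuous_on M F" "F ` M \<subseteq> M" "p \<in> M"
    and G: "strict_deriv G (F p) T'"
  shows "strict_deriv (G \<circ> F) p (T' \<circ> T)"
  unfolding strict_deriv_def
proof (intro conjI allI impI)
  note lin = strict_deriv_bounded_linear[OF F(1)] strict_deriv_bounded_linear[OF G]
  show "bounded_linear (T' \<circ> T)" unfolding o_def by (rule bounded_linear_compose[OF lin(2,1)])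
  fix e :: real assume e: "e > 0"
  define K K' where "K = onorm T + 1" and "K' = onorm T' + 1"
  have K: "K > 0" "K' > 0" using onorm_pos_le[OF lin(1)] onorm_pos_le[OF lin(2)] by (auto simp: K_def K'_def)
  define e1 e2 where "e1 = min 1 (e / (2 * K'))" and "e2 = e / (2 * K)"
  have e12: "e1 > 0" "e2 > 0" "e1 \<le> 1" using e K by (auto simp: e1_def e2_def)
  obtain r1 where r1: "r1 > 0" "\<And>x y. x \<in> B p r1 \<Longrightarrow> y \<in> B p r1 \<Longrightarrow>
     norm (\<phi> (F p) (F x) - \<phi> (F p) (F y) - T (\<phi> p x - \<phi> p y)) \<le> e1 * norm (\<phi> p x - \<phi> p y)"
    by (rule strict_derivD[OF F(1) e12(1)]) (rule that)
  obtain r2 where r2: "r2 > 0" "\<And>x y. x \<in> B (F p) r2 \<Longrightarrow> y \<in> B (F p) r2 \<Longrightarrow>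
     norm (\<phi> (G (F p)) (G x) - \<phi> (G (F p)) (G y) - T' (\<phi> (F p) x - \<phi> (F p) y)) \<le> e2 * norm (\<phi> (F p) x - \<phi> (F p) y)"
    by (rule strict_derivD[OF G e12(2)]) (rule that)
  obtain r3 where r3: "r3 > 0" "F ` B p r3 \<subseteq> B (F p) r2"
    by (rule continuous_at_ball[OF F(2-4) r2(1)]) (rule that)
  have "norm (\<phi> ((G \<circ> F) p) ((G \<circ> F) x) - \<phi> ((G \<circ> F) p) ((G \<circ> F) y) - (T' \<circ> T) (\<phi> p x - \<phi> p y))
      \<le> e * norm (\<phi> p x - \<phi> p y)" if xy: "x \<in> B p (min r1 r3)" "y \<in> B p (min r1 r3)" for x y
  proof -
    define v w u where "v = \<phi> p x - \<phi> p y" and "w = \<phi> (F p) (F x) - \<phi> (F p) (F y)"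
      and "u = \<phi> (G (F p)) (G (F x)) - \<phi> (G (F p)) (G (F y))"
    have x1: "x \<in> B p r1" "y \<in> B p r1" "x \<in> B p r3" "y \<in> B p r3" using xy by (auto simp: in_ball)
    have 1: "norm (w - T v) \<le> e1 * norm v" unfolding w_def v_def by (rule r1(2)[OF x1(1,2)])
    have 2: "norm (u - T' w) \<le> e2 * norm w"
      unfolding u_def w_def by (rule r2(2)) (use r3(2) x1(3,4) in auto)
    have "norm w \<le> norm (w - T v) + norm (T v)" using norm_triangle_ineq[of "w - T v" "T v"] by simp
    also have "\<dots> \<le> 1 * norm v + onorm T * norm v"
      using 1 onorm[OF lin(1), of v] e12(3) mult_right_mono[OF e12(3) norm_ge_zero[of v]] by linarith
    finally have w: "norm w \<le> K * norm v" by (simp add: K_def algebra_simps)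
    have "norm (T' (w - T v)) \<le> onorm T' * norm (w - T v)" by (rule onorm[OF lin(2)])
    also have "\<dots> \<le> K' * (e / (2 * K') * norm v)"
    proof (rule mult_mono)
      have "e1 * norm v \<le> e / (2 * K') * norm v" by (rule mult_right_mono) (auto simp: e1_def)
      then show "norm (w - T v) \<le> e / (2 * K') * norm v" using 1 by linarith
    qed (use K in \<open>auto simp: K'_def\<close>)
    also have "\<dots> = e / 2 * norm v" using K by simp
    finally have 3: "norm (T' w - T' (T v)) \<le> e / 2 * norm v"
      using linear_diff[OF bounded_linear.linear[OF lin(2)]] by simp
    have "e2 * norm w \<le> e2 * (K * norm v)" by (rule mult_left_mono[OF w]) (use e12 in simp)
    also have "\<dots> = e / 2 * norm v" using K by (simp add: e2_def)
    finally have 4: "norm (u - T' w) \<le> e / 2 * norm v" using 2 by linarith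
    have "norm (u - T' (T v)) \<le> norm (u - T' w) + norm (T' w - T' (T v))"
      using norm_triangle_ineq[of "u - T' w" "T' w - T' (T v)"] by simp
    also have "\<dots> \<le> e * norm v" using 3 4 by (simp add: field_simps)
    finally show ?thesis unfolding u_def v_def by simp
  qed
  then show "\<exists>r>0. \<forall>x\<in>B p r. \<forall>y\<in>B p r. norm (\<phi> ((G \<circ> F) p) ((G \<circ> F) x) - \<phi> ((G \<circ> F) p) ((G \<circ> F) y)
     - (T' \<circ> T) (\<phi> p x - \<phi> p y)) \<le> e * norm (\<phi> p x - \<phi> p y)"
    using r1(1) r3(1) by (intro exI[of _ "min r1 r3"]) auto
qed

lemma strict_deriv_funpow:
  assumes "continuous_on M f" "f ` M \<subseteq> M" "\<And>p. p \<in> M \<Longrightarrow> \<exists>T. strict_deriv f p T" "p \<in> M"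
  shows "\<exists>T. strict_deriv (f ^^ n) p T"
proof (induction n)
  case 0
  have "strict_deriv (f ^^ 0) p (\<lambda>v. v)"
    unfolding strict_deriv_def by (auto intro!: exI[of _ 1])
  then show ?case by blast
next
  case (Suc n)
  then obtain T where T: "strict_deriv (f ^^ n) p T" by blast
  obtain T' where T': "strict_deriv f ((f ^^ n) p) T'"
    using assms(3)[OF funpow_in_M[OF assms(2,4)]] by blast
  have "(f ^^ n) ` M \<subseteq> M" using funpow_in_M[OF assms(2)] by blast
  from strict_deriv_compose[OF T continuous_on_funpow[OF assms(1,2)] this assms(4) T']
  show ?case unfolding funpow.simps(2) by blast
qed

text \<open>If \<open>T\<close> were zero, so would be the strict derivative \<open>T' \<circ> T\<close> of the identity \<open>G \<circ> F\<close>.\<close>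

lemma strict_deriv_nonzero:
  assumes F: "strict_deriv F p T" "continuous_on M F" "F ` M \<subseteq> M" "p \<in> M"
    and G: "strict_deriv G (F p) T'" "\<And>x. x \<in> M \<Longrightarrow> G (F x) = x"
  shows "onorm T > 0"
proof (rule ccontr)
  note lin = strict_deriv_bounded_linear[OF F(1)] strict_deriv_bounded_linear[OF G(1)]
  assume "\<not> onorm T > 0"
  then have T: "T v = 0" for v using onorm_pos_lt[OF lin(1)] by blast
  have T'0: "T' 0 = 0" using linear_0[OF bounded_linear.linear[OF lin(2)]] .
  obtain r where r: "r > 0" and small: "\<And>x y. x \<in> B p r \<Longrightarrow> y \<in> B p r \<Longrightarrow>
     norm (\<phi> ((G \<circ> F) p) ((G \<circ> F) x) - \<phi> ((G \<circ> F) p) ((G \<circ> F) y) - (T' \<circ> T) (\<phi> p x - \<phi> p y)) \<le> 1/2 * norm (\<phi> p x - \<phi> p y)"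
    by (rule strict_derivD[OF strict_deriv_compose[OF F G(1)], of "1/2"]) (simp, rule that)
  obtain s where s: "s > 0" "ball (\<phi> p p) s \<subseteq> \<phi> p ` B p r" using coord_onto[OF F(4) r] by blast
  have "\<phi> p p + of_real (s / 2) \<in> ball (\<phi> p p) s" using s(1) by (simp add: dist_norm del: of_real_divide)
  then obtain x where x: "x \<in> B p r" "\<phi> p x = \<phi> p p + of_real (s / 2)" using s(2) by (metis (no_types, lifting) imageE subsetD)
  have xM: "x \<in> M" using x(1) by (simp add: in_ball)
  have "norm (\<phi> p x - \<phi> p p) \<le> 1/2 * norm (\<phi> p x - \<phi> p p)"
    using small[OF x(1) center_in_ball[OF F(4) r]] by (simp add: T T'0 G(2)[OF F(4)] G(2)[OF xM])
  moreover have "norm (\<phi> p x - \<phi> p p) > 0" using s(1) by (simp add: x(2) del: of_real_divide)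
  ultimately show False by simp
qed

text \<open>The image of a small ball is long in a direction in which \<open>T\<close> nearly attains its norm, and hence
  fits only into a ball of proportional radius.\<close>

lemma distortion_of_balls:
  assumes F: "strict_deriv F p T" "continuous_on M F" "F ` M \<subseteq> M" "p \<in> M" and L: "onorm T > 0"
  obtains r where "r > 0"
    "\<And>x y. x \<in> B p r \<Longrightarrow> y \<in> B p r \<Longrightarrow> d (F x) (F y) \<le> 2 * onorm T * C\<^sup>2 * d x y"
    "\<And>x \<rho> q R. x \<in> B p r \<Longrightarrow> 0 < \<rho> \<Longrightarrow> \<rho> \<le> r \<Longrightarrow> q \<in> M \<Longrightarrow> F ` B x \<rho> \<subseteq> B q R \<Longrightarrow> onorm T * \<rho> \<le> 8 * C\<^sup>2 * R"
proof -
  define L where "L = onorm T"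
  note lin = strict_deriv_bounded_linear[OF F(1)]
  have L0: "L > 0" using L by (simp add: L_def)
  have FpM: "F p \<in> M" using F by blast
  obtain r1 where r1: "r1 > 0" and cmp: "\<forall>x\<in>B p r1. \<forall>y\<in>B p r1.
       norm (\<phi> p x - \<phi> p y) \<le> C * d x y \<and> d x y \<le> C * norm (\<phi> p x - \<phi> p y)"
    using coord_compare[OF F(4)] by blast
  obtain r2 where r2: "r2 > 0" and cmp': "\<forall>x\<in>B (F p) r2. \<forall>y\<in>B (F p) r2.
       norm (\<phi> (F p) x - \<phi> (F p) y) \<le> C * d x y \<and> d x y \<le> C * norm (\<phi> (F p) x - \<phi> (F p) y)"
    using coord_compare[OF FpM] by blast
  obtain r3 where r3: "r3 > 0" "F ` B p r3 \<subseteq> B (F p) r2"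
    by (rule continuous_at_ball[OF F(2-4) r2(1)]) (rule that)
  have "L / 4 > 0" using L0 by simp
  from strict_derivD[OF F(1) this]
  obtain r4 where r4: "r4 > 0" "\<And>x y. x \<in> B p r4 \<Longrightarrow> y \<in> B p r4 \<Longrightarrow>
     norm (\<phi> (F p) (F x) - \<phi> (F p) (F y) - T (\<phi> p x - \<phi> p y)) \<le> L / 4 * norm (\<phi> p x - \<phi> p y)" by blast
  define r5 where "r5 = min r1 (min r3 r4)"
  have r5: "r5 > 0" using r1 r3 r4 by (simp add: r5_def)
  have sub: "B p r5 \<subseteq> B p r1" "B p r5 \<subseteq> B p r3" "B p r5 \<subseteq> B p r4" by (auto simp: r5_def in_ball)
  obtain s where s: "s > 0" "ball (\<phi> p p) s \<subseteq> \<phi> p ` B p r5" using coord_onto[OF F(4) r5] by blast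
  obtain v where v: "norm (T v) > 3/4 * L * norm v"
  proof -
    have "\<not> (\<forall>v. norm (T v) \<le> 3/4 * L * norm v)"
    proof
      assume "\<forall>v. norm (T v) \<le> 3/4 * L * norm v"
      then have "onorm T \<le> 3/4 * L" by (intro onorm_le) simp
      then show False using L0 by (simp add: L_def)
    qed
    then show ?thesis using that by (auto simp: not_le)
  qed
  have v0: "norm v > 0"
    using v linear_0[OF bounded_linear.linear[OF lin]] by (cases "v = 0") auto
  \<comment> \<open>The coordinates of a point of the ball of radius \<open>r\<close>, moved by a vector of length less than \<open>s / 2\<close>, still belong to a point.\<close>
  define r where "r = min r5 (s / (2 * C))"
  have r: "r > 0" "r \<le> r5" "C * r \<le> s / 2" using r5 s C by (auto simp: r_def min_def field_simps)
  show ?thesis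
  proof (rule that[OF r(1)])
    fix x y assume "x \<in> B p r" "y \<in> B p r"
    then have xy: "x \<in> B p r5" "y \<in> B p r5" using r(2) by (auto simp: in_ball)
    define w where "w = \<phi> p x - \<phi> p y"
    define w' where "w' = \<phi> (F p) (F x) - \<phi> (F p) (F y)"
    have w: "norm w \<le> C * d x y" using cmp xy sub unfolding w_def by blast
    have "norm w' \<le> norm (w' - T w) + norm (T w)" using norm_triangle_ineq[of "w' - T w" "T w"] by simp
    also have "\<dots> \<le> L / 4 * norm w + L * norm w"
      using r4(2)[of x y] xy sub onorm[OF lin, of w] unfolding w_def w'_def L_def
      by (intro add_mono) auto
    also have "\<dots> \<le> 2 * L * norm w" using L0 by simp
    also have "\<dots> \<le> 2 * L * (C * d x y)" using w L0 by simp
    finally have w': "norm w' \<le> 2 * L * (C * d x y)" .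
    have "d (F x) (F y) \<le> C * norm w'" unfolding w'_def using cmp' r3(2) xy sub by blast
    also have "\<dots> \<le> C * (2 * L * (C * d x y))" using w' C by simp
    finally show "d (F x) (F y) \<le> 2 * onorm T * C\<^sup>2 * d x y"
      by (simp add: L_def power2_eq_square mult_ac)
  next
    fix x \<rho> q R assume x: "x \<in> B p r" and \<rho>: "0 < \<rho>" "\<rho> \<le> r" and q: "q \<in> M" and im: "F ` B x \<rho> \<subseteq> B q R"
    have x5: "x \<in> B p r5" using x r(2) by (auto simp: in_ball)
    have xM: "x \<in> M" using x by (simp add: in_ball)
    define u where "u = (\<rho> / (2 * C) / norm v) *\<^sub>R v"
    have nu: "norm u = \<rho> / (2 * C)" using \<rho> C v0 by (simp add: u_def)
    have "norm (\<phi> p x - \<phi> p p) \<le> C * d x p" using cmp x5 center_in_ball[OF F(4) r5] sub by blast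
    also have "\<dots> \<le> C * r" using x C commute[of x p] by (intro mult_left_mono) (auto simp: in_ball)
    finally have "norm (\<phi> p x - \<phi> p p) \<le> s / 2" using r(3) by simp
    moreover have "norm u < s / 2"
    proof -
      have "norm u \<le> \<rho> / 2" unfolding nu using \<rho> C by (simp add: field_simps)
      also have "\<dots> < r" using \<rho> by simp
      also have "\<dots> \<le> C * r" using C r(1) by simp
      finally show ?thesis using r(3) by simp
    qed
    ultimately have "norm (\<phi> p x + u - \<phi> p p) < s"
      using norm_triangle_ineq[of "\<phi> p x - \<phi> p p" u] by (simp add: algebra_simps)
    then have "\<phi> p x + u \<in> ball (\<phi> p p) s" by (simp add: dist_norm norm_minus_commute)
    then obtain y where y: "y \<in> B p r5" "\<phi> p y = \<phi> p x + u" using s(2) by (metis (no_types, lifting) imageE subsetD)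
    have yM: "y \<in> M" using y by (simp add: in_ball)
    have "d x y \<le> C * norm (\<phi> p x - \<phi> p y)" using cmp x5 y(1) sub by blast
    also have "\<dots> = \<rho> / 2" using nu C by (simp add: y(2))
    finally have "y \<in> B x \<rho>" using \<rho> yM by (simp add: in_ball)
    then have im': "F x \<in> B q R" "F y \<in> B q R" using im center_in_ball[OF xM \<rho>(1)] by auto
    define w' where "w' = \<phi> (F p) (F y) - \<phi> (F p) (F x)"
    have "norm (T u) \<ge> 3/4 * L * norm u"
    proof -
      have "T u = (\<rho> / (2 * C) / norm v) *\<^sub>R T v"
        unfolding u_def by (rule linear_scale[OF bounded_linear.linear[OF lin]])
      then have "norm (T u) = (\<rho> / (2 * C) / norm v) * norm (T v)" using \<rho> C v0 by simp
      also have "\<dots> \<ge> (\<rho> / (2 * C) / norm v) * (3/4 * L * norm v)"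
        using v \<rho> C v0 by (intro mult_left_mono) auto
      finally show ?thesis using v0 by (simp add: nu mult_ac)
    qed
    moreover have "norm (w' - T u) \<le> L / 4 * norm u"
      using r4(2)[of y x] y x5 sub unfolding w'_def by auto
    moreover have "norm (T u) \<le> norm w' + norm (w' - T u)"
      using norm_triangle_ineq[of w' "T u - w'"] by (simp add: norm_minus_commute)
    ultimately have "L / 2 * norm u \<le> norm w'" by (simp add: field_simps)
    also have "norm w' \<le> C * d (F y) (F x)" unfolding w'_def using cmp' r3(2) y(1) x5 sub by blast
    also have "\<dots> \<le> C * (2 * R)"
    proof (rule mult_left_mono)
      show "d (F y) (F x) \<le> 2 * R"
        using im' q triangle[of "F y" q "F x"] commute[of q "F y"] by (auto simp: in_ball)
    qed (use C in simp)
    finally show "onorm T * \<rho> \<le> 8 * C\<^sup>2 * R"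
      unfolding nu L_def[symmetric] using C by (simp add: field_simps power2_eq_square)
  qed
qed

text \<open>The iterate \<open>F = f ^^ N\<close> maps a tiny domain near \<open>p\<close> to another domain. Both are round up to the
  factor \<open>\<beta>\<close>, so a linear map close to \<open>F\<close> cannot be very eccentric. Precisely, the domain contains a
  ball whose image fits into a ball of radius \<open>Ro (\<sigma> k)\<close>, which bounds the norm of the derivative of
  \<open>F\<close>; the same for the inverse bounds the norm of its derivative; and the unknown sizes of the two
  domains cancel in the product. The bound involves only \<open>C\<close> and \<open>\<beta>\<close>, not \<open>N\<close> or \<open>p\<close>.\<close>

lemma uniformly_quasiconformal_iterates:
  fixes D :: "int \<Rightarrow> 'a set" and c :: "int \<Rightarrow> 'a" and ri Ro :: "int \<Rightarrow> real"
  assumes f: "continuous_on M f" "f ` M \<subseteq> M" "\<And>p. p \<in> M \<Longrightarrow> \<exists>T. strict_deriv f p T"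
    and f': "continuous_on M f'" "f' ` M \<subseteq> M" "\<And>p. p \<in> M \<Longrightarrow> \<exists>T. strict_deriv f' p T"
    and inv: "\<And>x. x \<in> M \<Longrightarrow> f' (f x) = x" "\<And>x. x \<in> M \<Longrightarrow> f (f' x) = x"
    and S: "S \<subseteq> M"
    and D: "inj D" "\<And>k. c k \<in> D k" "\<And>k. D k \<subseteq> M" "\<And>k. \<exists>k'. f ` D k = D k'"
    and geom: "\<And>k. 0 < ri k" "\<And>k. B (c k) (ri k) \<subseteq> D k" "\<And>k. D k \<subseteq> B (c k) (Ro k)" "\<And>k. Ro k \<le> \<beta> * ri k" "\<And>k. ri k \<le> Ro k"
    and small: "\<And>e. e > 0 \<Longrightarrow> finite {k. e \<le> Ro k}"
    and accumulate: "\<And>p r. p \<in> S \<Longrightarrow> r > 0 \<Longrightarrow> infinite {k. D k \<subseteq> B p r}"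
    and p: "p \<in> S"
  shows "\<exists>r>0. \<exists>\<Lambda>>0. \<forall>x\<in>B p r. \<forall>y\<in>B p r.
     \<Lambda> * d x y \<le> (2 * C\<^sup>2 + 128 * C ^ 6 * \<beta>\<^sup>2) * d ((f ^^ N) x) ((f ^^ N) y) \<and>
     d ((f ^^ N) x) ((f ^^ N) y) \<le> (2 * C\<^sup>2 + 128 * C ^ 6 * \<beta>\<^sup>2) * \<Lambda> * d x y"
proof -
  define F G where "F = f ^^ N" and "G = f' ^^ N"
  have pM: "p \<in> M" using p S by blast
  have F: "continuous_on M F" "F ` M \<subseteq> M"
    unfolding F_def using continuous_on_funpow[OF f(1,2)] funpow_in_M[OF f(2)] by blast+
  have G: "continuous_on M G" "G ` M \<subseteq> M"
    unfolding G_def using continuous_on_funpow[OF f'(1,2)] funpow_in_M[OF f'(2)] by blast+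
  have GF: "G (F x) = x" if "x \<in> M" for x
    unfolding F_def G_def
  proof (induction N)
    case (Suc n)
    have "(f' ^^ Suc n) ((f ^^ Suc n) x) = (f' ^^ n) (f' (f ((f ^^ n) x)))" by (simp add: funpow_swap1)
    then show ?case using inv(1)[OF funpow_in_M[OF f(2) that]] Suc by simp
  qed simp
  have FG: "F (G x) = x" if "x \<in> M" for x
    unfolding F_def G_def
  proof (induction N)
    case (Suc n)
    have "(f ^^ Suc n) ((f' ^^ Suc n) x) = (f ^^ n) (f (f' ((f' ^^ n) x)))" by (simp add: funpow_swap1)
    then show ?case using inv(2)[OF funpow_in_M[OF f'(2) that]] Suc by simp
  qed simp
  have FpM: "F p \<in> M" using F(2) pM by blast
  obtain T where T: "strict_deriv F p T" using strict_deriv_funpow[OF f pM] unfolding F_def by blast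
  obtain T' where T': "strict_deriv G (F p) T'" using strict_deriv_funpow[OF f' FpM] unfolding G_def by blast
  define L L' where "L = onorm T" and "L' = onorm T'"
  have L: "L > 0" unfolding L_def by (rule strict_deriv_nonzero[OF T F pM T' GF])
  have L': "L' > 0" unfolding L'_def
    by (rule strict_deriv_nonzero[OF T' G FpM _ FG]) (use T GF[OF pM] in simp)
  obtain r1 where r1: "r1 > 0" and
    lip: "\<And>x y. x \<in> B p r1 \<Longrightarrow> y \<in> B p r1 \<Longrightarrow> d (F x) (F y) \<le> 2 * L * C\<^sup>2 * d x y" and
    img: "\<And>x \<rho> q R. x \<in> B p r1 \<Longrightarrow> 0 < \<rho> \<Longrightarrow> \<rho> \<le> r1 \<Longrightarrow> q \<in> M \<Longrightarrow> F ` B x \<rho> \<subseteq> B q R \<Longrightarrow> L * \<rho> \<le> 8 * C\<^sup>2 * R"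
    using distortion_of_balls[OF T F pM L[unfolded L_def]] unfolding L_def by blast
  obtain r2 where r2: "r2 > 0" and
    lip': "\<And>x y. x \<in> B (F p) r2 \<Longrightarrow> y \<in> B (F p) r2 \<Longrightarrow> d (G x) (G y) \<le> 2 * L' * C\<^sup>2 * d x y" and
    img': "\<And>x \<rho> q R. x \<in> B (F p) r2 \<Longrightarrow> 0 < \<rho> \<Longrightarrow> \<rho> \<le> r2 \<Longrightarrow> q \<in> M \<Longrightarrow> G ` B x \<rho> \<subseteq> B q R \<Longrightarrow> L' * \<rho> \<le> 8 * C\<^sup>2 * R"
    using distortion_of_balls[OF T' G FpM L'[unfolded L'_def]] unfolding L'_def by blast
  obtain r3 where r3: "r3 > 0" "F ` B p r3 \<subseteq> B (F p) r2"
    by (rule continuous_at_ball[OF F pM r2(1)]) (rule that)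
  define r where "r = min r1 r3"
  have r: "r > 0" "B p r \<subseteq> B p r1" "B p r \<subseteq> B p r3" using r1 r3(1) by (auto simp: r_def in_ball)
  have FD: "\<exists>k'. F ` D k = D k'" for k
    unfolding F_def
  proof (induction N)
    case (Suc n)
    then obtain k' where "(f ^^ n) ` D k = D k'" by blast
    moreover obtain k'' where "f ` D k' = D k''" using D(4) by blast
    ultimately have "(f ^^ Suc n) ` D k = D k''" by (metis funpow.simps(2) image_comp)
    then show ?case by blast
  qed (simp, blast)
  then obtain \<sigma> where \<sigma>: "\<And>k. F ` D k = D (\<sigma> k)" by metis
  have "inj \<sigma>"
  proof (rule injI)
    fix k k' assume "\<sigma> k = \<sigma> k'"
    then have eq: "F ` D k = F ` D k'" by (simp add: \<sigma>)
    have "G ` F ` D k = D k" for k using D(3)[of k] GF by force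
    then have "D k = D k'" using eq by metis
    then show "k = k'" using D(1) by (simp add: inj_eq)
  qed
  have "finite {k. r2 \<le> Ro (\<sigma> k)}"
    using finite_vimageI[OF small[OF r2] \<open>inj \<sigma>\<close>] by (simp add: vimage_def)
  then have "infinite ({k. D k \<subseteq> B p r} - {k. r1 \<le> Ro k} - {k. r2 \<le> Ro (\<sigma> k)})"
    using accumulate[OF p r(1)] small[OF r1] by (intro Diff_infinite_finite)
  then obtain k where k: "D k \<subseteq> B p r" "Ro k < r1" "Ro (\<sigma> k) < r2"
    using not_finite_existsD by (metis (no_types, lifting) DiffE finite.emptyI ex_in_conv mem_Collect_eq not_le)
  have ri_Ro: "ri k \<le> Ro k" for k by (rule geom(5))
  define k' where "k' = \<sigma> k"
  have cM: "c k \<in> M" for k using D(2,3) by blast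
  have 1: "L * ri k \<le> 8 * C\<^sup>2 * Ro k'"
  proof (rule img[OF _ geom(1) _ cM])
    show "c k \<in> B p r1" using D(2) k(1) r(2) by blast
    show "ri k \<le> r1" using ri_Ro[of k] k(2) by simp
    show "F ` B (c k) (ri k) \<subseteq> B (c k') (Ro k')"
      using geom(2)[of k] geom(3)[of k'] \<sigma>[of k] unfolding k'_def by blast
  qed
  have 2: "L' * ri k' \<le> 8 * C\<^sup>2 * Ro k"
  proof (rule img'[OF _ geom(1) _ cM])
    have "D k' \<subseteq> B (F p) r2" using \<sigma>[of k] k(1) r(3) r3(2) unfolding k'_def by blast
    then show "c k' \<in> B (F p) r2" using D(2) by blast
    show "ri k' \<le> r2" using ri_Ro[of k'] k(3) by (simp add: k'_def)
    have "G ` D k' = D k" using D(3)[of k] GF \<sigma>[of k] unfolding k'_def by force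
    then show "G ` B (c k') (ri k') \<subseteq> B (c k) (Ro k)"
      using geom(2)[of k'] geom(3)[of k] by blast
  qed
  have ri: "ri k > 0" "ri k' > 0" using geom(1) by auto
  have Ro: "Ro k \<le> \<beta> * ri k" "Ro k' \<le> \<beta> * ri k'" "0 \<le> Ro k" "0 \<le> Ro k'"
    using geom(4) ri ri_Ro[of k] ri_Ro[of k'] by auto
  have "L * ri k \<le> 8 * C\<^sup>2 * (\<beta> * ri k')" "L' * ri k' \<le> 8 * C\<^sup>2 * (\<beta> * ri k)"
    using 1 2 Ro(1,2) by (auto elim!: order_trans intro!: mult_left_mono)
  then have "(L * ri k) * (L' * ri k') \<le> (8 * C\<^sup>2 * (\<beta> * ri k')) * (8 * C\<^sup>2 * (\<beta> * ri k))"
    by (rule mult_mono') (use L L' ri in auto)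
  then have "(L * L') * (ri k * ri k') \<le> (64 * C ^ 4 * \<beta>\<^sup>2) * (ri k * ri k')"
    by (simp add: power2_eq_square power4_eq_xxxx mult_ac)
  then have LL': "L * L' \<le> 64 * C ^ 4 * \<beta>\<^sup>2" using ri by simp
  define Q where "Q = 2 * C\<^sup>2 + 128 * C ^ 6 * \<beta>\<^sup>2"
  have Q: "2 * C\<^sup>2 \<le> Q" "128 * C ^ 6 * \<beta>\<^sup>2 \<le> Q" using C by (auto simp: Q_def)
  have "L * d x y \<le> Q * d (F x) (F y) \<and> d (F x) (F y) \<le> Q * L * d x y" if xy: "x \<in> B p r" "y \<in> B p r" for x y
  proof
    have M: "x \<in> M" "y \<in> M" "F x \<in> M" "F y \<in> M" using xy F(2) by (auto simp: in_ball)
    have nn: "0 \<le> d x y" "0 \<le> d (F x) (F y)" using nonneg M by auto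
    have "d (F x) (F y) \<le> 2 * L * C\<^sup>2 * d x y" using lip xy r(2) by blast
    also have "\<dots> = 2 * C\<^sup>2 * (L * d x y)" by simp
    also have "\<dots> \<le> Q * (L * d x y)" using Q(1) L nn by (intro mult_right_mono) auto
    finally show "d (F x) (F y) \<le> Q * L * d x y" by simp
    have "d x y \<le> 2 * L' * C\<^sup>2 * d (F x) (F y)"
      using lip'[of "F x" "F y"] r3(2) xy r(3) GF M(1,2) by force
    then have "L * d x y \<le> L * (2 * L' * C\<^sup>2 * d (F x) (F y))" using L by simp
    also have "\<dots> = 2 * C\<^sup>2 * (L * L') * d (F x) (F y)" by simp
    also have "\<dots> \<le> 2 * C\<^sup>2 * (64 * C ^ 4 * \<beta>\<^sup>2) * d (F x) (F y)"
      using LL' nn C by (intro mult_right_mono mult_left_mono) auto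
    also have "\<dots> = 128 * C ^ 6 * \<beta>\<^sup>2 * d (F x) (F y)" by (simp add: power_add[symmetric] flip: power_add)
    also have "\<dots> \<le> Q * d (F x) (F y)" using Q(2) nn by (intro mult_right_mono)
    finally show "L * d x y \<le> Q * d (F x) (F y)" .
  qed
  then show ?thesis unfolding F_def[symmetric] Q_def[symmetric] using r(1) L by blast
qed

end

section \<open>Strict differentiability\<close>

lemma hoelder_diff_on_imp_continuous_on: "hoelder_diff_on k s W F \<Longrightarrow> continuous_on W F"
  by (cases k) (auto intro: differentiable_imp_continuous_on)

lemma class_C_on_imp_C1:
  assumes "\<alpha> > 0" "class_C_on (1 + \<alpha>) W F"
  shows "F differentiable_on W" "continuous_on W (\<lambda>x. frechet_derivative F (at x) v)"
proof -
  have "nat \<lfloor>1 + \<alpha>\<rfloor> = Suc (nat \<lfloor>\<alpha>\<rfloor>)" using assms(1) by (simp add: nat_add_distrib)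
  then have h: "hoelder_diff_on (Suc (nat \<lfloor>\<alpha>\<rfloor>)) (frac (1 + \<alpha>)) W F"
    using assms(2) by (simp add: class_C_on_def)
  then show "F differentiable_on W" by simp
  show "continuous_on W (\<lambda>x. frechet_derivative F (at x) v)"
    by (rule hoelder_diff_on_imp_continuous_on[of "nat \<lfloor>\<alpha>\<rfloor>" "frac (1 + \<alpha>)"]) (use h in simp)
qed

text \<open>The mean value inequality, applied to the difference of the map and its derivative at \<open>z0\<close>.\<close>

lemma C1_imp_strictly_differentiable:
  fixes F :: "complex \<Rightarrow> complex"
  assumes W: "open W" "z0 \<in> W" and F: "F differentiable_on W"
    and cont: "\<And>v. continuous_on W (\<lambda>x. frechet_derivative F (at x) v)" and e: "e > 0"
  obtains r where "r > 0" "ball z0 r \<subseteq> W" "\<And>x y. x \<in> ball z0 r \<Longrightarrow> y \<in> ball z0 r \<Longrightarrow>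
    norm (F x - F y - frechet_derivative F (at z0) (x - y)) \<le> e * norm (x - y)"
proof -
  define L where "L = (\<lambda>z. frechet_derivative F (at z))"
  have der: "(F has_derivative L z) (at z)" if "z \<in> W" for z
    using F that W(1) unfolding L_def differentiable_on_eq_differentiable_at[OF W(1)]
    by (simp add: frechet_derivative_works)
  have near: "\<exists>r>0. \<forall>z\<in>ball z0 r. norm (L z v - L z0 v) < e / 2" for v
  proof -
    have "isCont (\<lambda>z. L z v) z0"
      using cont[of v] W unfolding L_def by (simp add: continuous_on_eq_continuous_at)
    then show ?thesis
      using e unfolding continuous_at_eps_delta by (metis dist_commute dist_norm half_gt_zero mem_ball)
  qed
  obtain r1 r2 where r: "r1 > 0" "r2 > 0" "\<forall>z\<in>ball z0 r1. norm (L z 1 - L z0 1) < e / 2"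
    "\<forall>z\<in>ball z0 r2. norm (L z \<i> - L z0 \<i>) < e / 2"
    using near[of 1] near[of \<i>] by blast
  obtain r3 where r3: "r3 > 0" "ball z0 r3 \<subseteq> W" using W openE by blast
  define r where "r = min r1 (min r2 r3)"
  have sub: "ball z0 r \<subseteq> ball z0 r1" "ball z0 r \<subseteq> ball z0 r2" "ball z0 r \<subseteq> ball z0 r3"
    by (auto simp: r_def)
  have lin: "linear (L z)" if "z \<in> W" for z using has_derivative_linear[OF der[OF that]] .
  have bound: "onorm (L z - L z0) \<le> e" if z: "z \<in> ball z0 r" for z
  proof (rule onorm_le)
    fix h :: complex
    have zW: "z \<in> W" using z sub r3 by blast
    have exp: "L z h = Re h *\<^sub>R L z 1 + Im h *\<^sub>R L z \<i>" if "z \<in> W" for z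
    proof -
      have "L z h = L z (Re h *\<^sub>R 1 + Im h *\<^sub>R \<i>)" by (rule arg_cong) (simp add: complex_eq_iff)
      then show ?thesis by (simp add: linear_add[OF lin[OF that]] linear_scale[OF lin[OF that]])
    qed
    have "(L z - L z0) h = Re h *\<^sub>R (L z 1 - L z0 1) + Im h *\<^sub>R (L z \<i> - L z0 \<i>)"
      using exp[OF zW] exp[OF W(2)] by (simp add: algebra_simps)
    also have "norm \<dots> \<le> norm h * (e / 2) + norm h * (e / 2)"
    proof (rule norm_triangle_le, rule add_mono)
      show "norm (Re h *\<^sub>R (L z 1 - L z0 1)) \<le> norm h * (e / 2)"
        unfolding norm_scaleR real_norm_def using bspec[OF r(3) subsetD[OF sub(1) z]] abs_Re_le_cmod[of h]
        by (intro mult_mono) (simp_all add: less_imp_le)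
      show "norm (Im h *\<^sub>R (L z \<i> - L z0 \<i>)) \<le> norm h * (e / 2)"
        unfolding norm_scaleR real_norm_def using bspec[OF r(4) subsetD[OF sub(2) z]] abs_Im_le_cmod[of h]
        by (intro mult_mono) (simp_all add: less_imp_le)
    qed
    finally show "norm ((L z - L z0) h) \<le> e * norm h" by (simp add: mult.commute)
  qed
  show ?thesis
  proof (rule that[of r])
    show "r > 0" using r(1,2) r3(1) by (simp add: r_def)
    then have z0: "z0 \<in> ball z0 r" by simp
    show "ball z0 r \<subseteq> W" using sub(3) r3(2) by (rule order_trans)
    fix x y assume xy: "x \<in> ball z0 r" "y \<in> ball z0 r"
    have "norm (F x - F y - L z0 (x - y)) \<le> norm (x - y) * e"
    proof (rule differentiable_bound_linearization[where S = "ball z0 r" and f' = L, OF _ _ bound z0])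
      fix t :: real assume "t \<in> {0..1}"
      then have "(1 - t) *\<^sub>R y + t *\<^sub>R x \<in> ball z0 r" using convexD[OF convex_ball xy(2,1), of "1 - t" t] by simp
      then show "y + t *\<^sub>R (x - y) \<in> ball z0 r" by (simp add: algebra_simps)
    next
      fix z assume "z \<in> ball z0 r"
      then have "z \<in> W" using sub(3) r3(2) by blast
      then show "(F has_derivative L z) (at z within ball z0 r)" using der has_derivative_at_withinI by blast
    qed
    then show "norm (F x - F y - frechet_derivative F (at z0) (x - y)) \<le> e * norm (x - y)"
      by (simp add: L_def mult.commute)
  qed
qed

section \<open>Accumulation of the domains\<close>

context compact_distance
begin

context
  fixes f :: "'a \<Rightarrow> 'a" and S :: "'a set" and D :: "int \<Rightarrow> 'a set"
  assumes perm: "permutes_dense_domains M f S D" and conn: "connected M"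
begin

lemma closure_meets:
  "x \<in> closure_in M X \<Longrightarrow> openin (top_of_set M) U \<Longrightarrow> x \<in> U \<Longrightarrow> \<exists>y\<in>X. y \<in> U"
  unfolding in_closure_of by meson

lemma domains_complementary: "complementary_domains M S D"
  using perm by (simp add: permutes_dense_domains_def)

lemma domains_inj: "inj D" and S_subset: "S \<subseteq> M" and S_compact: "compact S"
  and domains_components: "range D = components (M - S)"
  and domains_regular: "interior_in M (closure_in M (D k)) = D k"
  using domains_complementary by (simp_all add: complementary_domains_def)

lemma domain_component: "D k \<in> components (M - S)"
  using domains_components by blast

lemma domain_subset: "D k \<subseteq> M - S"
  by (rule in_components_subset[OF domain_component])

lemma domain_nonempty: "D k \<noteq> {}"
  by (rule in_components_nonempty[OF domain_component])

lemma domain_open: "openin (top_of_set M) (D k)"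
  using openin_interior_of[of "top_of_set M" "closure_in M (D k)"] domains_regular by simp

lemma domains_cover: "M = S \<union> (\<Union>k. D k)"
  using Union_components[of "M - S"] domains_components S_subset by auto

lemma domain_subset_closure: "D k \<subseteq> closure_in M (D k)"
  by (rule closure_of_subset) (use domain_subset in auto)

lemma closure_subset: "closure_in M X \<subseteq> M"
  using closure_of_subset_topspace[of "top_of_set M" X] by simp

lemma closures_disjoint: "k \<noteq> k' \<Longrightarrow> closure_in M (D k) \<inter> closure_in M (D k') = {}"
  using perm by (simp add: permutes_dense_domains_def)

lemma domains_disjoint:
  assumes "k \<noteq> k'"
  shows "D k \<inter> D k' = {}"
proof -
  have "D k \<inter> D k' \<subseteq> closure_in M (D k) \<inter> closure_in M (D k')"
    by (rule Int_mono) (rule domain_subset_closure)+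
  also have "\<dots> = {}" by (rule closures_disjoint[OF assms])
  finally show ?thesis by (simp only: subset_empty)
qed

lemma domains_dense:
  assumes "openin (top_of_set M) U" "x \<in> U"
  obtains k where "D k \<inter> U \<noteq> {}"
proof -
  have "closure_in M (\<Union>k. D k) = M" using perm by (simp add: permutes_dense_domains_def)
  moreover have "x \<in> M" by (rule subsetD[OF openin_imp_subset[OF assms(1)] assms(2)])
  ultimately have "x \<in> closure_in M (\<Union>k. D k)" by simp
  from closure_meets[OF this assms] show ?thesis using that by blast
qed

lemma wandering: "n > 0 \<Longrightarrow> (f ^^ n) ` D k \<inter> D k = {}"
proof -
  assume n: "n > 0"
  have "int_iterate M f (int n) ` D k \<inter> D k = {}"
    using perm n unfolding permutes_dense_domains_def by (metis of_nat_0_less_iff less_numeral_extra(3))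
  then show ?thesis by (simp add: int_iterate_def)
qed

lemma homeomorphism_permutes_domains:
  assumes "homeomorphism M M f f'"
  shows "\<exists>k'. f ` D k = D k'"
proof -
  have fM: "f ` M = M" "f' ` M = M" "\<And>x. x \<in> M \<Longrightarrow> f' (f x) = x" "\<And>x. x \<in> M \<Longrightarrow> f (f' x) = x"
    and cont: "continuous_on M f" "continuous_on M f'"
    using assms by (auto simp: homeomorphism_def)
  have fS: "f ` S = S" using perm by (simp add: permutes_dense_domains_def)
  have into: "\<exists>k'. h ` D k \<subseteq> D k'"
    if h: "continuous_on M h" "h ` (M - S) \<subseteq> M - S" for h k
  proof -
    have "connected (h ` D k)"
      by (rule connected_continuous_image[OF continuous_on_subset[OF h(1)] in_components_connected[OF domain_component]])
        (use domain_subset in blast)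
    moreover have "h ` D k \<subseteq> M - S" using h(2) domain_subset by blast
    moreover have "M - S \<noteq> {}" using domain_subset domain_nonempty by blast
    ultimately obtain X where "X \<in> components (M - S)" "h ` D k \<subseteq> X"
      using exists_component_superset by metis
    then show ?thesis unfolding domains_components[symmetric] by blast
  qed
  have f'S: "f' ` S = S"
  proof -
    have "f' ` S = f' ` f ` S" using fS by simp
    also have "\<dots> = S" using fM(3) S_subset by force
    finally show ?thesis .
  qed
  have fMS: "f ` (M - S) \<subseteq> M - S"
  proof (rule image_subsetI)
    fix x assume x: "x \<in> M - S"
    have "f x \<notin> S" using f'S fM(3)[of x] x by force
    then show "f x \<in> M - S" using fM(1) x by blast
  qed
  have f'MS: "f' ` (M - S) \<subseteq> M - S"
  proof (rule image_subsetI)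
    fix x assume x: "x \<in> M - S"
    have "f' x \<notin> S" using fS fM(4)[of x] x by force
    then show "f' x \<in> M - S" using fM(2) x by blast
  qed
  obtain k' where k': "f ` D k \<subseteq> D k'" using into[OF cont(1) fMS] by blast
  obtain k'' where k'': "f' ` D k' \<subseteq> D k''" using into[OF cont(2) f'MS] by blast
  have "D k \<subseteq> D k''"
  proof
    fix x assume x: "x \<in> D k"
    then have "f' (f x) \<in> D k''" using k' k'' by blast
    moreover have "x \<in> M" using x domain_subset by blast
    ultimately show "x \<in> D k''" using fM(3) by simp
  qed
  then have "k'' = k" using domains_disjoint[of k k''] domain_nonempty[of k] by blast
  have "D k' \<subseteq> f ` D k"
  proof
    fix x assume x: "x \<in> D k'"
    then have "f' x \<in> D k" using k'' \<open>k'' = k\<close> by blast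
    moreover have "f (f' x) = x" using fM(4)[of x] x domain_subset by blast
    ultimately show "x \<in> f ` D k" by (metis imageI)
  qed
  then show ?thesis using k' by blast
qed

text \<open>Otherwise the domain is open and closed, hence all of \<open>M\<close>, and cannot be disjoint from its image.\<close>

lemma domain_has_boundary_point:
  assumes fM: "f ` M = M"
  shows "closure_in M (D k) \<inter> S \<noteq> {}"
proof
  assume no: "closure_in M (D k) \<inter> S = {}"
  have "closure_in M (D k) \<subseteq> D k"
  proof
    fix x assume x: "x \<in> closure_in M (D k)"
    then have "x \<in> M" "x \<notin> S" using closure_subset no by blast+
    then obtain j where j: "x \<in> D j" using domains_cover by blast
    then have "x \<in> closure_in M (D j)" using domain_subset_closure by blast
    then have "j = k" using x closures_disjoint[of j k] by blast
    then show "x \<in> D k" using j by simp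
  qed
  then have "closure_in M (D k) = D k" using domain_subset_closure by blast
  then have "closedin (top_of_set M) (D k)" using closedin_closure_of[of "top_of_set M" "D k"] by simp
  then have "D k = M"
    using conn domain_open[of k] domain_nonempty[of k] unfolding connected_clopen by blast
  then show False using wandering[of 1 k] fM domain_nonempty[of k] by simp
qed

text \<open>A neighbourhood of \<open>p\<close> is not contained in \<open>S\<close> and the closures of finitely many domains: \<open>p\<close>
  lies in at most one of these closures, and if it lies in the closure of \<open>D k\<close>, it is not an
  interior point of it because \<open>D k\<close> is the interior of its closure.\<close>

lemma domains_accumulate:
  assumes p: "p \<in> S" and X: "finite X" and U: "openin (top_of_set M) U" "p \<in> U"
  obtains k where "k \<notin> X" "D k \<inter> U \<noteq> {}"
proof -
  define V where "V = U - (\<Union>k\<in>{k \<in> X. p \<notin> closure_in M (D k)}. closure_in M (D k))"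
  have "closedin (top_of_set M) (\<Union>k\<in>{k \<in> X. p \<notin> closure_in M (D k)}. closure_in M (D k))"
    by (rule closedin_Union) (use X in auto)
  then have V: "openin (top_of_set M) V" "p \<in> V" unfolding V_def using U openin_diff by auto
  have avoid: "k \<notin> X \<or> p \<in> closure_in M (D k)" if "D k \<inter> V \<noteq> {}" for k
    using that domain_subset_closure[of k] unfolding V_def by blast
  show ?thesis
  proof (cases "\<exists>k. p \<in> closure_in M (D k)")
    case True
    then obtain k0 where k0: "p \<in> closure_in M (D k0)" by blast
    have "\<not> V \<subseteq> closure_in M (D k0)"
    proof
      assume "V \<subseteq> closure_in M (D k0)"
      then have "p \<in> interior_in M (closure_in M (D k0))" using V unfolding interior_of_def by blast
      then show False using domains_regular domain_subset p by blast
    qed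
    then obtain x where x: "x \<in> V - closure_in M (D k0)" by blast
    have "openin (top_of_set M) (V - closure_in M (D k0))" by (rule openin_diff[OF V(1)]) simp
    from domains_dense[OF this x] obtain k where k: "D k \<inter> (V - closure_in M (D k0)) \<noteq> {}" by blast
    then have "k \<noteq> k0" using domain_subset_closure by blast
    then have "p \<notin> closure_in M (D k)" using closures_disjoint[of k k0] k0 by blast
    then have "k \<notin> X" using avoid[of k] k by blast
    then show ?thesis using that[of k] k unfolding V_def by blast
  next
    case False
    from domains_dense[OF V] obtain k where k: "D k \<inter> V \<noteq> {}" by blast
    then have "k \<notin> X" using avoid False by blast
    then show ?thesis using that[of k] k unfolding V_def by blast
  qed
qed

context
  fixes c :: "int \<Rightarrow> 'a" and ri Ro :: "int \<Rightarrow> real" and \<beta> :: real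
  assumes center: "c k \<in> D k" and ri: "0 < ri k" and ri_Ro: "ri k \<le> Ro k"
    and inner: "B (c k) (ri k) \<subseteq> D k" and outer: "D k \<subseteq> B (c k) (Ro k)"
    and ratio: "Ro k \<le> \<beta> * ri k"
begin

lemma center_in_M: "c k \<in> M"
  using center[of k] domain_subset[of k] by blast

lemma Ro_pos: "Ro k > 0"
  using ri[of k] ri_Ro[of k] by linarith

text \<open>The centres of domains with \<open>Ro k \<ge> e\<close> have pairwise distance at least \<open>e / \<beta>\<close>: each is outside
  the inner balls of the others.\<close>

lemma finitely_many_large_domains:
  assumes "e > 0"
  shows "finite {k. e \<le> Ro k}"
proof -
  have \<beta>: "\<beta> > 0"
  proof (rule ccontr)
    assume "\<not> \<beta> > 0"
    then have "\<beta> * ri 0 \<le> 0" using ri[of 0] by (simp add: mult_nonpos_nonneg less_imp_le)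
    then show False using ratio[of 0] Ro_pos[of 0] by linarith
  qed
  have "finite (c ` {k. e \<le> Ro k})"
  proof (rule finite_if_separated[of "e / \<beta>"])
    fix x y assume "x \<in> c ` {k. e \<le> Ro k}" "y \<in> c ` {k. e \<le> Ro k}" "x \<noteq> y"
    then obtain j k where jk: "x = c j" "y = c k" "e \<le> Ro j" "j \<noteq> k" by blast
    have "y \<notin> D j" using center[of k] domains_disjoint[OF jk(4)] jk(2) by blast
    then have "y \<notin> B (c j) (ri j)" using inner by blast
    then have "ri j \<le> d x y" using center_in_M jk by (simp add: in_ball not_less)
    moreover have "e / \<beta> \<le> ri j" using ratio[of j] jk(3) \<beta> by (simp add: field_simps)
    ultimately show "e / \<beta> \<le> d x y" by linarith
  qed (use assms \<beta> center_in_M in auto)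
  moreover have "inj_on c {k. e \<le> Ro k}"
    by (rule inj_onI) (metis center domains_disjoint disjoint_iff)
  ultimately show ?thesis by (rule finite_imageD)
qed

lemma finitely_many_large_closures:
  assumes "e > 0"
  shows "finite {k. \<exists>x\<in>closure_in M (D k). \<exists>y\<in>closure_in M (D k). e \<le> d x y}"
proof (rule finite_subset)
  show "finite {k. e / 4 \<le> Ro k}" by (rule finitely_many_large_domains) (use assms in simp)
  have near: "x \<in> M \<and> d x (c k) < 2 * Ro k" if x: "x \<in> closure_in M (D k)" for x k
  proof -
    have xM: "x \<in> M" using x closure_subset by blast
    obtain y where y: "y \<in> D k" "y \<in> B x (Ro k)"
      using closure_meets[OF x ball_open[OF xM] center_in_ball[OF xM Ro_pos]] by meson
    have "y \<in> B (c k) (Ro k)" using outer y by blast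
    then have "d x (c k) < 2 * Ro k"
      using y(2) triangle[OF xM _ center_in_M, of y k] commute[of y "c k"] by (simp add: in_ball)
    then show ?thesis using xM by simp
  qed
  show "{k. \<exists>x\<in>closure_in M (D k). \<exists>y\<in>closure_in M (D k). e \<le> d x y} \<subseteq> {k. e / 4 \<le> Ro k}"
  proof
    fix k assume "k \<in> {k. \<exists>x\<in>closure_in M (D k). \<exists>y\<in>closure_in M (D k). e \<le> d x y}"
    then obtain x y where "x \<in> closure_in M (D k)" "y \<in> closure_in M (D k)" "e \<le> d x y" by blast
    then have "e < 4 * Ro k"
      using near[of x k] near[of y k] triangle[of x "c k" y] center_in_M[of k] commute[of y "c k"] by simp
    then show "k \<in> {k. e / 4 \<le> Ro k}" by simp
  qed
qed

lemma infinitely_many_domains_near: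
  assumes p: "p \<in> S" and r: "r > 0"
  shows "infinite {k. D k \<subseteq> B p r}"
proof
  assume fin: "finite {k. D k \<subseteq> B p r}"
  have pM: "p \<in> M" using p S_subset by blast
  have r2: "r / 2 > 0" using r by simp
  have fin': "finite ({k. D k \<subseteq> B p r} \<union> {k. r / 4 \<le> Ro k})"
    using fin finitely_many_large_domains[of "r / 4"] r by simp
  obtain k where k: "k \<notin> {k. D k \<subseteq> B p r} \<union> {k. r / 4 \<le> Ro k}" "D k \<inter> B p (r / 2) \<noteq> {}"
    by (rule domains_accumulate[OF p fin' ball_open[OF pM] center_in_ball[OF pM r2]]) (rule that)
  obtain y where y: "y \<in> D k" "y \<in> M" "d p y < r / 2" using k(2) by (auto simp: in_ball)
  have small: "Ro k < r / 4" using k(1) by simp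
  have "D k \<subseteq> B p r"
  proof
    fix x assume "x \<in> D k"
    then have x: "x \<in> M" "d (c k) x < Ro k" using outer[of k] by (auto simp: in_ball)
    have y': "d (c k) y < Ro k" using outer[of k] y by (auto simp: in_ball)
    have "d p x \<le> d p y + (d (c k) y + d (c k) x)"
      using triangle[OF pM y(2) x(1)] triangle[OF y(2) center_in_M x(1), of k] commute[of y "c k"] by linarith
    then show "x \<in> B p r" using x y y' small by (simp add: in_ball)
  qed
  then show False using k(1) by simp
qed

end

end

end

section \<open>Coordinates on closed surfaces\<close>

context closed_surface
begin

lemma compact_distance_rdist: "compact_distance M rdist"
  by unfold_locales
    (use compact rdist_nonneg rdist_self rdist_commute rdist_triangle dist_ball_open dist_ball_subset_openin in auto)

text \<open>By compactness, finitely many charts suffice, and a common bound for their constants serves all points.\<close>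

lemma uniform_coordinates:
  obtains ch :: "'a \<Rightarrow> 'a chart" and C :: real where "C \<ge> 1" "\<And>p. p \<in> M \<Longrightarrow> ch p \<in> A" "\<And>p. p \<in> M \<Longrightarrow> p \<in> fst (ch p)"
    "\<And>p. p \<in> M \<Longrightarrow> \<exists>r>0. \<forall>x\<in>dist_ball M rdist p r. \<forall>y\<in>dist_ball M rdist p r.
       norm (snd (ch p) x - snd (ch p) y) \<le> C * rdist x y \<and> rdist x y \<le> C * norm (snd (ch p) x - snd (ch p) y)"
proof -
  interpret dist: compact_distance M rdist by (rule compact_distance_rdist)
  define Q where "Q = (\<lambda>p (c :: 'a chart) U (K :: real). c \<in> A \<and> openin (top_of_set M) U \<and> p \<in> U \<and> U \<subseteq> fst c \<and> K \<ge> 1 \<and>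
    (\<forall>x\<in>U. \<forall>y\<in>U. norm (snd c x - snd c y) \<le> K * rdist x y \<and> rdist x y \<le> K * norm (snd c x - snd c y)))"
  have "\<forall>p\<in>M. \<exists>c U K. Q p c U K"
  proof
    fix p assume p: "p \<in> M"
    obtain c U K where "c \<in> A" "openin (top_of_set M) U" "p \<in> U" "U \<subseteq> fst c" "K \<ge> 1"
      "\<And>x y. x \<in> U \<Longrightarrow> y \<in> U \<Longrightarrow> norm (snd c x - snd c y) \<le> K * rdist x y"
      "\<And>x y. x \<in> U \<Longrightarrow> y \<in> U \<Longrightarrow> rdist x y \<le> K * norm (snd c x - snd c y)"
      by (rule rdist_comparable_in_chart[OF p]) (rule that)
    then have "Q p c U K" by (simp add: Q_def)
    then show "\<exists>c U K. Q p c U K" by blast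
  qed
  then obtain c U K where Q: "\<And>p. p \<in> M \<Longrightarrow> Q p (c p) (U p) (K p)" by metis
  have cU: "\<And>p. p \<in> M \<Longrightarrow> c p \<in> A" "\<And>p. p \<in> M \<Longrightarrow> openin (top_of_set M) (U p)"
    "\<And>p. p \<in> M \<Longrightarrow> p \<in> U p" "\<And>p. p \<in> M \<Longrightarrow> U p \<subseteq> fst (c p)" "\<And>p. p \<in> M \<Longrightarrow> K p \<ge> (1::real)" and
    cmp: "\<And>p x y. p \<in> M \<Longrightarrow> x \<in> U p \<Longrightarrow> y \<in> U p \<Longrightarrow>
       norm (snd (c p) x - snd (c p) y) \<le> K p * rdist x y \<and> rdist x y \<le> K p * norm (snd (c p) x - snd (c p) y)"
    using Q unfolding Q_def by blast+
  have "\<forall>p\<in>M. \<exists>r>0. dist_ball M rdist p r \<subseteq> U p"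
    using dist_ball_subset_openin[OF cU(2) cU(3)] by blast
  then obtain r where r: "\<And>p. p \<in> M \<Longrightarrow> r p > 0" "\<And>p. p \<in> M \<Longrightarrow> dist_ball M rdist p (r p) \<subseteq> U p"
    by metis
  obtain F where F: "finite F" "F \<subseteq> M" "M \<subseteq> (\<Union>p\<in>F. dist_ball M rdist p (r p))"
    using dist.finite_ball_cover[OF compact subset_refl, of r] r(1) by auto
  have "\<forall>q\<in>M. \<exists>p. p \<in> F \<and> q \<in> U p" using F r(2) by blast
  then obtain i where i: "\<And>q. q \<in> M \<Longrightarrow> i q \<in> F" "\<And>q. q \<in> M \<Longrightarrow> q \<in> U (i q)" by metis
  define C where "C = 1 + (\<Sum>p\<in>F. K p)"
  have K_nonneg: "K p \<ge> 0" if "p \<in> F" for p using cU(5)[of p] F(2) that by force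
  have K_le: "K p \<le> C" if "p \<in> F" for p
    using member_le_sum[of p F K] that F(1) K_nonneg by (simp add: C_def)
  show ?thesis
  proof (rule that[of C "\<lambda>q. c (i q)"])
    show "1 \<le> C" using K_nonneg by (simp add: C_def sum_nonneg)
    fix q assume q: "q \<in> M"
    have iM: "i q \<in> M" using i(1)[OF q] F(2) by blast
    show "c (i q) \<in> A" using cU(1)[OF iM] .
    show "q \<in> fst (c (i q))" using cU(4)[OF iM] i(2)[OF q] by blast
    obtain s where s: "s > 0" "dist_ball M rdist q s \<subseteq> U (i q)"
      using dist_ball_subset_openin[OF cU(2)[OF iM] i(2)[OF q]] by blast
    have "norm (snd (c (i q)) x - snd (c (i q)) y) \<le> C * rdist x y \<and>
       rdist x y \<le> C * norm (snd (c (i q)) x - snd (c (i q)) y)"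
      if xy: "x \<in> dist_ball M rdist q s" "y \<in> dist_ball M rdist q s" for x y
    proof -
      have U: "x \<in> U (i q)" "y \<in> U (i q)" using xy s(2) by auto
      have "K (i q) * rdist x y \<le> C * rdist x y"
        using xy K_le[OF i(1)[OF q]] rdist_nonneg by (intro mult_right_mono) (auto simp: dist_ball_def)
      moreover have "K (i q) * norm (snd (c (i q)) x - snd (c (i q)) y) \<le> C * norm (snd (c (i q)) x - snd (c (i q)) y)"
        using K_le[OF i(1)[OF q]] by (intro mult_right_mono) auto
      ultimately show ?thesis using cmp[OF iM U] by linarith
    qed
    then show "\<exists>s>0. \<forall>x\<in>dist_ball M rdist q s. \<forall>y\<in>dist_ball M rdist q s.
       norm (snd (c (i q)) x - snd (c (i q)) y) \<le> C * rdist x y \<and>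
       rdist x y \<le> C * norm (snd (c (i q)) x - snd (c (i q)) y)"
      using s(1) by blast
  qed
qed

lemma chart_image_of_ball:
  assumes c: "c \<in> A" "p \<in> fst c" and r: "r > 0"
  shows "\<exists>s>0. ball (snd c p) s \<subseteq> snd c ` dist_ball M rdist p r"
proof -
  have pM: "p \<in> M" using chart_subset c by blast
  have "openin (top_of_set M) (fst c \<inter> dist_ball M rdist p r)"
    by (rule openin_Int[OF chart_domain_open[OF c(1)] dist_ball_open[OF pM]])
  then have "open (snd c ` (fst c \<inter> dist_ball M rdist p r))"
    by (rule open_chart_image[OF c(1)]) simp
  moreover have "snd c p \<in> snd c ` (fst c \<inter> dist_ball M rdist p r)"
    using c r pM rdist_self by (auto simp: dist_ball_def)
  ultimately obtain s where "s > 0" "ball (snd c p) s \<subseteq> snd c ` (fst c \<inter> dist_ball M rdist p r)"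
    unfolding open_contains_ball by meson
  then show ?thesis by blast
qed

lemma class_C_strictly_differentiable:
  assumes \<alpha>: "\<alpha> > 0" and F: "surface_map_class_C (1 + \<alpha>) A A F" "continuous_on M F" "F ` M \<subseteq> M"
    and c: "c \<in> A" "p \<in> fst c" and c': "c' \<in> A" "F p \<in> fst c'"
  obtains T where "bounded_linear T"
    "\<And>e. e > 0 \<Longrightarrow> \<exists>r>0. \<forall>x\<in>dist_ball M rdist p r. \<forall>y\<in>dist_ball M rdist p r.
      norm (snd c' (F x) - snd c' (F y) - T (snd c x - snd c y)) \<le> e * norm (snd c x - snd c y)"
proof -
  define W where "W = chart_rep_dom c c' F"
  define R where "R = chart_rep c c' F"
  have W: "open W" unfolding W_def by (rule open_chart_rep_dom[OF c(1) c'(1) F(2,3)])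
  have z0: "snd c p \<in> W" using c c' by (auto simp: W_def chart_rep_dom_def)
  have "class_C_on (1 + \<alpha>) W R" using F(1) c c' unfolding surface_map_class_C_def W_def R_def by blast
  note C1 = class_C_on_imp_C1[OF \<alpha> this]
  define T where "T = frechet_derivative R (at (snd c p))"
  have "R differentiable at (snd c p)"
    using C1(1) z0 unfolding differentiable_on_eq_differentiable_at[OF W] by blast
  then have "bounded_linear T"
    unfolding T_def frechet_derivative_works by (rule has_derivative_bounded_linear)
  moreover have "\<exists>r>0. \<forall>x\<in>dist_ball M rdist p r. \<forall>y\<in>dist_ball M rdist p r.
      norm (snd c' (F x) - snd c' (F y) - T (snd c x - snd c y)) \<le> e * norm (snd c x - snd c y)"
    if e: "e > 0" for e
  proof -
    obtain s where s: "s > 0" "\<And>x y. x \<in> ball (snd c p) s \<Longrightarrow> y \<in> ball (snd c p) s \<Longrightarrow>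
      norm (R x - R y - T (x - y)) \<le> e * norm (x - y)"
      using C1_imp_strictly_differentiable[OF W z0 C1 e] unfolding T_def by metis
    have "p \<in> {q \<in> fst c. snd c q \<in> ball (snd c p) s}" using c s(1) by simp
    from dist_ball_subset_openin[OF open_chart_preimage[OF c(1) open_ball] this]
    obtain r where r: "r > 0" "dist_ball M rdist p r \<subseteq> {q \<in> fst c. snd c q \<in> ball (snd c p) s}"
      by blast
    have "norm (snd c' (F x) - snd c' (F y) - T (snd c x - snd c y)) \<le> e * norm (snd c x - snd c y)"
      if "x \<in> dist_ball M rdist p r" "y \<in> dist_ball M rdist p r" for x y
    proof -
      have "x \<in> fst c" "y \<in> fst c" "snd c x \<in> ball (snd c p) s" "snd c y \<in> ball (snd c p) s"
        using that r(2) by auto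
      then show ?thesis
        using s(2)[of "snd c x" "snd c y"] by (simp add: R_def chart_rep_apply[OF c(1)])
    qed
    then show ?thesis using r(1) by blast
  qed
  ultimately show ?thesis by (rule that)
qed

end

section \<open>Zero entropy\<close>

theorem theoremA:
  fixes M S :: "'a::t2_space set" and A :: "'a chart set" and g :: "'a metric_tensor"
    and f :: "'a \<Rightarrow> 'a" and D :: "int \<Rightarrow> 'a set" and \<alpha> :: real
  assumes "closed_surface M A g"
    and "\<alpha> > 0"
    and "f \<in> Diff (1 + \<alpha>) M A"
    and "permutes_dense_domains M f S D"
    and "bounded_geometry M (riemannian_dist A g) D"
  shows "topological_entropy M (riemannian_dist A g) f = 0"
proof -
  interpret closed_surface M A g by (rule assms(1))
  obtain ch C where C: "C \<ge> (1::real)" and ch: "\<And>p. p \<in> M \<Longrightarrow> ch p \<in> A" "\<And>p. p \<in> M \<Longrightarrow> p \<in> fst (ch p)"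
    and cmp: "\<And>p. p \<in> M \<Longrightarrow> \<exists>r>0. \<forall>x\<in>dist_ball M rdist p r. \<forall>y\<in>dist_ball M rdist p r.
       norm (snd (ch p) x - snd (ch p) y) \<le> C * rdist x y \<and> rdist x y \<le> C * norm (snd (ch p) x - snd (ch p) y)"
    by (rule uniform_coordinates) (rule that)
  interpret planar_distance M rdist "\<lambda>p. snd (ch p)" C
    by (intro planar_distance.intro planar_distance_axioms.intro compact_distance_rdist C cmp
        chart_image_of_ball ch)
  obtain f' where hom: "homeomorphism M M f f'" and smooth: "surface_map_class_C (1 + \<alpha>) A A f"
    "surface_map_class_C (1 + \<alpha>) A A f'"
    using assms(3) unfolding Diff_def by blast
  have f: "continuous_on M f" "f ` M = M" "\<And>x. x \<in> M \<Longrightarrow> f' (f x) = x"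
    and f': "continuous_on M f'" "f' ` M = M" "\<And>x. x \<in> M \<Longrightarrow> f (f' x) = x"
    using hom by (auto simp: homeomorphism_def)
  have fM: "f ` M \<subseteq> M" and f'M: "f' ` M \<subseteq> M" using f(2) f'(2) by auto
  have invariant: "\<exists>k'. f ` D k \<subseteq> D k'" for k
    using homeomorphism_permutes_domains[OF assms(4) connected hom, of k] by blast
  have diff: "\<exists>T. strict_deriv h p T"
    if h: "surface_map_class_C (1 + \<alpha>) A A h" "continuous_on M h" "h ` M = M" and p: "p \<in> M" for h p
  proof -
    have hM: "h ` M \<subseteq> M" "h p \<in> M" using h(3) p by auto
    obtain T where "bounded_linear T" "\<And>e. e > 0 \<Longrightarrow> \<exists>r>0. \<forall>x\<in>B p r. \<forall>y\<in>B p r.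
      norm (snd (ch (h p)) (h x) - snd (ch (h p)) (h y) - T (snd (ch p) x - snd (ch p) y))
        \<le> e * norm (snd (ch p) x - snd (ch p) y)"
      by (rule class_C_strictly_differentiable[OF assms(2) h(1,2) hM(1) ch(1)[OF p] ch(2)[OF p] ch(1)[OF hM(2)] ch(2)[OF hM(2)]])
        (rule that)
    then show ?thesis unfolding strict_deriv_def by blast
  qed
  note perm = assms(4)
  obtain \<beta> where "\<forall>k. \<exists>p\<in>D k. \<exists>r R. 0 < r \<and> r \<le> R \<and> B p r \<subseteq> D k \<and> D k \<subseteq> B p R \<and> R / r \<le> \<beta>"
    using assms(5) unfolding bounded_geometry_def by blast
  then obtain c ri Ro where geom: "\<And>k. c k \<in> D k" "\<And>k. 0 < ri k" "\<And>k. ri k \<le> Ro k" "\<And>k. B (c k) (ri k) \<subseteq> D k"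
    "\<And>k. D k \<subseteq> B (c k) (Ro k)" "\<And>k. Ro k / ri k \<le> \<beta>"
    by metis
  have ratio: "Ro k \<le> \<beta> * ri k" for k using geom(2,6)[of k] by (simp add: field_simps)
  note geom' = perm connected geom(1-5) ratio
  have DM: "D k \<subseteq> M" for k using domain_subset[OF perm connected] by blast
  have S: "compact S" "S \<subseteq> M" "f ` S \<subseteq> S"
    using S_compact[OF perm connected] S_subset[OF perm connected] perm
    by (auto simp: permutes_dense_domains_def)
  define K where "K = 2 * C\<^sup>2 + 128 * C ^ 6 * \<beta>\<^sup>2"
  have "1 \<le> C\<^sup>2" using C by simp
  moreover have "0 \<le> 128 * C ^ 6 * \<beta>\<^sup>2" using C by simp
  ultimately have K: "K \<ge> 1" unfolding K_def by linarith
  have conf: "\<exists>r>0. \<exists>\<Lambda>>0. \<forall>x\<in>B p r. \<forall>y\<in>B p r. \<Lambda> * rdist x y \<le> K * rdist ((f ^^ N) x) ((f ^^ N) y) \<and>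
     rdist ((f ^^ N) x) ((f ^^ N) y) \<le> K * \<Lambda> * rdist x y" if "p \<in> S" for N p
    unfolding K_def
    by (rule uniformly_quasiconformal_iterates[OF f(1) fM diff[OF smooth(1) f(1,2)] f'(1) f'M
          diff[OF smooth(2) f'(1,2)] f(3) f'(3) S(2) domains_inj[OF perm connected] geom(1) DM
          homeomorphism_permutes_domains[OF perm connected hom] geom(2,4,5) ratio geom(3)
          finitely_many_large_domains[OF geom'] infinitely_many_domains_near[OF geom'] that])
  show ?thesis
  proof (rule topological_entropy_eq_0)
    fix \<epsilon> q :: real assume \<epsilon>_q: "\<epsilon> > 0" "q > 1"
    show "\<exists>a>0. \<exists>c::nat. \<forall>n\<ge>1. \<forall>U. finite U \<longrightarrow> separated_set M rdist f n \<epsilon> U \<longrightarrow>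
       real (card U) \<le> a * real (n + 1) ^ c * q ^ n"
      by (rule few_separated_points[OF f(1) fM f'(1) f'M f(3) S K conf domains_cover[OF perm connected]
          invariant wandering[OF perm connected] domain_has_boundary_point[OF perm connected f(2)]
          finitely_many_large_closures[OF geom'] \<epsilon>_q])
  qed
qed

end
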